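(* Let $A$ be a free Perm algebra, i.e. $A\cong\mathrm{Perm}\langle X\rangle$ for some set $X$, let $(P,\cdot_P)$ be a pre-Lie algebra, and let $N$ be a $P$-bimodule. Given the canonical embedding of cochain complexes $$\Psi: C^*_{\mathrm{Pre}}(P,N)\hookrightarrow C^*_{\mathrm{Lie}}(A\otimes P,A\otimes N)$$ (the map $\Psi$ defined in the context), we obtain a short exact sequence of complexes $$0\to C^*_{\mathrm{Pre}}(P,N)\hookrightarrow C^*_{\mathrm{Lie}}(A\otimes P,A\otimes N)\to Q^*\to 0,$$ where $Q^*=C^*_{\mathrm{Lie}}(A\otimes P,A\otimes N)/C^*_{\mathrm{Pre}}(P,N)$ is the quotient complex. Applying the cohomology functor yields the long exact sequence $$\begin{aligned}\cdots\to H^{n-1}_{\mathrm{Pre}}(P,N)&\to H^{n-1}_{\mathrm{Lie}}(A\otimes P,A\otimes N)\to H^{n-1}(Q^* )\\&\to H^n_{\mathrm{Pre}}(P,N)\to H^n_{\mathrm{Lie}}(A\otimes P,A\otimes N)\to H^n(Q^* )\\&\to H^{n+1}_{\mathrm{Pre}}(P,N)\to H^{n+1}_{\mathrm{Lie}}(A\otimes P,A\otimes N)\to\cdots\end{aligned}$$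
   Context: All algebras are over a field $\Bbbk$; $\otimes=\otimes_\Bbbk$; a hat denotes omission. Perm algebra: an algebra with $(ab)c=a(bc)=a(cb)$ for all $a,b,c$. Free Perm algebra on a set $X=\{x_1,x_2,\dots\}$: let $F\langle X\rangle$ be the free non-unital associative algebra on $X$ and $I$ the two-sided ideal generated by all $x(yz)-x(zy)$, $x,y,z\in F\langle X\rangle$; then $\mathrm{Perm}\langle X\rangle:=F\langle X\rangle/I$. Pre-Lie (right-symmetric) algebra: a vector space $P$ with a bilinear operation $\cdot_P$ such that $(a\cdot_P b)\cdot_P c-a\cdot_P(b\cdot_P c)=(a\cdot_P c)\cdot_P b-a\cdot_P(c\cdot_P b)$ for all $a,b,c\in P$. Its Lie bracket is $[a,b]=a\cdot_P b-b\cdot_P a$. $P$-bimodule: a vector space $N$ with bilinear left and right actions of $P$ such that for $a,b\in P$, $m\in N$: $(a\cdot b)\cdot m-a\cdot(b\cdot m)=(a\cdot m)\cdot b-a\cdot(m\cdot b)$ and $(m\cdot a)\cdot b-m\cdot(a\cdot b)=(m\cdot b)\cdot a-m\cdot(b\cdot a)$. $A\otimes P$ is the Lie algebra with bracket $[a_1\otimes p_1,a_2\otimes p_2]=a_1a_2\otimes(p_1\cdot_P p_2)-a_2a_1\otimes(p_2\cdot_P p_1)$. $A\otimes N$ is the $A\otimes P$-module with action $(a'\otimes p)\cdot(a\otimes n)=a'a\otimes(p\cdot n)-aa'\otimes(n\cdot p)$. Pre-Lie cochain complex: $C^*_{\mathrm{Pre}}(P,N)=\bigoplus_{k>0}C^k_{\mathrm{Pre}}(P,N)$,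 where $C^k_{\mathrm{Pre}}(P,N)$ consists of multilinear maps $\psi:P^{\otimes k}\to N$, with coboundary operator $$\begin{aligned}(\delta_{\mathrm{Pre}}\psi)(a_0,a_1,\dots,a_k)=&-\sum_{i=1}^k(-1)^i a_0\cdot\psi(a_i,a_1,\dots,\widehat{a_i},\dots,a_k)+\sum_{i=1}^k(-1)^i\psi(a_0\cdot_P a_i,a_1,\dots,\widehat{a_i},\dots,a_k)\\&+\sum_{1\le i<j\le k}(-1)^{i+1}\psi(a_0,a_1,\dots,\widehat{a_i},\dots,[a_i,a_j],\dots,a_k)-\sum_{i=1}^k(-1)^i\psi(a_0,a_1,\dots,\widehat{a_i},\dots,a_k)\cdot a_i,\end{aligned}$$ where in the third sum $[a_i,a_j]$ stands in the place of $a_j$. Its cohomology is $H^*_{\mathrm{Pre}}(P,N)$. Chevalley–Eilenberg complex of a Lie algebra $\mathfrak g$ with coefficients in a $\mathfrak g$-module $M$: $C^n_{\mathrm{Lie}}(\mathfrak g,M)$ is the space of alternating $n$-linear maps $\mathfrak g^n\to M$, with $$(\delta_{\mathrm{Lie}}g)(u_1,\dots,u_{n+1})=\sum_{i<j}(-1)^{i+j}g([u_i,u_j],u_1,\dots,\widehat{u_i},\dots,\widehat{u_j},\dots,u_{n+1})+\sum_i(-1)^{i+1}u_i\cdot g(u_1,\dots,\widehat{u_i},\dots,u_{n+1});$$ its cohomology is $H^*_{\mathrm{Lie}}(\mathfrak g,M)$. The map $\Psi$: for $f\in C^n_{\mathrm{Pre}}(P,N)$, $a_1,\dots,a_n\in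 A$ and $b_1,\dots,b_n\in P$, $$\begin{aligned}\Psi(f)(a_1\otimes b_1,\dots,a_n\otimes b_n)=\ & a_1a_2\cdots a_n\otimes f(b_1,b_2,\dots,b_n)-a_2a_1a_3\cdots a_n\otimes f(b_2,b_1,b_3,\dots,b_n)\\&+\sum_{i=2}^{n-2}(-1)^i a_{i+1}a_i\cdots a_1a_{i+2}\cdots a_n\otimes f(b_1,\dots,b_{i-1},b_{i+1},b_i,b_{i+2},\dots,b_n)\\&+(-1)^{n-1}a_na_{n-1}\cdots a_1\otimes f(b_n,b_{n-1},\dots,b_2,b_1),\end{aligned}$$ where coinciding terms are not repeated for small $n$: for $n=1$, $\Psi(f)(a_1\otimes b_1)=a_1\otimes f(b_1)$, and for $n=2$, $\Psi(f)(a_1\otimes b_1,a_2\otimes b_2)=a_1a_2\otimes f(b_1,b_2)-a_2a_1\otimes f(b_2,b_1)$. The quotient $Q^*$ is taken by the image of $\Psi$.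
   Formalization: Pre-Lie cochains are taken alternating in all arguments but the first; in Ψ the later summands use f(b_{i+1},b_1,…,b_i,b_{i+2},…,b_n); Ψ is shown injective for |X|≥2, and for |X|≤1 injectivity is assumed for the exact sequences. As printed, Ψ(f) need not be alternating and Ψ may fail to be injective. *)

theory Defs
  imports
    Complex_Main
    "HOL-Algebra.Module"
    "HOL-Algebra.QuotRing"
    "HOL-Library.Poly_Mapping"
begin

section \<open>Vector spaces, quotients and isomorphisms\<close>

text \<open>
  The given vector spaces are types with a scalar multiplication satisfying the locale
  \<^locale>\<open>vector_space\<close>.  Spaces of cochains, quotients and cohomology spaces are
  records \<^typ>\<open>('k, 'v) module\<close> of HOL-Algebra, over the field \<open>'k\<close> viewed as a ring
  record.  The fields \<open>mult\<close> and \<open>one\<close> of such a record are only meaningful for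
  (non-unital) algebras, where \<open>mult\<close> is the product; otherwise they are left undefined.
\<close>

definition field_ring :: "'k::field ring" where
  "field_ring = \<lparr>carrier = UNIV, mult = (*), one = 1, zero = 0, add = (+)\<rparr>"

definition space_of :: "('k \<Rightarrow> 'v::ab_group_add \<Rightarrow> 'v) \<Rightarrow> ('k, 'v) module" where
  "space_of s = \<lparr>carrier = UNIV, mult = undefined, one = undefined, zero = 0, add = (+), smult = s\<rparr>"

definition algebra_of ::
  "('k \<Rightarrow> 'v::ab_group_add \<Rightarrow> 'v) \<Rightarrow> ('v \<Rightarrow> 'v \<Rightarrow> 'v) \<Rightarrow> ('k, 'v) module" where
  "algebra_of s m = (space_of s)\<lparr>mult := m\<rparr>"

definition linear_map :: "('k, 'v) module \<Rightarrow> ('k, 'w) module \<Rightarrow> ('v \<Rightarrow> 'w) \<Rightarrow> bool" where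
  "linear_map M N h \<longleftrightarrow>
     h \<in> carrier M \<rightarrow> carrier N \<and>
     (\<forall>x\<in>carrier M. \<forall>y\<in>carrier M. h (x \<oplus>\<^bsub>M\<^esub> y) = h x \<oplus>\<^bsub>N\<^esub> h y) \<and>
     (\<forall>c. \<forall>x\<in>carrier M. h (c \<odot>\<^bsub>M\<^esub> x) = c \<odot>\<^bsub>N\<^esub> h x)"

definition linear_iso :: "('k, 'v) module \<Rightarrow> ('k, 'w) module \<Rightarrow> ('v \<Rightarrow> 'w) \<Rightarrow> bool" where
  "linear_iso M N h \<longleftrightarrow> linear_map M N h \<and> bij_betw h (carrier M) (carrier N)"

definition algebra_iso :: "('k, 'v) module \<Rightarrow> ('k, 'w) module \<Rightarrow> ('v \<Rightarrow> 'w) \<Rightarrow> bool" where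
  "algebra_iso M N h \<longleftrightarrow> linear_iso M N h \<and>
     (\<forall>x\<in>carrier M. \<forall>y\<in>carrier M. h (x \<otimes>\<^bsub>M\<^esub> y) = h x \<otimes>\<^bsub>N\<^esub> h y)"

definition quotient_module :: "('k, 'v) module \<Rightarrow> 'v set \<Rightarrow> ('k, 'v set) module" where
  "quotient_module M U =
     \<lparr>carrier = a_rcosets\<^bsub>M\<^esub> U,
      mult = rcoset_mult M U,
      one = U +>\<^bsub>M\<^esub> \<one>\<^bsub>M\<^esub>,
      zero = U,
      add = set_add M,
      smult = (\<lambda>c S. \<Union>x\<in>S. U +>\<^bsub>M\<^esub> (c \<odot>\<^bsub>M\<^esub> x))\<rparr>"

text \<open>The map on cosets \<open>x + U \<mapsto> h x + V\<close>, for a linear map \<open>h\<close> into \<open>N\<close> carrying \<open>U\<close> into \<open>V\<close>: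
  all the cosets in the union coincide.\<close>

definition induced_map :: "('k, 'w) module \<Rightarrow> 'w set \<Rightarrow> ('v \<Rightarrow> 'w) \<Rightarrow> 'v set \<Rightarrow> 'w set" where
  "induced_map N V h S = (\<Union>x\<in>S. V +>\<^bsub>N\<^esub> h x)"

definition bilinear_map ::
  "('k::field \<Rightarrow> 'u::ab_group_add \<Rightarrow> 'u) \<Rightarrow> ('k \<Rightarrow> 'v::ab_group_add \<Rightarrow> 'v) \<Rightarrow>
   ('k \<Rightarrow> 'w::ab_group_add \<Rightarrow> 'w) \<Rightarrow> ('u \<Rightarrow> 'v \<Rightarrow> 'w) \<Rightarrow> bool" where
  "bilinear_map s1 s2 s3 b \<longleftrightarrow>
     (\<forall>x. Vector_Spaces.linear s2 s3 (b x)) \<and> (\<forall>y. Vector_Spaces.linear s1 s3 (\<lambda>x. b x y))"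


section \<open>Free Perm algebras\<close>

definition fa_mult ::
  "('x list \<Rightarrow>\<^sub>0 'k::field) \<Rightarrow> ('x list \<Rightarrow>\<^sub>0 'k) \<Rightarrow> ('x list \<Rightarrow>\<^sub>0 'k)" where
  "fa_mult p q = (\<Sum>u\<in>Poly_Mapping.keys p. \<Sum>v\<in>Poly_Mapping.keys q.
     Poly_Mapping.single (u @ v) (Poly_Mapping.lookup p u * Poly_Mapping.lookup q v))"

definition free_scale :: "'k::field \<Rightarrow> ('b \<Rightarrow>\<^sub>0 'k) \<Rightarrow> ('b \<Rightarrow>\<^sub>0 'k)" where
  "free_scale c p = Poly_Mapping.map ((*) c) p"

text \<open>The free non-unital associative algebra: linear combinations of nonempty words in \<open>X\<close>.\<close>

definition free_assoc :: "'x set \<Rightarrow> ('k::field, 'x list \<Rightarrow>\<^sub>0 'k) module" where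
  "free_assoc X = (algebra_of free_scale fa_mult)
     \<lparr>carrier := {p. Poly_Mapping.keys p \<subseteq> {w. w \<noteq> [] \<and> set w \<subseteq> X}}\<rparr>"

definition two_sided_ideal :: "('k::field, 'v) module \<Rightarrow> 'v set \<Rightarrow> bool" where
  "two_sided_ideal F J \<longleftrightarrow> submodule J field_ring F \<and>
     (\<forall>x\<in>carrier F. \<forall>y\<in>J. x \<otimes>\<^bsub>F\<^esub> y \<in> J \<and> y \<otimes>\<^bsub>F\<^esub> x \<in> J)"

definition perm_ideal :: "'x set \<Rightarrow> ('x list \<Rightarrow>\<^sub>0 'k::field) set" where
  "perm_ideal X = \<Inter> {J. two_sided_ideal (free_assoc X) J \<and>
     {fa_mult x (fa_mult y z) - fa_mult x (fa_mult z y) | x y z.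
        x \<in> carrier (free_assoc X :: ('k, _) module) \<and> y \<in> carrier (free_assoc X :: ('k, _) module) \<and>
        z \<in> carrier (free_assoc X :: ('k, _) module)} \<subseteq> J}"

definition Perm :: "'x set \<Rightarrow> ('k::field, ('x list \<Rightarrow>\<^sub>0 'k) set) module" where
  "Perm X = quotient_module (free_assoc X) (perm_ideal X)"

definition free_perm_algebra ::
  "'x set \<Rightarrow> ('k::field \<Rightarrow> 'a::ab_group_add \<Rightarrow> 'a) \<Rightarrow> ('a \<Rightarrow> 'a \<Rightarrow> 'a) \<Rightarrow> bool" where
  "free_perm_algebra X sA mA \<longleftrightarrow>
     vector_space sA \<and> bilinear_map sA sA sA mA \<and>
     (\<exists>\<phi>. algebra_iso (algebra_of sA mA) (Perm X) \<phi>)"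


section \<open>Pre-Lie algebras and bimodules\<close>

definition pre_lie_algebra ::
  "('k::field \<Rightarrow> 'p::ab_group_add \<Rightarrow> 'p) \<Rightarrow> ('p \<Rightarrow> 'p \<Rightarrow> 'p) \<Rightarrow> bool" where
  "pre_lie_algebra sP mP \<longleftrightarrow>
     vector_space sP \<and> bilinear_map sP sP sP mP \<and>
     (\<forall>a b c. mP (mP a b) c - mP a (mP b c) = mP (mP a c) b - mP a (mP c b))"

definition pre_lie_bracket :: "('p::ab_group_add \<Rightarrow> 'p \<Rightarrow> 'p) \<Rightarrow> 'p \<Rightarrow> 'p \<Rightarrow> 'p" where
  "pre_lie_bracket mP a b = mP a b - mP b a"

text \<open>\<open>lN a m\<close> is the left action \<open>a \<cdot> m\<close>, and \<open>rN m a\<close> the right action \<open>m \<cdot> a\<close>.\<close>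

definition pre_lie_bimodule ::
  "('k::field \<Rightarrow> 'p::ab_group_add \<Rightarrow> 'p) \<Rightarrow> ('p \<Rightarrow> 'p \<Rightarrow> 'p) \<Rightarrow>
   ('k \<Rightarrow> 'n::ab_group_add \<Rightarrow> 'n) \<Rightarrow> ('p \<Rightarrow> 'n \<Rightarrow> 'n) \<Rightarrow> ('n \<Rightarrow> 'p \<Rightarrow> 'n) \<Rightarrow> bool" where
  "pre_lie_bimodule sP mP sN lN rN \<longleftrightarrow>
     vector_space sN \<and> bilinear_map sP sN sN lN \<and> bilinear_map sN sP sN rN \<and>
     (\<forall>a b m. lN (mP a b) m - lN a (lN b m) = rN (lN a m) b - lN a (rN m b)) \<and>
     (\<forall>a b m. rN (rN m a) b - rN m (mP a b) = rN (rN m b) a - rN m (mP b a))"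


section \<open>Tensor products\<close>

definition tensor_relations ::
  "('k::field \<Rightarrow> 'a::ab_group_add \<Rightarrow> 'a) \<Rightarrow> ('k \<Rightarrow> 'p::ab_group_add \<Rightarrow> 'p) \<Rightarrow> ('a \<times> 'p \<Rightarrow>\<^sub>0 'k) set" where
  "tensor_relations sA sP =
     (let e = (\<lambda>a p. Poly_Mapping.single (a, p) 1) in
       {e (a + a') p - e a p - e a' p | a a' p. True} \<union>
       {e a (p + p') - e a p - e a p' | a p p'. True} \<union>
       {e (sA c a) p - free_scale c (e a p) | c a p. True} \<union>
       {e a (sP c p) - free_scale c (e a p) | c a p. True})"

text \<open>
  The space \<open>sT\<close> together with the map \<open>\<tau>\<close> is the tensor product over \<open>'k\<close> of \<open>sA\<close> and \<open>sP\<close>,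
  with \<open>\<tau> a p\<close> in the role of \<open>a \<otimes> p\<close>: it is identified with the quotient of the vector space
  with basis \<open>'a \<times> 'p\<close> by the subspace that the bilinearity relations generate.
\<close>

definition tensor_product ::
  "('k::field \<Rightarrow> 'a::ab_group_add \<Rightarrow> 'a) \<Rightarrow> ('k \<Rightarrow> 'p::ab_group_add \<Rightarrow> 'p) \<Rightarrow>
   ('k \<Rightarrow> 't::ab_group_add \<Rightarrow> 't) \<Rightarrow> ('a \<Rightarrow> 'p \<Rightarrow> 't) \<Rightarrow> bool" where
  "tensor_product sA sP sT \<tau> \<longleftrightarrow> vector_space sT \<and>
     (let F = space_of free_scale;
          R = module.span free_scale (tensor_relations sA sP)
      in \<exists>\<phi>. linear_iso (space_of sT) (quotient_module F R) \<phi> \<and>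
             (\<forall>a p. \<phi> (\<tau> a p) = R +>\<^bsub>F\<^esub> Poly_Mapping.single (a, p) 1))"

text \<open>The linear map on the tensor product sending \<open>\<tau> a p\<close> to \<open>B a p\<close>, for bilinear \<open>B\<close>.\<close>

definition tensor_lift ::
  "('k::field \<Rightarrow> 't::ab_group_add \<Rightarrow> 't) \<Rightarrow> ('a \<Rightarrow> 'p \<Rightarrow> 't) \<Rightarrow> ('k \<Rightarrow> 'w::ab_group_add \<Rightarrow> 'w) \<Rightarrow>
   ('a \<Rightarrow> 'p \<Rightarrow> 'w) \<Rightarrow> 't \<Rightarrow> 'w" where
  "tensor_lift sT \<tau> sW B = (THE L. Vector_Spaces.linear sT sW L \<and> (\<forall>a p. L (\<tau> a p) = B a p))"

definition tensor_bracket ::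
  "('a \<Rightarrow> 'a \<Rightarrow> 'a) \<Rightarrow> ('p \<Rightarrow> 'p \<Rightarrow> 'p) \<Rightarrow>
   ('k::field \<Rightarrow> 't::ab_group_add \<Rightarrow> 't) \<Rightarrow> ('a \<Rightarrow> 'p \<Rightarrow> 't) \<Rightarrow> 't \<Rightarrow> 't \<Rightarrow> 't" where
  "tensor_bracket mA mP sT \<tau> u v =
     tensor_lift sT \<tau> sT (\<lambda>a1 p1.
       tensor_lift sT \<tau> sT (\<lambda>a2 p2. \<tau> (mA a1 a2) (mP p1 p2) - \<tau> (mA a2 a1) (mP p2 p1)) v) u"

definition tensor_action ::
  "('a \<Rightarrow> 'a \<Rightarrow> 'a) \<Rightarrow> ('p \<Rightarrow> 'n \<Rightarrow> 'n) \<Rightarrow> ('n \<Rightarrow> 'p \<Rightarrow> 'n) \<Rightarrow>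
   ('k::field \<Rightarrow> 't::ab_group_add \<Rightarrow> 't) \<Rightarrow> ('a \<Rightarrow> 'p \<Rightarrow> 't) \<Rightarrow>
   ('k \<Rightarrow> 's::ab_group_add \<Rightarrow> 's) \<Rightarrow> ('a \<Rightarrow> 'n \<Rightarrow> 's) \<Rightarrow> 't \<Rightarrow> 's \<Rightarrow> 's" where
  "tensor_action mA lN rN sT \<tau> sS \<sigma> u m =
     tensor_lift sT \<tau> sS (\<lambda>a' p.
       tensor_lift sS \<sigma> sS (\<lambda>a n. \<sigma> (mA a' a) (lN p n) - \<sigma> (mA a a') (rN n p)) m) u"


section \<open>Cochains\<close>

text \<open>An \<open>n\<close>-linear map is a function on lists of length \<open>n\<close>; positions are counted from \<open>0\<close>.\<close>

definition multilinear ::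
  "('k::field \<Rightarrow> 'v::ab_group_add \<Rightarrow> 'v) \<Rightarrow> ('k \<Rightarrow> 'w::ab_group_add \<Rightarrow> 'w) \<Rightarrow> nat \<Rightarrow>
   ('v list \<Rightarrow> 'w) \<Rightarrow> bool" where
  "multilinear sV sW n f \<longleftrightarrow>
     (\<forall>xs i. length xs = n \<longrightarrow> i < n \<longrightarrow> Vector_Spaces.linear sV sW (\<lambda>x. f (xs[i := x])))"

definition del_nth :: "nat \<Rightarrow> 'v list \<Rightarrow> 'v list" where
  "del_nth i xs = take i xs @ drop (Suc i) xs"

text \<open>The \<open>n\<close>-linear maps that vanish as soon as two of the arguments at positions \<open>\<ge> m\<close> are
  equal.  They are extended by \<open>0\<close> to lists of other lengths, so that equality of cochains
  is equality of functions.\<close>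

definition alternating_maps ::
  "nat \<Rightarrow> ('k::field \<Rightarrow> 'v::ab_group_add \<Rightarrow> 'v) \<Rightarrow> ('k \<Rightarrow> 'w::ab_group_add \<Rightarrow> 'w) \<Rightarrow> nat \<Rightarrow>
   ('k, 'v list \<Rightarrow> 'w) module" where
  "alternating_maps m sV sW n =
     \<lparr>carrier = {f. (\<forall>xs. length xs \<noteq> n \<longrightarrow> f xs = 0) \<and> multilinear sV sW n f \<and>
                    (\<forall>xs i j. length xs = n \<and> m \<le> i \<and> i < j \<and> j < n \<and> xs ! i = xs ! j \<longrightarrow> f xs = 0)},
      mult = undefined,
      one = undefined,
      zero = (\<lambda>xs. 0),
      add = (\<lambda>f g xs. f xs + g xs),
      smult = (\<lambda>c f xs. sW c (f xs))\<rparr>"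

definition lie_cochains ::
  "('k::field \<Rightarrow> 'g::ab_group_add \<Rightarrow> 'g) \<Rightarrow> ('k \<Rightarrow> 'm::ab_group_add \<Rightarrow> 'm) \<Rightarrow> nat \<Rightarrow>
   ('k, 'g list \<Rightarrow> 'm) module" where
  "lie_cochains sG sM n = alternating_maps 0 sG sM n"

definition lie_coboundary ::
  "('k::field \<Rightarrow> 'm::ab_group_add \<Rightarrow> 'm) \<Rightarrow> ('g \<Rightarrow> 'g \<Rightarrow> 'g) \<Rightarrow> ('g \<Rightarrow> 'm \<Rightarrow> 'm) \<Rightarrow> nat \<Rightarrow>
   ('g list \<Rightarrow> 'm) \<Rightarrow> 'g list \<Rightarrow> 'm" where
  "lie_coboundary sM br act n g us =
     (if length us = Suc n then
        (\<Sum>j<Suc n. \<Sum>i<j. sM ((-1) ^ (i + j)) (g (br (us ! i) (us ! j) # del_nth i (del_nth j us)))) +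
        (\<Sum>i<Suc n. sM ((-1) ^ i) (act (us ! i) (g (del_nth i us))))
      else 0)"

text \<open>Pre-Lie cochains of degree \<open>k > 0\<close> are the elements of \<open>Hom (P \<otimes> \<Lambda>\<^sup>k\<^sup>-\<^sup>1 P, N)\<close>: they are
  alternating in all arguments but the first.  There are none in degree \<open>0\<close>.\<close>

definition pre_cochains ::
  "('k::field \<Rightarrow> 'p::ab_group_add \<Rightarrow> 'p) \<Rightarrow> ('k \<Rightarrow> 'n::ab_group_add \<Rightarrow> 'n) \<Rightarrow> nat \<Rightarrow>
   ('k, 'p list \<Rightarrow> 'n) module" where
  "pre_cochains sP sN k =
     (if k = 0 then (alternating_maps 1 sP sN 0)\<lparr>carrier := {\<lambda>xs. 0}\<rparr>
      else alternating_maps 1 sP sN k)"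

definition pre_coboundary ::
  "('p::ab_group_add \<Rightarrow> 'p \<Rightarrow> 'p) \<Rightarrow> ('k::field \<Rightarrow> 'n::ab_group_add \<Rightarrow> 'n) \<Rightarrow>
   ('p \<Rightarrow> 'n \<Rightarrow> 'n) \<Rightarrow> ('n \<Rightarrow> 'p \<Rightarrow> 'n) \<Rightarrow> nat \<Rightarrow> ('p list \<Rightarrow> 'n) \<Rightarrow> 'p list \<Rightarrow> 'n" where
  "pre_coboundary mP sN lN rN k \<psi> as =
     (if length as = Suc k then
        - (\<Sum>i=1..k. sN ((-1) ^ i) (lN (as ! 0) (\<psi> (as ! i # tl (del_nth i as)))))
        + (\<Sum>i=1..k. sN ((-1) ^ i) (\<psi> (mP (as ! 0) (as ! i) # tl (del_nth i as))))
        + (\<Sum>j=1..k. \<Sum>i=1..<j. sN ((-1) ^ (i + 1))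
             (\<psi> (del_nth i (as[j := pre_lie_bracket mP (as ! i) (as ! j)]))))
        - (\<Sum>i=1..k. sN ((-1) ^ i) (rN (\<psi> (del_nth i as)) (as ! i)))
      else 0)"


section \<open>The map \<open>\<Psi>\<close>\<close>

fun list_product :: "('a \<Rightarrow> 'a \<Rightarrow> 'a) \<Rightarrow> 'a list \<Rightarrow> 'a" where
  "list_product m (a # as) = foldl m a as"
| "list_product m [] = undefined"

text \<open>
  The value of \<open>\<Psi> f\<close> at \<open>a\<^sub>1 \<otimes> b\<^sub>1, \<dots>, a\<^sub>n \<otimes> b\<^sub>n\<close>.  With positions counted from \<open>0\<close>, the summand of
  index \<open>i\<close> is
  \<open>(-1)\<^sup>i a\<^sub>i a\<^sub>i\<^sub>-\<^sub>1 \<cdots> a\<^sub>0 a\<^sub>i\<^sub>+\<^sub>1 \<cdots> a\<^sub>n\<^sub>-\<^sub>1 \<otimes> f (b\<^sub>i, b\<^sub>0, \<dots>, b\<^sub>i\<^sub>-\<^sub>1, b\<^sub>i\<^sub>+\<^sub>1, \<dots>, b\<^sub>n\<^sub>-\<^sub>1)\<close>.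
  A product in a Perm algebra depends on its first factor and on the multiset of the others, so the
  summand \<open>i = 0\<close> and the alternation of \<open>\<Psi> f\<close> determine all the others, in particular
  the order in which \<open>f\<close> takes its arguments.
\<close>

definition Psi_value ::
  "('a \<Rightarrow> 'a \<Rightarrow> 'a) \<Rightarrow> ('k::field \<Rightarrow> 's::ab_group_add \<Rightarrow> 's) \<Rightarrow> ('a \<Rightarrow> 'n \<Rightarrow> 's) \<Rightarrow>
   ('p list \<Rightarrow> 'n) \<Rightarrow> 'a list \<Rightarrow> 'p list \<Rightarrow> 's" where
  "Psi_value mA sS \<sigma> f as bs =
     (\<Sum>i<length as. sS ((-1) ^ i)
        (\<sigma> (list_product mA (rev (take (Suc i) as) @ drop (Suc i) as)) (f (bs ! i # del_nth i bs))))"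

definition Psi ::
  "('a \<Rightarrow> 'a \<Rightarrow> 'a) \<Rightarrow> ('k::field \<Rightarrow> 't::ab_group_add \<Rightarrow> 't) \<Rightarrow> ('a \<Rightarrow> 'p \<Rightarrow> 't) \<Rightarrow>
   ('k \<Rightarrow> 's::ab_group_add \<Rightarrow> 's) \<Rightarrow> ('a \<Rightarrow> 'n \<Rightarrow> 's) \<Rightarrow> nat \<Rightarrow>
   ('p list \<Rightarrow> 'n) \<Rightarrow> 't list \<Rightarrow> 's" where
  "Psi mA sT \<tau> sS \<sigma> n f =
     (THE g. (\<forall>us. length us \<noteq> n \<longrightarrow> g us = 0) \<and> multilinear sT sS n g \<and>
             (\<forall>as bs. length as = n \<and> length bs = n \<longrightarrow> g (map2 \<tau> as bs) = Psi_value mA sS \<sigma> f as bs))"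


section \<open>Complexes, cohomology and exact sequences\<close>

definition cochain_complex ::
  "(nat \<Rightarrow> ('k::field, 'v) module) \<Rightarrow> (nat \<Rightarrow> 'v \<Rightarrow> 'v) \<Rightarrow> bool" where
  "cochain_complex C d \<longleftrightarrow>
     (\<forall>n. module field_ring (C n) \<and> linear_map (C n) (C (Suc n)) (d n) \<and>
          (\<forall>x\<in>carrier (C n). d (Suc n) (d n x) = \<zero>\<^bsub>C (Suc (Suc n))\<^esub>))"

definition cochain_map ::
  "(nat \<Rightarrow> ('k::field, 'v) module) \<Rightarrow> (nat \<Rightarrow> 'v \<Rightarrow> 'v) \<Rightarrow>
   (nat \<Rightarrow> ('k, 'w) module) \<Rightarrow> (nat \<Rightarrow> 'w \<Rightarrow> 'w) \<Rightarrow> (nat \<Rightarrow> 'v \<Rightarrow> 'w) \<Rightarrow> bool" where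
  "cochain_map C dC D dD f \<longleftrightarrow>
     (\<forall>n. linear_map (C n) (D n) (f n) \<and> (\<forall>x\<in>carrier (C n). f (Suc n) (dC n x) = dD n (f n x)))"

definition cocycles ::
  "(nat \<Rightarrow> ('k, 'v) module) \<Rightarrow> (nat \<Rightarrow> 'v \<Rightarrow> 'v) \<Rightarrow> nat \<Rightarrow> 'v set" where
  "cocycles C d n = a_kernel (C n) (C (Suc n)) (d n)"

definition coboundaries ::
  "(nat \<Rightarrow> ('k, 'v) module) \<Rightarrow> (nat \<Rightarrow> 'v \<Rightarrow> 'v) \<Rightarrow> nat \<Rightarrow> 'v set" where
  "coboundaries C d n = (case n of 0 \<Rightarrow> {\<zero>\<^bsub>C 0\<^esub>} | Suc m \<Rightarrow> d m ` carrier (C m))"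

definition cohomology ::
  "(nat \<Rightarrow> ('k, 'v) module) \<Rightarrow> (nat \<Rightarrow> 'v \<Rightarrow> 'v) \<Rightarrow> nat \<Rightarrow> ('k, 'v set) module" where
  "cohomology C d n = quotient_module ((C n)\<lparr>carrier := cocycles C d n\<rparr>) (coboundaries C d n)"

text \<open>The map \<open>H\<^sup>n(f)\<close> induced by a cochain map \<open>f\<close> into the complex \<open>D\<close>.\<close>

definition cohomology_map ::
  "(nat \<Rightarrow> ('k, 'w) module) \<Rightarrow> (nat \<Rightarrow> 'w \<Rightarrow> 'w) \<Rightarrow> (nat \<Rightarrow> 'v \<Rightarrow> 'w) \<Rightarrow> nat \<Rightarrow> 'v set \<Rightarrow> 'w set" where
  "cohomology_map D dD f n = induced_map (D n) (coboundaries D dD n) (f n)"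

text \<open>The quotient of the complex \<open>B\<close> by the image of \<open>i : A \<rightarrow> B\<close>, with its differential and projection.\<close>

definition quotient_complex ::
  "(nat \<Rightarrow> ('k, 'u) module) \<Rightarrow> (nat \<Rightarrow> ('k, 'v) module) \<Rightarrow> (nat \<Rightarrow> 'u \<Rightarrow> 'v) \<Rightarrow>
   nat \<Rightarrow> ('k, 'v set) module" where
  "quotient_complex A B i n = quotient_module (B n) (i n ` carrier (A n))"

definition quotient_differential ::
  "(nat \<Rightarrow> ('k, 'u) module) \<Rightarrow> (nat \<Rightarrow> ('k, 'v) module) \<Rightarrow> (nat \<Rightarrow> 'v \<Rightarrow> 'v) \<Rightarrow> (nat \<Rightarrow> 'u \<Rightarrow> 'v) \<Rightarrow>
   nat \<Rightarrow> 'v set \<Rightarrow> 'v set" where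
  "quotient_differential A B dB i n = induced_map (B (Suc n)) (i (Suc n) ` carrier (A (Suc n))) (dB n)"

definition quotient_projection ::
  "(nat \<Rightarrow> ('k, 'u) module) \<Rightarrow> (nat \<Rightarrow> ('k, 'v) module) \<Rightarrow> (nat \<Rightarrow> 'u \<Rightarrow> 'v) \<Rightarrow>
   nat \<Rightarrow> 'v \<Rightarrow> 'v set" where
  "quotient_projection A B i n x = (i n ` carrier (A n)) +>\<^bsub>B n\<^esub> x"

definition short_exact ::
  "(nat \<Rightarrow> ('k::field, 'u) module) \<Rightarrow> (nat \<Rightarrow> 'u \<Rightarrow> 'u) \<Rightarrow>
   (nat \<Rightarrow> ('k, 'v) module) \<Rightarrow> (nat \<Rightarrow> 'v \<Rightarrow> 'v) \<Rightarrow>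
   (nat \<Rightarrow> ('k, 'w) module) \<Rightarrow> (nat \<Rightarrow> 'w \<Rightarrow> 'w) \<Rightarrow>
   (nat \<Rightarrow> 'u \<Rightarrow> 'v) \<Rightarrow> (nat \<Rightarrow> 'v \<Rightarrow> 'w) \<Rightarrow> bool" where
  "short_exact A dA B dB C dC i p \<longleftrightarrow>
     cochain_complex A dA \<and> cochain_complex B dB \<and> cochain_complex C dC \<and>
     cochain_map A dA B dB i \<and> cochain_map B dB C dC p \<and>
     (\<forall>n. inj_on (i n) (carrier (A n)) \<and>
          i n ` carrier (A n) = a_kernel (B n) (C n) (p n) \<and>
          p n ` carrier (B n) = carrier (C n))"

text \<open>The connecting map \<open>H\<^sup>n(C) \<rightarrow> H\<^sup>n\<^sup>+\<^sup>1(A)\<close> sends the class of \<open>p b\<close> to the class of \<open>a\<close>, where \<open>i a = dB b\<close>.\<close>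

definition connecting_map ::
  "(nat \<Rightarrow> ('k, 'u) module) \<Rightarrow> (nat \<Rightarrow> 'u \<Rightarrow> 'u) \<Rightarrow>
   (nat \<Rightarrow> ('k, 'v) module) \<Rightarrow> (nat \<Rightarrow> 'v \<Rightarrow> 'v) \<Rightarrow>
   (nat \<Rightarrow> 'u \<Rightarrow> 'v) \<Rightarrow> (nat \<Rightarrow> 'v \<Rightarrow> 'w) \<Rightarrow> nat \<Rightarrow> 'w set \<Rightarrow> 'u set" where
  "connecting_map A dA B dB i p n S =
     \<Union> {coboundaries A dA (Suc n) +>\<^bsub>A (Suc n)\<^esub> a | a b.
          a \<in> carrier (A (Suc n)) \<and> b \<in> carrier (B n) \<and> p n b \<in> S \<and> i (Suc n) a = dB n b}"

definition long_exact_sequence ::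
  "(nat \<Rightarrow> ('k::field, 'u) module) \<Rightarrow> (nat \<Rightarrow> 'u \<Rightarrow> 'u) \<Rightarrow>
   (nat \<Rightarrow> ('k, 'v) module) \<Rightarrow> (nat \<Rightarrow> 'v \<Rightarrow> 'v) \<Rightarrow>
   (nat \<Rightarrow> ('k, 'w) module) \<Rightarrow> (nat \<Rightarrow> 'w \<Rightarrow> 'w) \<Rightarrow>
   (nat \<Rightarrow> 'u \<Rightarrow> 'v) \<Rightarrow> (nat \<Rightarrow> 'v \<Rightarrow> 'w) \<Rightarrow> bool" where
  "long_exact_sequence A dA B dB C dC i p \<longleftrightarrow>
     (let HA = cohomology A dA; HB = cohomology B dB; HC = cohomology C dC;
          Hi = cohomology_map B dB i; Hp = cohomology_map C dC p;
          conn = connecting_map A dA B dB i p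
      in (\<forall>n. module field_ring (HA n) \<and> module field_ring (HB n) \<and> module field_ring (HC n) \<and>
              linear_map (HA n) (HB n) (Hi n) \<and>
              linear_map (HB n) (HC n) (Hp n) \<and>
              linear_map (HC n) (HA (Suc n)) (conn n) \<and>
              Hi n ` carrier (HA n) = a_kernel (HB n) (HC n) (Hp n) \<and>
              Hp n ` carrier (HB n) = a_kernel (HC n) (HA (Suc n)) (conn n) \<and>
              conn n ` carrier (HC n) = a_kernel (HA (Suc n)) (HB (Suc n)) (Hi (Suc n))) \<and>
         inj_on (Hi 0) (carrier (HA 0)))"

end

theory Submission
  imports Defs "HOL-Library.Function_Algebras"
begin

text \<open>
  Cartan's formula \<open>i\<^sub>u d = \<theta>\<^sub>u - d i\<^sub>u\<close>, where \<open>i\<^sub>u\<close> inserts \<open>u\<close> as first argument and \<open>\<theta>\<^sub>u\<close> is the action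
  of \<open>u\<close> on cochains, determines the Chevalley--Eilenberg coboundary by recursion on the list of arguments, and
  \<open>d d = 0\<close> follows by induction from \<open>[\<theta>\<^sub>u, \<theta>\<^sub>v] = \<theta>\<^bsub>[u,v]\<^esub>\<close>.  Currying the first argument of a pre-Lie cochain
  turns the pre-Lie complex into the Chevalley--Eilenberg complex of \<open>P\<close> with the opposite bracket and values in
  \<open>Hom(P, N)\<close>.

  A product in a Perm algebra depends only on its first factor and on the multiset of the others.  Hence \<open>\<Psi> f\<close> is
  the alternating sum over the choice of the first factor, and for \<open>u = a \<otimes> b\<close> the cochain \<open>i\<^sub>u (\<Psi> f)\<close> is the summand
  with first factor \<open>a\<close> minus \<open>\<Psi> (i\<^sub>b f)\<close> multiplied by \<open>a\<close> on the right.  Right multiplication commutes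
  with the action of \<open>A \<otimes> P\<close>, so \<open>d \<Psi> = \<Psi> d\<close> follows by induction from Cartan's formula on both sides.
  If \<open>X\<close> has two elements \<open>x \<noteq> y\<close>, then \<open>f\<close> is the coefficient of \<open>x y \<cdots> y\<close> in \<open>\<Psi> f\<close>, so \<open>\<Psi>\<close> is injective.
\<close>

section \<open>Quotient modules\<close>

text \<open>Written out, \<open>d d = 0\<close> and \<open>d \<Psi> = \<Psi> d\<close> are nested
  sums full of signs and deleted positions; a recursion that peels off one argument at a time
  removes most of this bookkeeping. The opposite bracket is forced by right symmetry:
  \<open>(m a) b - (m b) a = m [a, b]\<close>, so right multiplication reverses brackets. Since
  \<open>Hom(P, N)\<close> is not a type, cochains take values in a subspace \<open>S\<close> of an
  ambient type. Cochains on \<open>A \<otimes> P\<close> are compared at pure tensors, where a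
  product in \<open>A\<close> is recorded by its first factor. In the inductive step for
  \<open>d \<Psi>\<close> the terms that begin with the new factor \<open>a\<close> add up to the
  pre-Lie coboundary, and those that begin with an older factor to the action of \<open>b\<close> on
  the pre-Lie cochain. Two generators matter for injectivity: on one generator \<open>A\<close> is
  commutative, and in degree 2 the value \<open>a1 a2 \<otimes> (f (b1, b2) - f (b2, b1))\<close>
  vanishes for symmetric \<open>f\<close>. Hence injectivity is proved from two distinct generators,
  while the exact sequences are derived from injectivity itself, that is, from the given
  embedding.\<close>

lemma field_ring_simps [simp]:
  "carrier field_ring = UNIV" "mult field_ring = (*)" "one field_ring = 1"
  "zero field_ring = 0" "add field_ring = (+)"
  by (simp_all add: field_ring_def)

lemma cring_field_ring: "cring (field_ring :: 'k::field ring)"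
proof (intro cringI abelian_groupI comm_monoidI)
  fix x :: 'k
  show "\<exists>y\<in>carrier field_ring. y \<oplus>\<^bsub>field_ring\<^esub> x = \<zero>\<^bsub>field_ring\<^esub>"
    by (auto intro: exI[of _ "- x"])
qed (auto simp: algebra_simps)

text \<open>One locale serves all the quotients that occur: cocycles modulo coboundaries, a complex
  modulo the image of a cochain map, the free space modulo the bilinearity relations, and the free
  associative algebra modulo an ideal.\<close>

locale quotient_space = module field_ring M
  for M :: "('k::field, 'v) module" (structure) +
  fixes U :: "'v set"
  assumes submodule: "submodule U field_ring M"
begin

lemmas U_simps = submoduleE[OF submodule]

lemma U_carrier: "u \<in> U \<Longrightarrow> u \<in> carrier M"
  using U_simps(1) by blast

lemma U_zero: "\<zero> \<in> U"
proof -
  obtain u where u: "u \<in> U" using U_simps(2) by blast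
  then have "0 \<odot> u \<in> U" using U_simps(4) by simp
  then show ?thesis using smult_l_null[of u] u U_carrier by simp
qed

lemma mem_coset_iff:
  assumes "x \<in> carrier M" "y \<in> carrier M"
  shows "y \<in> U +> x \<longleftrightarrow> y \<ominus> x \<in> U"
proof
  assume "y \<in> U +> x"
  then obtain h where h: "h \<in> U" "y = h \<oplus> x" by (auto simp: a_r_coset_def')
  then have "y \<ominus> x = h" using assms U_carrier by (simp add: a_minus_def a_assoc r_neg)
  then show "y \<ominus> x \<in> U" using h by simp
next
  assume "y \<ominus> x \<in> U"
  moreover have "y = (y \<ominus> x) \<oplus> x" using assms by (simp add: a_minus_def a_assoc l_neg)
  ultimately show "y \<in> U +> x" by (auto simp: a_r_coset_def')
qed

lemma coset_carrier: "x \<in> carrier M \<Longrightarrow> y \<in> U +> x \<Longrightarrow> y \<in> carrier M"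
  by (auto simp: a_r_coset_def' U_carrier)

lemma coset_self: "x \<in> carrier M \<Longrightarrow> x \<in> U +> x"
  by (simp add: mem_coset_iff U_zero a_minus_def r_neg)

lemma coset_eqI:
  assumes "x \<in> carrier M" "y \<in> carrier M" "x \<ominus> y \<in> U"
  shows "U +> x = U +> y"
proof -
  have sub: "U +> x \<subseteq> U +> y"
    if xy: "x \<in> carrier M" "y \<in> carrier M" "x \<ominus> y \<in> U" for x y
  proof
    fix z assume z: "z \<in> U +> x"
    have zc: "z \<in> carrier M" using z xy coset_carrier by blast
    have "(z \<ominus> x) \<oplus> (x \<ominus> y) = z \<oplus> ((\<ominus> x \<oplus> x) \<oplus> \<ominus> y)"
      using xy zc by (simp only: a_minus_def a_assoc a_closed a_inv_closed)
    then have "z \<ominus> y = (z \<ominus> x) \<oplus> (x \<ominus> y)"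
      using xy zc by (simp add: a_minus_def l_neg)
    moreover have "z \<ominus> x \<in> U" using z mem_coset_iff zc xy by blast
    ultimately show "z \<in> U +> y" using U_simps(5) xy zc by (simp add: mem_coset_iff)
  qed
  have "y \<ominus> x = \<ominus> (x \<ominus> y)" using assms by (simp add: a_minus_def minus_add a_comm)
  then have "y \<ominus> x \<in> U" using assms U_simps(3) by simp
  then show ?thesis using sub assms by blast
qed

lemma coset_eq_iff:
  "x \<in> carrier M \<Longrightarrow> y \<in> carrier M \<Longrightarrow> U +> x = U +> y \<longleftrightarrow> x \<ominus> y \<in> U"
  using coset_eqI coset_self mem_coset_iff by metis

lemma coset_zero: "U +> \<zero> = U"
  by (auto simp: a_r_coset_def' U_carrier)

lemma coset_eq_U_iff: "x \<in> carrier M \<Longrightarrow> U +> x = U \<longleftrightarrow> x \<in> U"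
  using coset_eq_iff[of x \<zero>] coset_zero minus_equality[of \<zero> \<zero>] by (simp add: minus_eq)

lemma carrier_quotient: "carrier (quotient_module M U) = (\<lambda>x. U +> x) ` carrier M"
  by (auto simp: quotient_module_def A_RCOSETS_def')

lemma coset_in_quotient [intro]: "x \<in> carrier M \<Longrightarrow> U +> x \<in> carrier (quotient_module M U)"
  by (simp add: carrier_quotient)

lemma quotient_cases:
  assumes "S \<in> carrier (quotient_module M U)"
  obtains x where "x \<in> carrier M" "S = U +> x"
  using assms by (auto simp: carrier_quotient)

lemma zero_quotient: "\<zero>\<^bsub>quotient_module M U\<^esub> = U"
  by (simp add: quotient_module_def)

lemma add_quotient:
  assumes "x \<in> carrier M" "y \<in> carrier M"
  shows "(U +> x) \<oplus>\<^bsub>quotient_module M U\<^esub> (U +> y) = U +> (x \<oplus> y)"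
proof -
  have "set_add M (U +> x) (U +> y) = U +> (x \<oplus> y)"
  proof (intro equalityI subsetI)
    fix z assume "z \<in> set_add M (U +> x) (U +> y)"
    then obtain u v where uv: "u \<in> U" "v \<in> U" "z = (u \<oplus> x) \<oplus> (v \<oplus> y)"
      by (auto simp: set_add_def' a_r_coset_def')
    then have "z = (u \<oplus> v) \<oplus> (x \<oplus> y)" using assms U_carrier by (simp add: a_ac)
    then show "z \<in> U +> (x \<oplus> y)" using uv U_simps(5) by (auto simp: a_r_coset_def')
  next
    fix z assume "z \<in> U +> (x \<oplus> y)"
    then obtain u where u: "u \<in> U" "z = u \<oplus> (x \<oplus> y)" by (auto simp: a_r_coset_def')
    then have "z = (u \<oplus> x) \<oplus> (\<zero> \<oplus> y)" using assms U_carrier by (simp add: a_ac)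
    then show "z \<in> set_add M (U +> x) (U +> y)" using u U_zero 
      unfolding set_add_def' a_r_coset_def' by blast
  qed
  then show ?thesis by (simp add: quotient_module_def)
qed

text \<open>The record defines the product as a union over representatives. Their cosets coincide
  because \<open>c \<odot> y \<ominus> c \<odot> x = c \<odot> (y \<ominus> x)\<close> lies in
  \<open>U\<close>, and the union is not empty.\<close>

lemma smult_quotient:
  assumes "x \<in> carrier M"
  shows "c \<odot>\<^bsub>quotient_module M U\<^esub> (U +> x) = U +> (c \<odot> x)"
proof -
  have "U +> (c \<odot> y) = U +> (c \<odot> x)" if "y \<in> U +> x" for y
  proof -
    have y: "y \<in> carrier M" using that assms coset_carrier by blast
    have "c \<odot> y \<ominus> c \<odot> x = c \<odot> (y \<ominus> x)"
      using y assms by (simp add: a_minus_def smult_r_distr smult_r_minus)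
    then show ?thesis using that y assms U_simps(4) by (intro coset_eqI) (auto simp: mem_coset_iff)
  qed
  then have "(\<Union>y\<in>U +> x. U +> (c \<odot> y)) = (\<Union>y\<in>U +> x. U +> (c \<odot> x))" by (rule SUP_cong[OF refl])
  also have "\<dots> = U +> (c \<odot> x)" using coset_self[OF assms] by blast
  finally show ?thesis by (simp add: quotient_module_def)
qed

lemma module_quotient: "module field_ring (quotient_module M U)"
proof (rule moduleI[OF cring_field_ring])
  let ?Q = "quotient_module M U"
  show "abelian_group ?Q"
  proof (rule abelian_groupI)
    show "\<zero>\<^bsub>?Q\<^esub> \<in> carrier ?Q"
      using coset_in_quotient[of \<zero>] coset_zero zero_quotient by simp
    fix X assume X: "X \<in> carrier ?Q"
    then obtain x where x: "x \<in> carrier M" "X = U +> x" by (rule quotient_cases)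
    show "\<zero>\<^bsub>?Q\<^esub> \<oplus>\<^bsub>?Q\<^esub> X = X"
      using add_quotient[of \<zero> x] x by (simp add: coset_zero zero_quotient)
    show "\<exists>Y\<in>carrier ?Q. Y \<oplus>\<^bsub>?Q\<^esub> X = \<zero>\<^bsub>?Q\<^esub>"
      using add_quotient[of "\<ominus> x" x] x
      by (intro bexI[of _ "U +> (\<ominus> x)"]) (auto simp: coset_zero zero_quotient l_neg)
    fix Y assume "Y \<in> carrier ?Q"
    then obtain y where y: "y \<in> carrier M" "Y = U +> y" by (rule quotient_cases)
    show "X \<oplus>\<^bsub>?Q\<^esub> Y \<in> carrier ?Q" using x y by (auto simp: add_quotient)
    show "X \<oplus>\<^bsub>?Q\<^esub> Y = Y \<oplus>\<^bsub>?Q\<^esub> X" using x y by (simp add: add_quotient a_comm)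
    fix Z assume "Z \<in> carrier ?Q"
    then obtain z where z: "z \<in> carrier M" "Z = U +> z" by (rule quotient_cases)
    show "X \<oplus>\<^bsub>?Q\<^esub> Y \<oplus>\<^bsub>?Q\<^esub> Z = X \<oplus>\<^bsub>?Q\<^esub> (Y \<oplus>\<^bsub>?Q\<^esub> Z)" using x y z by (simp add: add_quotient a_assoc)
  qed
next
  let ?Q = "quotient_module M U"
  fix c d :: 'k and X Y assume "X \<in> carrier ?Q" "Y \<in> carrier ?Q"
  then obtain x y where xy: "x \<in> carrier M" "X = U +> x" "y \<in> carrier M" "Y = U +> y"
    by (auto elim!: quotient_cases)
  have sc: "c \<odot> z \<in> carrier M" if "z \<in> carrier M" for c z using that smult_closed by simp
  show "c \<odot>\<^bsub>?Q\<^esub> X \<in> carrier ?Q" using xy sc by (simp add: smult_quotient coset_in_quotient)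
  show "(c \<oplus>\<^bsub>field_ring\<^esub> d) \<odot>\<^bsub>?Q\<^esub> X = c \<odot>\<^bsub>?Q\<^esub> X \<oplus>\<^bsub>?Q\<^esub> d \<odot>\<^bsub>?Q\<^esub> X"
    using xy sc smult_l_distr[of c d x] by (simp add: smult_quotient add_quotient)
  show "c \<odot>\<^bsub>?Q\<^esub> (X \<oplus>\<^bsub>?Q\<^esub> Y) = c \<odot>\<^bsub>?Q\<^esub> X \<oplus>\<^bsub>?Q\<^esub> c \<odot>\<^bsub>?Q\<^esub> Y"
    using xy sc smult_r_distr[of c x y] by (simp add: smult_quotient add_quotient)
  show "(c \<otimes>\<^bsub>field_ring\<^esub> d) \<odot>\<^bsub>?Q\<^esub> X = c \<odot>\<^bsub>?Q\<^esub> (d \<odot>\<^bsub>?Q\<^esub> X)"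
    using xy sc smult_assoc1[of c d x] by (simp add: smult_quotient)
  show "\<one>\<^bsub>field_ring\<^esub> \<odot>\<^bsub>?Q\<^esub> X = X"
    using xy smult_one[of x] by (simp add: smult_quotient)
qed

end

section \<open>Linear maps, their images and kernels, and induced maps on quotients\<close>

locale linear_pair = M: module field_ring M + N: module field_ring N
  for M :: "('k::field, 'v) module" and N :: "('k, 'w) module" +
  fixes h assumes linear: "linear_map M N h"
begin

lemma closed [simp, intro]: "x \<in> carrier M \<Longrightarrow> h x \<in> carrier N"
  using linear by (auto simp: linear_map_def)

lemma add: "x \<in> carrier M \<Longrightarrow> y \<in> carrier M \<Longrightarrow> h (x \<oplus>\<^bsub>M\<^esub> y) = h x \<oplus>\<^bsub>N\<^esub> h y"
  using linear by (auto simp: linear_map_def)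

lemma smult: "x \<in> carrier M \<Longrightarrow> h (c \<odot>\<^bsub>M\<^esub> x) = c \<odot>\<^bsub>N\<^esub> h x"
  using linear by (auto simp: linear_map_def)

lemma zero: "h \<zero>\<^bsub>M\<^esub> = \<zero>\<^bsub>N\<^esub>"
  using smult[of "\<zero>\<^bsub>M\<^esub>" 0] M.smult_l_null[of "\<zero>\<^bsub>M\<^esub>"] N.smult_l_null[of "h \<zero>\<^bsub>M\<^esub>"] by simp

lemma minus: "x \<in> carrier M \<Longrightarrow> h (\<ominus>\<^bsub>M\<^esub> x) = \<ominus>\<^bsub>N\<^esub> (h x)"
  by (metis M.a_inv_closed M.l_neg N.minus_equality add closed zero)

lemma diff: "x \<in> carrier M \<Longrightarrow> y \<in> carrier M \<Longrightarrow> h (x \<ominus>\<^bsub>M\<^esub> y) = h x \<ominus>\<^bsub>N\<^esub> h y"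
  by (simp add: a_minus_def add minus)

lemma submodule_image: "submodule (h ` carrier M) field_ring N"
proof (rule N.submoduleI)
  show "\<zero>\<^bsub>N\<^esub> \<in> h ` carrier M" using zero M.zero_closed by (metis imageI)
  fix a b assume "a \<in> h ` carrier M" "b \<in> h ` carrier M"
  then obtain x y where xy: "x \<in> carrier M" "a = h x" "y \<in> carrier M" "b = h y" by auto
  show "\<ominus>\<^bsub>N\<^esub> a \<in> h ` carrier M" using xy by (simp flip: minus)
  show "a \<oplus>\<^bsub>N\<^esub> b \<in> h ` carrier M" using xy by (simp flip: add)
  show "c \<odot>\<^bsub>N\<^esub> a \<in> h ` carrier M" for c using xy M.smult_closed[of c x] by (simp flip: smult)
qed auto

lemma submodule_kernel: "submodule (a_kernel M N h) field_ring M"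
proof (rule M.submoduleI)
  fix a b assume "a \<in> a_kernel M N h" "b \<in> a_kernel M N h"
  then have ab: "a \<in> carrier M" "b \<in> carrier M" "h a = \<zero>\<^bsub>N\<^esub>" "h b = \<zero>\<^bsub>N\<^esub>"
    by (auto simp: a_kernel_def')
  show "\<ominus>\<^bsub>M\<^esub> a \<in> a_kernel M N h"
    using ab N.minus_equality[of "\<zero>\<^bsub>N\<^esub>" "\<zero>\<^bsub>N\<^esub>"] by (simp add: a_kernel_def' minus)
  show "a \<oplus>\<^bsub>M\<^esub> b \<in> a_kernel M N h" using ab by (simp add: a_kernel_def' add)
  show "c \<odot>\<^bsub>M\<^esub> a \<in> a_kernel M N h" for c
    using ab M.smult_closed[of c a] N.smult_r_null[of c] by (simp add: a_kernel_def' smult)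
qed (auto simp: a_kernel_def' zero)

end

lemma (in module) submodule_module:
  assumes "submodule H R M"
  shows "module R (M\<lparr>carrier := H\<rparr>)"
proof -
  note H = submoduleE[OF assms]
  have c: "x \<in> H \<Longrightarrow> x \<in> carrier M" for x using H(1) by blast
  obtain u where u: "u \<in> H" using H(2) by blast
  have z: "\<zero>\<^bsub>M\<^esub> \<in> H" using H(4)[of \<zero> u] smult_l_null[of u] u c by simp
  show ?thesis
  proof (rule moduleI)
    show "abelian_group (M\<lparr>carrier := H\<rparr>)"
    proof (rule abelian_groupI)
      fix x assume "x \<in> carrier (M\<lparr>carrier := H\<rparr>)"
      then show "\<exists>y\<in>carrier (M\<lparr>carrier := H\<rparr>). y \<oplus>\<^bsub>M\<lparr>carrier := H\<rparr>\<^esub> x = \<zero>\<^bsub>M\<lparr>carrier := H\<rparr>\<^esub>"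
        using c H(3) by (auto intro!: bexI[of _ "\<ominus>\<^bsub>M\<^esub> x"] simp: M.l_neg)
    qed (auto simp: z c H(5) intro: M.a_assoc M.a_comm)
  qed (auto simp: c H(4) intro: smult_l_distr smult_r_distr smult_assoc1 is_cring)
qed

lemma induced_map_coset:
  assumes "quotient_space M U" "quotient_space N V" "linear_map M N h" "h ` U \<subseteq> V" "x \<in> carrier M"
  shows "induced_map N V h (U +>\<^bsub>M\<^esub> x) = V +>\<^bsub>N\<^esub> h x"
proof -
  interpret M: quotient_space M U by fact
  interpret N: quotient_space N V by fact
  interpret linear_pair M N h by unfold_locales fact
  have "V +>\<^bsub>N\<^esub> h y = V +>\<^bsub>N\<^esub> h x" if y: "y \<in> U +>\<^bsub>M\<^esub> x" for y
  proof -
    have yc: "y \<in> carrier M" using M.coset_carrier assms(5) y by blast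
    have "y \<ominus>\<^bsub>M\<^esub> x \<in> U" using M.mem_coset_iff y yc assms(5) by blast
    then have "h y \<ominus>\<^bsub>N\<^esub> h x \<in> V" using assms(4,5) yc by (auto simp: diff[symmetric])
    then show ?thesis using yc assms(5) by (intro N.coset_eqI) auto
  qed
  then have "induced_map N V h (U +>\<^bsub>M\<^esub> x) = (\<Union>y\<in>U +>\<^bsub>M\<^esub> x. V +>\<^bsub>N\<^esub> h x)"
    unfolding induced_map_def by (rule SUP_cong[OF refl])
  also have "\<dots> = V +>\<^bsub>N\<^esub> h x" using M.coset_self[OF assms(5)] by blast
  finally show ?thesis .
qed

lemma linear_induced_map:
  assumes "quotient_space M U" "quotient_space N V" "linear_map M N h" "h ` U \<subseteq> V"
  shows "linear_map (quotient_module M U) (quotient_module N V) (induced_map N V h)"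
proof -
  interpret M: quotient_space M U by fact
  interpret N: quotient_space N V by fact
  interpret linear_pair M N h by unfold_locales fact
  note c = induced_map_coset[OF assms]
  show ?thesis
    unfolding linear_map_def
  proof (intro conjI ballI allI funcsetI)
    fix c X Y assume "X \<in> carrier (quotient_module M U)" "Y \<in> carrier (quotient_module M U)"
    then obtain x y where xy: "x \<in> carrier M" "X = U +>\<^bsub>M\<^esub> x" "y \<in> carrier M" "Y = U +>\<^bsub>M\<^esub> y"
      by (auto elim!: M.quotient_cases)
    show "induced_map N V h X \<in> carrier (quotient_module N V)"
      using xy by (simp add: c N.coset_in_quotient)
    show "induced_map N V h (X \<oplus>\<^bsub>quotient_module M U\<^esub> Y) =
        induced_map N V h X \<oplus>\<^bsub>quotient_module N V\<^esub> induced_map N V h Y"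
      using xy by (simp add: c M.add_quotient N.add_quotient add)
    show "induced_map N V h (c \<odot>\<^bsub>quotient_module M U\<^esub> X) = c \<odot>\<^bsub>quotient_module N V\<^esub> induced_map N V h X"
      using xy M.smult_closed[of c x] by (simp add: c M.smult_quotient N.smult_quotient smult)
  qed
qed

section \<open>The long exact cohomology sequence\<close>

lemma (in abelian_group) minus_self: "x \<in> carrier G \<Longrightarrow> x \<ominus> x = \<zero>"
  by (simp add: a_minus_def r_neg)

lemma a_r_coset_carrier_update [simp]: "H +>\<^bsub>M\<lparr>carrier := K\<rparr>\<^esub> x = H +>\<^bsub>M\<^esub> x"
  by (simp add: a_r_coset_def')

text \<open>Negation is not a field of the record: it is the inverse found in the carrier, so a
  smaller carrier could a priori change it. Uniqueness of inverses excludes this.\<close>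

lemma (in module) a_inv_submodule:
  assumes "submodule H R M" "x \<in> H"
  shows "\<ominus>\<^bsub>M\<lparr>carrier := H\<rparr>\<^esub> x = \<ominus>\<^bsub>M\<^esub> x"
proof -
  note H = submoduleE[OF assms(1)]
  interpret H: module R "M\<lparr>carrier := H\<rparr>" by (rule submodule_module[OF assms(1)])
  have "x \<in> carrier M" using assms H(1) by blast
  then show ?thesis using H.minus_equality[of "\<ominus>\<^bsub>M\<^esub> x" x] H(3) assms(2) by (simp add: M.l_neg)
qed

lemma (in module) minus_submodule:
  assumes "submodule H R M" "y \<in> H"
  shows "x \<ominus>\<^bsub>M\<lparr>carrier := H\<rparr>\<^esub> y = x \<ominus>\<^bsub>M\<^esub> y"
  using a_inv_submodule[OF assms] by (simp add: a_minus_def)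

section \<open>Cocycles, coboundaries and cohomology classes\<close>

locale complex =
  fixes C :: "nat \<Rightarrow> ('k::field, 'v) module" and d :: "nat \<Rightarrow> 'v \<Rightarrow> 'v"
  assumes complex: "cochain_complex C d"
begin

lemma linear_pair: "linear_pair (C n) (C (Suc n)) (d n)"
  using complex by (simp add: cochain_complex_def linear_pair_def linear_pair_axioms_def)

sublocale D: linear_pair "C n" "C (Suc n)" "d n" for n
  by (rule linear_pair)

lemma d_d: "x \<in> carrier (C n) \<Longrightarrow> d (Suc n) (d n x) = \<zero>\<^bsub>C (Suc (Suc n))\<^esub>"
  using complex by (simp add: cochain_complex_def)

lemma cocycles_iff: "x \<in> cocycles C d n \<longleftrightarrow> x \<in> carrier (C n) \<and> d n x = \<zero>\<^bsub>C (Suc n)\<^esub>"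
  by (simp add: cocycles_def a_kernel_def')

lemma coboundaries_0: "coboundaries C d 0 = {\<zero>\<^bsub>C 0\<^esub>}"
  and coboundaries_Suc: "coboundaries C d (Suc n) = d n ` carrier (C n)"
  by (simp_all add: coboundaries_def)

lemma coboundaries_cocycles: "x \<in> coboundaries C d n \<Longrightarrow> x \<in> cocycles C d n"
  by (cases n) (auto simp: coboundaries_0 coboundaries_Suc cocycles_iff d_d D.zero)

lemma submodule_cocycles: "submodule (cocycles C d n) field_ring (C n)"
  unfolding cocycles_def by (rule D.submodule_kernel)

lemma submodule_coboundaries: "submodule (coboundaries C d n) field_ring (C n)"
proof (cases n)
  case 0
  show ?thesis unfolding 0 coboundaries_0
  proof (rule D.M.submoduleI)
    show "\<ominus>\<^bsub>C 0\<^esub> a \<in> {\<zero>\<^bsub>C 0\<^esub>}" if "a \<in> {\<zero>\<^bsub>C 0\<^esub>}" for a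
      using that D.M.minus_equality[of 0 "\<zero>\<^bsub>C 0\<^esub>" "\<zero>\<^bsub>C 0\<^esub>"] by simp
  qed (use D.M.smult_r_null in auto)
next
  case (Suc m)
  show ?thesis unfolding Suc coboundaries_Suc by (rule D.submodule_image)
qed

abbreviation "Z n \<equiv> (C n)\<lparr>carrier := cocycles C d n\<rparr>"

sublocale H: quotient_space "Z n" "coboundaries C d n" for n
proof -
  interpret Z: module field_ring "Z n" by (rule D.M.submodule_module[OF submodule_cocycles])
  note B = D.M.submoduleE[OF submodule_coboundaries[of n]]
  show "quotient_space (Z n) (coboundaries C d n)"
  proof (intro quotient_space.intro quotient_space_axioms.intro Z.module_axioms, rule Z.submoduleI)
    show "\<zero>\<^bsub>Z n\<^esub> \<in> coboundaries C d n"
      using quotient_space.U_zero[OF quotient_space.intro, OF D.M.module_axioms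
          quotient_space_axioms.intro, OF submodule_coboundaries] by simp
    fix a b c assume "a \<in> coboundaries C d n" "b \<in> coboundaries C d n"
    then show "\<ominus>\<^bsub>Z n\<^esub> a \<in> coboundaries C d n" "a \<oplus>\<^bsub>Z n\<^esub> b \<in> coboundaries C d n"
        "c \<odot>\<^bsub>Z n\<^esub> a \<in> coboundaries C d n"
      using B coboundaries_cocycles by (auto simp: D.M.a_inv_submodule[OF submodule_cocycles])
  qed (auto simp: coboundaries_cocycles)
qed

text \<open>The coset is formed in \<open>C n\<close> and not in \<open>Z n\<close>. Both agree,
  since a coset depends only on the addition and not on the carrier.\<close>

definition cl :: "nat \<Rightarrow> 'v \<Rightarrow> 'v set" where
  "cl n x = coboundaries C d n +>\<^bsub>C n\<^esub> x"

lemma cohomology_def: "cohomology C d n = quotient_module (Z n) (coboundaries C d n)"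
  by (simp add: Defs.cohomology_def)

lemma module_cohomology: "module field_ring (cohomology C d n)"
  unfolding cohomology_def by (rule H.module_quotient)

lemma carrier_cohomology: "carrier (cohomology C d n) = cl n ` cocycles C d n"
  unfolding cohomology_def H.carrier_quotient by (simp add: cl_def)

lemma cl_carrier: "x \<in> cocycles C d n \<Longrightarrow> cl n x \<in> carrier (cohomology C d n)"
  by (simp add: carrier_cohomology)

lemma cl_eq_iff:
  "x \<in> cocycles C d n \<Longrightarrow> y \<in> cocycles C d n \<Longrightarrow>
    cl n x = cl n y \<longleftrightarrow> x \<ominus>\<^bsub>C n\<^esub> y \<in> coboundaries C d n"
  using H.coset_eq_iff[of x n y] by (simp add: cl_def D.M.minus_submodule[OF submodule_cocycles])

lemma mem_cl_iff:
  "x \<in> cocycles C d n \<Longrightarrow>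
    y \<in> cl n x \<longleftrightarrow> y \<in> cocycles C d n \<and> y \<ominus>\<^bsub>C n\<^esub> x \<in> coboundaries C d n"
  using H.mem_coset_iff[of x n y] H.coset_carrier[of x n y]
  by (auto simp: cl_def D.M.minus_submodule[OF submodule_cocycles])

lemma cl_self: "x \<in> cocycles C d n \<Longrightarrow> x \<in> cl n x"
  using H.coset_self[of x n] by (simp add: cl_def)

lemma zero_cohomology: "\<zero>\<^bsub>cohomology C d n\<^esub> = coboundaries C d n"
  unfolding cohomology_def by (rule H.zero_quotient)

lemma cl_eq_zero_iff:
  "x \<in> cocycles C d n \<Longrightarrow> cl n x = \<zero>\<^bsub>cohomology C d n\<^esub> \<longleftrightarrow> x \<in> coboundaries C d n"
  using H.coset_eq_U_iff[of x n] by (simp add: zero_cohomology cl_def)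

lemma cl_add:
  "x \<in> cocycles C d n \<Longrightarrow> y \<in> cocycles C d n \<Longrightarrow>
    cl n x \<oplus>\<^bsub>cohomology C d n\<^esub> cl n y = cl n (x \<oplus>\<^bsub>C n\<^esub> y)"
  using H.add_quotient[of x n y] by (simp add: cohomology_def cl_def)

lemma cl_smult:
  "x \<in> cocycles C d n \<Longrightarrow> c \<odot>\<^bsub>cohomology C d n\<^esub> cl n x = cl n (c \<odot>\<^bsub>C n\<^esub> x)"
  using H.smult_quotient[of x n c] by (simp add: cohomology_def cl_def)

lemma cocycles_closed:
  "x \<in> cocycles C d n \<Longrightarrow> y \<in> cocycles C d n \<Longrightarrow> x \<oplus>\<^bsub>C n\<^esub> y \<in> cocycles C d n"
  "x \<in> cocycles C d n \<Longrightarrow> c \<odot>\<^bsub>C n\<^esub> x \<in> cocycles C d n"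
  using D.M.submoduleE(4,5)[OF submodule_cocycles[of n]] by auto

lemma linear_cohomologyI:
  assumes "\<And>x. x \<in> cocycles C d n \<Longrightarrow> h (cl n x) \<in> carrier N"
    and "\<And>x y. x \<in> cocycles C d n \<Longrightarrow> y \<in> cocycles C d n \<Longrightarrow>
      h (cl n (x \<oplus>\<^bsub>C n\<^esub> y)) = h (cl n x) \<oplus>\<^bsub>N\<^esub> h (cl n y)"
    and "\<And>c x. x \<in> cocycles C d n \<Longrightarrow> h (cl n (c \<odot>\<^bsub>C n\<^esub> x)) = c \<odot>\<^bsub>N\<^esub> h (cl n x)"
  shows "linear_map (cohomology C d n) N h"
  using assms by (auto simp: linear_map_def carrier_cohomology cl_add cl_smult)

end

section \<open>Cochain maps and their action on cohomology\<close>

locale complex_map = C: complex C dC + D: complex D dD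
  for C :: "nat \<Rightarrow> ('k::field, 'v) module" and dC
    and D :: "nat \<Rightarrow> ('k, 'w) module" and dD +
  fixes f
  assumes cochain_map: "cochain_map C dC D dD f"
begin

sublocale F: linear_pair "C n" "D n" "f n" for n
  using cochain_map by unfold_locales (simp add: cochain_map_def)

lemma commutes: "x \<in> carrier (C n) \<Longrightarrow> f (Suc n) (dC n x) = dD n (f n x)"
  using cochain_map by (simp add: cochain_map_def)

lemma cocycles: "x \<in> cocycles C dC n \<Longrightarrow> f n x \<in> cocycles D dD n"
  by (auto simp: C.cocycles_iff D.cocycles_iff commutes[symmetric] F.zero)

lemma coboundaries: "x \<in> coboundaries C dC n \<Longrightarrow> f n x \<in> coboundaries D dD n"
  by (cases n) (auto simp: C.coboundaries_0 D.coboundaries_0 C.coboundaries_Suc D.coboundaries_Suc commutes F.zero)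

lemma cohomology_map_cl:
  assumes "x \<in> cocycles C dC n"
  shows "cohomology_map D dD f n (C.cl n x) = D.cl n (f n x)"
proof -
  have "D.cl n (f n y) = D.cl n (f n x)" if y: "y \<in> C.cl n x" for y
  proof -
    have yc: "y \<in> cocycles C dC n" and diff: "y \<ominus>\<^bsub>C n\<^esub> x \<in> coboundaries C dC n"
      using y assms C.mem_cl_iff by blast+
    have "f n y \<ominus>\<^bsub>D n\<^esub> f n x \<in> coboundaries D dD n"
      using coboundaries[OF diff] yc assms by (simp add: F.diff C.cocycles_iff)
    then show ?thesis using D.cl_eq_iff cocycles yc assms by blast
  qed
  then have "cohomology_map D dD f n (C.cl n x) = (\<Union>y\<in>C.cl n x. D.cl n (f n x))"
    unfolding cohomology_map_def induced_map_def D.cl_def[symmetric] by (rule SUP_cong[OF refl])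
  also have "\<dots> = D.cl n (f n x)" using C.cl_self[OF assms] by blast
  finally show ?thesis .
qed

lemma linear_cohomology_map:
  "linear_map (cohomology C dC n) (cohomology D dD n) (cohomology_map D dD f n)"
  by (rule C.linear_cohomologyI)
    (simp_all add: cohomology_map_cl C.cocycles_closed cocycles D.cl_carrier D.cl_add D.cl_smult,
      simp_all add: C.cocycles_iff F.add F.smult)

end

section \<open>The connecting map and exactness at the three terms\<close>

locale short_exact_sequence =
  fixes A :: "nat \<Rightarrow> ('k::field, 'u) module" and dA
    and B :: "nat \<Rightarrow> ('k, 'v) module" and dB
    and C :: "nat \<Rightarrow> ('k, 'w) module" and dC
    and i and p
  assumes short_exact: "short_exact A dA B dB C dC i p"
begin

sublocale i: complex_map A dA B dB i
  using short_exact by unfold_locales (simp_all add: short_exact_def)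

sublocale p: complex_map B dB C dC p
  using short_exact by unfold_locales (simp_all add: short_exact_def)

lemma i_inj: "x \<in> carrier (A n) \<Longrightarrow> y \<in> carrier (A n) \<Longrightarrow> i n x = i n y \<Longrightarrow> x = y"
  using short_exact unfolding short_exact_def inj_on_def by blast

lemma p_zero_iff: "b \<in> carrier (B n) \<Longrightarrow> p n b = \<zero>\<^bsub>C n\<^esub> \<longleftrightarrow> b \<in> i n ` carrier (A n)"
proof -
  assume "b \<in> carrier (B n)"
  moreover have "i n ` carrier (A n) = a_kernel (B n) (C n) (p n)"
    using short_exact by (simp only: short_exact_def)
  ultimately show ?thesis by (simp add: a_kernel_def')
qed

lemma p_i: "a \<in> carrier (A n) \<Longrightarrow> p n (i n a) = \<zero>\<^bsub>C n\<^esub>"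
  using p_zero_iff by blast

lemma p_surj:
  assumes "c \<in> carrier (C n)"
  obtains b where "b \<in> carrier (B n)" "p n b = c"
proof -
  have "p n ` carrier (B n) = carrier (C n)" using short_exact by (simp only: short_exact_def)
  then have "c \<in> p n ` carrier (B n)" using assms by simp
  then show ?thesis using that by blast
qed

text \<open>Injectivity in degree \<open>Suc n\<close> cancels \<open>i\<close> from
  \<open>i (dA a) = dB (i a) = 0 = i 0\<close>.\<close>

lemma i_reflects_cocycles:
  assumes "a \<in> carrier (A n)" "i n a \<in> cocycles B dB n"
  shows "a \<in> cocycles A dA n"
proof -
  have "i (Suc n) (dA n a) = i (Suc n) \<zero>\<^bsub>A (Suc n)\<^esub>"
    using assms by (simp add: i.commutes i.D.cocycles_iff i.F.zero)
  then have "dA n a = \<zero>\<^bsub>A (Suc n)\<^esub>" using assms by (intro i_inj[of _ "Suc n"]) auto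
  then show ?thesis using assms by (simp add: i.C.cocycles_iff)
qed

text \<open>The zigzag of the snake lemma: \<open>c\<close> is pulled back along \<open>p\<close> to
  \<open>b\<close>, and \<open>dB b\<close> is pulled back along \<open>i\<close> to
  \<open>a\<close>. The class of \<open>a\<close> is to be the image of the class of
  \<open>c\<close> under the connecting map.\<close>

definition lifts where
  "lifts n c b a \<longleftrightarrow> b \<in> carrier (B n) \<and> a \<in> carrier (A (Suc n)) \<and> p n b = c \<and> i (Suc n) a = dB n b"

lemma lifts_cocycle:
  assumes "lifts n c b a" shows "a \<in> cocycles A dA (Suc n)"
  using assms i.D.d_d[of b n] 
  by (intro i_reflects_cocycles) (auto simp: lifts_def i.D.cocycles_iff)

lemma lifts_exists:
  assumes "c \<in> cocycles C dC n"
  obtains a b where "lifts n c b a"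
proof -
  obtain b where b: "b \<in> carrier (B n)" "p n b = c"
    using p_surj assms by (auto simp: p.D.cocycles_iff)
  have "p (Suc n) (dB n b) = \<zero>\<^bsub>C (Suc n)\<^esub>"
    using b assms by (simp add: p.commutes p.D.cocycles_iff)
  then obtain a where "a \<in> carrier (A (Suc n))" "i (Suc n) a = dB n b"
    using p_zero_iff b by (auto simp: image_iff)
  then show ?thesis using that b by (auto simp: lifts_def)
qed

text \<open>A coboundary of \<open>C\<close> lifts along \<open>p\<close> to a coboundary of
  \<open>B\<close>: in positive degree lift a primitive and apply \<open>dB\<close>, in degree 0
  take zero. The difference from \<open>b\<close> lies in the kernel of \<open>p\<close>, which is
  the image of \<open>i\<close>. Both the well-definedness of the connecting map and exactness at
  \<open>B\<close> rest on this.\<close>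

lemma coboundary_lift:
  assumes "b \<in> carrier (B n)" "p n b \<in> coboundaries C dC n"
  obtains b' a where "b' \<in> coboundaries B dB n" "a \<in> carrier (A n)" "b = b' \<oplus>\<^bsub>B n\<^esub> i n a"
proof -
  have "\<exists>b'. b' \<in> coboundaries B dB n \<and> p n b' = p n b"
  proof (cases n)
    case 0
    then show ?thesis using assms p.F.zero[of 0]
      by (intro exI[of _ "\<zero>\<^bsub>B n\<^esub>"]) (simp add: i.D.coboundaries_0 p.D.coboundaries_0)
  next
    case (Suc m)
    then obtain c where c: "c \<in> carrier (C m)" "p n b = dC m c"
      using assms by (auto simp: p.D.coboundaries_Suc)
    obtain b'' where b'': "b'' \<in> carrier (B m)" "p m b'' = c" using p_surj c by blast
    then show ?thesis using c Suc
      by (intro exI[of _ "dB m b''"]) (auto simp: i.D.coboundaries_Suc p.commutes)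
  qed
  then obtain b' where b': "b' \<in> coboundaries B dB n" "p n b' = p n b" by blast
  have b'c: "b' \<in> carrier (B n)"
    using i.D.coboundaries_cocycles[OF b'(1)] by (simp add: i.D.cocycles_iff)
  have "p n (b \<ominus>\<^bsub>B n\<^esub> b') = \<zero>\<^bsub>C n\<^esub>"
    using assms b' b'c by (simp add: p.F.diff p.D.D.M.minus_self)
  then obtain a where a: "a \<in> carrier (A n)" "b \<ominus>\<^bsub>B n\<^esub> b' = i n a"
    using p_zero_iff assms b'c by (auto simp: image_iff)
  have "b = b' \<oplus>\<^bsub>B n\<^esub> (b \<ominus>\<^bsub>B n\<^esub> b')"
    using assms b'c by (simp add: a_minus_def i.D.D.M.a_lcomm i.D.D.M.r_neg)
  then show ?thesis using that b'(1) a by simp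
qed

lemma dB_coboundary: "b \<in> coboundaries B dB n \<Longrightarrow> dB n b = \<zero>\<^bsub>B (Suc n)\<^esub>"
  using i.D.coboundaries_cocycles by (simp add: i.D.cocycles_iff)

lemma coboundary_carrier: "b \<in> coboundaries B dB n \<Longrightarrow> b \<in> carrier (B n)"
  using i.D.coboundaries_cocycles by (simp add: i.D.cocycles_iff)

text \<open>By \<open>coboundary_lift\<close>, \<open>b - b'\<close> is a coboundary plus some
  \<open>i a1\<close>. The differential kills the coboundary, and cancelling \<open>i\<close> leaves
  \<open>a - a' = dA a1\<close>.\<close>

lemma lifts_unique:
  assumes "lifts n c b a" "lifts n c' b' a'" "c \<ominus>\<^bsub>C n\<^esub> c' \<in> coboundaries C dC n"
  shows "i.C.cl (Suc n) a = i.C.cl (Suc n) a'"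
proof -
  note l = assms(1,2)[unfolded lifts_def]
  have "p n (b \<ominus>\<^bsub>B n\<^esub> b') \<in> coboundaries C dC n" using assms(3) l by (simp add: p.F.diff)
  then obtain b1 a1 where 1: "b1 \<in> coboundaries B dB n" "a1 \<in> carrier (A n)"
      "b \<ominus>\<^bsub>B n\<^esub> b' = b1 \<oplus>\<^bsub>B n\<^esub> i n a1"
    using coboundary_lift[of "b \<ominus>\<^bsub>B n\<^esub> b'" n] l by auto
  have "i (Suc n) (a \<ominus>\<^bsub>A (Suc n)\<^esub> a') = dB n (b \<ominus>\<^bsub>B n\<^esub> b')"
    using l by (simp add: i.F.diff i.D.D.diff)
  also have "\<dots> = i (Suc n) (dA n a1)"
    unfolding 1(3) using 1(1,2) coboundary_carrier by (simp add: i.D.D.add dB_coboundary i.commutes)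
  finally have "a \<ominus>\<^bsub>A (Suc n)\<^esub> a' = dA n a1" using l 1(2) by (intro i_inj) auto
  then show ?thesis using 1(2) lifts_cocycle assms(1,2)
    by (auto simp: i.C.cl_eq_iff i.C.coboundaries_Suc)
qed

abbreviation "conn \<equiv> connecting_map A dA B dB i p"

text \<open>The union in \<open>connecting_map\<close> runs over all zigzags above the class of
  \<open>c\<close>. By \<open>lifts_unique\<close> they all contribute the same coset, and the given
  zigzag shows that there is one.\<close>

lemma conn_cl:
  assumes "c \<in> cocycles C dC n" "lifts n c b a"
  shows "conn n (p.D.cl n c) = i.C.cl (Suc n) a"
proof -
  have "i.C.cl (Suc n) a' = i.C.cl (Suc n) a"
    if "a' \<in> carrier (A (Suc n))" "b' \<in> carrier (B n)" "p n b' \<in> p.D.cl n c" "i (Suc n) a' = dB n b'" for a' b'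
    using that p.D.mem_cl_iff[OF assms(1)] by (intro lifts_unique[OF _ assms(2)]) (auto simp: lifts_def)
  moreover have "p n b \<in> p.D.cl n c" using assms p.D.cl_self by (simp add: lifts_def)
  ultimately have "{coboundaries A dA (Suc n) +>\<^bsub>A (Suc n)\<^esub> a' | a' b'.
          a' \<in> carrier (A (Suc n)) \<and> b' \<in> carrier (B n) \<and> p n b' \<in> p.D.cl n c \<and> i (Suc n) a' = dB n b'}
        = {i.C.cl (Suc n) a}"
    using assms(2) unfolding i.C.cl_def lifts_def by blast
  then show ?thesis by (simp add: connecting_map_def)
qed

lemma lifts_add:
  "lifts n c b a \<Longrightarrow> lifts n c' b' a' \<Longrightarrow>
    lifts n (c \<oplus>\<^bsub>C n\<^esub> c') (b \<oplus>\<^bsub>B n\<^esub> b') (a \<oplus>\<^bsub>A (Suc n)\<^esub> a')"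
  by (auto simp: lifts_def p.F.add i.F.add i.D.D.add)

lemma lifts_smult:
  "lifts n c b a \<Longrightarrow> lifts n (k \<odot>\<^bsub>C n\<^esub> c) (k \<odot>\<^bsub>B n\<^esub> b) (k \<odot>\<^bsub>A (Suc n)\<^esub> a)"
  using i.C.D.M.smult_closed[of k] i.D.D.M.smult_closed[of k]
  by (auto simp: lifts_def p.F.smult i.F.smult i.D.D.smult)

lemma linear_conn: "linear_map (cohomology C dC n) (cohomology A dA (Suc n)) (conn n)"
proof (rule p.D.linear_cohomologyI)
  fix c assume c: "c \<in> cocycles C dC n"
  obtain a b where l: "lifts n c b a" using lifts_exists c by blast
  show "conn n (p.D.cl n c) \<in> carrier (cohomology A dA (Suc n))"
    using conn_cl[OF c l] lifts_cocycle[OF l] i.C.cl_carrier by simp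
  show "conn n (p.D.cl n (k \<odot>\<^bsub>C n\<^esub> c)) = k \<odot>\<^bsub>cohomology A dA (Suc n)\<^esub> conn n (p.D.cl n c)" for k
    using conn_cl[OF c l] conn_cl[OF p.D.cocycles_closed(2)[OF c] lifts_smult[OF l]] lifts_cocycle[OF l]
    by (simp add: i.C.cl_smult)
  fix c' assume c': "c' \<in> cocycles C dC n"
  obtain a' b' where l': "lifts n c' b' a'" using lifts_exists c' by blast
  show "conn n (p.D.cl n (c \<oplus>\<^bsub>C n\<^esub> c')) =
      conn n (p.D.cl n c) \<oplus>\<^bsub>cohomology A dA (Suc n)\<^esub> conn n (p.D.cl n c')"
    using conn_cl[OF c l] conn_cl[OF c' l'] conn_cl[OF p.D.cocycles_closed(1)[OF c c'] lifts_add[OF l l']]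
      lifts_cocycle[OF l] lifts_cocycle[OF l']
    by (simp add: i.C.cl_add)
qed

abbreviation "Hi \<equiv> cohomology_map B dB i"
abbreviation "Hp \<equiv> cohomology_map C dC p"

lemma exact_B:
  "Hi n ` carrier (cohomology A dA n) = a_kernel (cohomology B dB n) (cohomology C dC n) (Hp n)"
proof (intro equalityI subsetI)
  fix S assume "S \<in> Hi n ` carrier (cohomology A dA n)"
  then obtain a where a: "a \<in> cocycles A dA n" "S = i.D.cl n (i n a)"
    by (auto simp: i.C.carrier_cohomology i.cohomology_map_cl)
  have z: "\<zero>\<^bsub>C n\<^esub> \<in> coboundaries C dC n"
    using p.D.H.U_zero[of n] by simp
  have "p n (i n a) = \<zero>\<^bsub>C n\<^esub>" using a p_i by (simp add: i.C.cocycles_iff)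
  then show "S \<in> a_kernel (cohomology B dB n) (cohomology C dC n) (Hp n)"
    using a i.cocycles p.cocycles[OF i.cocycles[OF a(1)]] z
    by (simp add: a_kernel_def' i.D.cl_carrier p.cohomology_map_cl p.D.cl_eq_zero_iff)
next
  fix S assume S: "S \<in> a_kernel (cohomology B dB n) (cohomology C dC n) (Hp n)"
  then obtain b where b: "b \<in> cocycles B dB n" "S = i.D.cl n b"
    by (auto simp: a_kernel_def' i.D.carrier_cohomology)
  then have "p n b \<in> coboundaries C dC n"
    using S p.cocycles by (auto simp: a_kernel_def' p.cohomology_map_cl p.D.cl_eq_zero_iff)
  \<comment> \<open>The coboundary \<open>b'\<close> changes neither the class nor the differential,
    so \<open>i n a\<close> is a cocycle that represents the class of \<open>b\<close>.\<close>
  then obtain b' a where ba: "b' \<in> coboundaries B dB n" "a \<in> carrier (A n)" "b = b' \<oplus>\<^bsub>B n\<^esub> i n a"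
    using coboundary_lift[of b n] b by (auto simp: i.D.cocycles_iff)
  have c: "b' \<in> carrier (B n)" "i n a \<in> carrier (B n)" using ba coboundary_carrier by auto
  have "dB n b = dB n (i n a)" using ba c by (simp add: i.D.D.add dB_coboundary)
  then have ia: "i n a \<in> cocycles B dB n" using b c by (simp add: i.D.cocycles_iff)
  have "b \<ominus>\<^bsub>B n\<^esub> i n a = b'"
    using ba c by (simp add: a_minus_def i.D.D.M.a_assoc i.D.D.M.r_neg)
  then have "i.D.cl n b = i.D.cl n (i n a)" using b ia ba by (simp add: i.D.cl_eq_iff)
  moreover have "a \<in> cocycles A dA n" using i_reflects_cocycles ba ia by blast
  ultimately show "S \<in> Hi n ` carrier (cohomology A dA n)"
    using b by (auto simp: i.C.carrier_cohomology i.cohomology_map_cl image_iff)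
qed

lemma exact_C:
  "Hp n ` carrier (cohomology B dB n) = a_kernel (cohomology C dC n) (cohomology A dA (Suc n)) (conn n)"
proof (intro equalityI subsetI)
  fix S assume "S \<in> Hp n ` carrier (cohomology B dB n)"
  then obtain b where b: "b \<in> cocycles B dB n" "S = p.D.cl n (p n b)"
    by (auto simp: i.D.carrier_cohomology p.cohomology_map_cl)
  \<comment> \<open>A cocycle \<open>b\<close> is itself a lift of its image, with
    \<open>dB b = 0 = i 0\<close>.\<close>
  have "lifts n (p n b) b \<zero>\<^bsub>A (Suc n)\<^esub>"
    using b by (simp add: lifts_def i.D.cocycles_iff i.F.zero)
  then have "conn n S = i.C.cl (Suc n) \<zero>\<^bsub>A (Suc n)\<^esub>" using conn_cl p.cocycles b by blast
  also have "\<dots> = \<zero>\<^bsub>cohomology A dA (Suc n)\<^esub>"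
    using i.C.H.coset_zero[of "Suc n"] by (simp add: i.C.cl_def i.C.zero_cohomology)
  finally show "S \<in> a_kernel (cohomology C dC n) (cohomology A dA (Suc n)) (conn n)"
    using b p.cocycles by (simp add: a_kernel_def' p.D.cl_carrier)
next
  fix S assume S: "S \<in> a_kernel (cohomology C dC n) (cohomology A dA (Suc n)) (conn n)"
  then obtain c where c: "c \<in> cocycles C dC n" "S = p.D.cl n c"
    by (auto simp: a_kernel_def' p.D.carrier_cohomology)
  obtain a b where l: "lifts n c b a" using lifts_exists c by blast
  have "i.C.cl (Suc n) a = \<zero>\<^bsub>cohomology A dA (Suc n)\<^esub>"
    using S c conn_cl[OF c(1) l] by (simp add: a_kernel_def')
  then obtain a' where a': "a' \<in> carrier (A n)" "a = dA n a'"
    using lifts_cocycle[OF l] by (auto simp: i.C.cl_eq_zero_iff i.C.coboundaries_Suc)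
  \<comment> \<open>The correction by \<open>i n a'\<close> turns \<open>b\<close> into a cocycle,
    and it does not change the image because \<open>p\<close> kills the image of
    \<open>i\<close>.\<close>
  let ?b = "b \<ominus>\<^bsub>B n\<^esub> i n a'"
  have b: "b \<in> carrier (B n)" "p n b = c" "dB n b = dB n (i n a')"
    using l a' by (auto simp: lifts_def i.commutes)
  have "?b \<in> cocycles B dB n"
    using b a' by (simp add: i.D.cocycles_iff i.D.D.diff i.D.D.M.minus_self)
  moreover have "p n ?b = c"
  proof -
    have "p n ?b = c \<ominus>\<^bsub>C n\<^esub> \<zero>\<^bsub>C n\<^esub>" using b a' by (simp add: p.F.diff p_i)
    also have "\<dots> = c" using c p.D.D.M.minus_equality[of n "\<zero>\<^bsub>C n\<^esub>" "\<zero>\<^bsub>C n\<^esub>"]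
      by (simp add: p.D.cocycles_iff a_minus_def)
    finally show ?thesis .
  qed
  ultimately show "S \<in> Hp n ` carrier (cohomology B dB n)"
    using c by (auto simp: i.D.carrier_cohomology p.cohomology_map_cl image_iff intro!: bexI[of _ ?b])
qed

lemma exact_A:
  "conn n ` carrier (cohomology C dC n) = a_kernel (cohomology A dA (Suc n)) (cohomology B dB (Suc n)) (Hi (Suc n))"
proof (intro equalityI subsetI)
  fix S assume "S \<in> conn n ` carrier (cohomology C dC n)"
  then obtain c where c: "c \<in> cocycles C dC n" "S = conn n (p.D.cl n c)"
    by (auto simp: p.D.carrier_cohomology)
  obtain a b where l: "lifts n c b a" using lifts_exists c by blast
  have a: "a \<in> cocycles A dA (Suc n)" using lifts_cocycle[OF l] .
  have "i (Suc n) a \<in> coboundaries B dB (Suc n)" using l by (auto simp: lifts_def i.D.coboundaries_Suc)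
  then show "S \<in> a_kernel (cohomology A dA (Suc n)) (cohomology B dB (Suc n)) (Hi (Suc n))"
    using a c(2) conn_cl[OF c(1) l] i.cocycles
    by (simp add: a_kernel_def' i.C.cl_carrier i.cohomology_map_cl i.D.cl_eq_zero_iff)
next
  fix S assume S: "S \<in> a_kernel (cohomology A dA (Suc n)) (cohomology B dB (Suc n)) (Hi (Suc n))"
  then obtain a where a: "a \<in> cocycles A dA (Suc n)" "S = i.C.cl (Suc n) a"
    by (auto simp: a_kernel_def' i.C.carrier_cohomology)
  then have "i (Suc n) a \<in> coboundaries B dB (Suc n)"
    using S i.cocycles by (auto simp: a_kernel_def' i.cohomology_map_cl i.D.cl_eq_zero_iff)
  then obtain b where b: "b \<in> carrier (B n)" "i (Suc n) a = dB n b" by (auto simp: i.D.coboundaries_Suc)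
  have ac: "a \<in> carrier (A (Suc n))" using a by (simp add: i.C.cocycles_iff)
  have "p n b \<in> cocycles C dC n"
    using b p_i[OF ac] by (simp add: p.D.cocycles_iff p.commutes[symmetric])
  moreover have "lifts n (p n b) b a" using b ac by (simp add: lifts_def)
  ultimately have "conn n (p.D.cl n (p n b)) = S" "p.D.cl n (p n b) \<in> carrier (cohomology C dC n)"
    using conn_cl a p.D.cl_carrier by auto
  then show "S \<in> conn n ` carrier (cohomology C dC n)" by blast
qed

text \<open>This is the left end of the sequence. In degree 0 the only coboundary is zero, so that
  injectivity of \<open>i 0\<close> passes to classes.\<close>

lemma Hi_0_inj: "inj_on (Hi 0) (carrier (cohomology A dA 0))"
proof (rule inj_onI)
  fix S T assume S: "S \<in> carrier (cohomology A dA 0)" and T: "T \<in> carrier (cohomology A dA 0)"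
    and eq: "Hi 0 S = Hi 0 T"
  obtain x where x: "x \<in> cocycles A dA 0" "S = i.C.cl 0 x" using S by (auto simp: i.C.carrier_cohomology)
  obtain y where y: "y \<in> cocycles A dA 0" "T = i.C.cl 0 y" using T by (auto simp: i.C.carrier_cohomology)
  have xy: "x \<in> carrier (A 0)" "y \<in> carrier (A 0)" using x y by (auto simp: i.C.cocycles_iff)
  have "i 0 x \<ominus>\<^bsub>B 0\<^esub> i 0 y = \<zero>\<^bsub>B 0\<^esub>"
    using eq x y i.cocycles by (simp add: i.cohomology_map_cl i.D.cl_eq_iff i.D.coboundaries_0)
  then have "i 0 (x \<ominus>\<^bsub>A 0\<^esub> y) = i 0 \<zero>\<^bsub>A 0\<^esub>" using xy by (simp add: i.F.diff i.F.zero)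
  then have "x \<ominus>\<^bsub>A 0\<^esub> y = \<zero>\<^bsub>A 0\<^esub>" using xy by (intro i_inj) auto
  then show "S = T" using x y by (simp add: i.C.cl_eq_iff i.C.coboundaries_0)
qed

theorem long_exact: "long_exact_sequence A dA B dB C dC i p"
  unfolding long_exact_sequence_def Let_def
  by (intro conjI allI; rule i.C.module_cohomology i.D.module_cohomology p.D.module_cohomology
    i.linear_cohomology_map p.linear_cohomology_map linear_conn exact_A exact_B exact_C Hi_0_inj)

end

section \<open>The quotient of a complex by an embedded subcomplex\<close>

lemma short_exact_quotient_complex:
  fixes A :: "nat \<Rightarrow> ('k::field, 'u) module" and B :: "nat \<Rightarrow> ('k, 'v) module"
  assumes A: "cochain_complex A dA" and B: "cochain_complex B dB"
    and i: "cochain_map A dA B dB i" and inj: "\<And>n. inj_on (i n) (carrier (A n))"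
  shows "short_exact A dA B dB (quotient_complex A B i) (quotient_differential A B dB i) i
    (quotient_projection A B i)"
proof -
  interpret i: complex_map A dA B dB i by unfold_locales fact+
  let ?I = "\<lambda>n. i n ` carrier (A n)"
  let ?Q = "quotient_complex A B i" and ?dQ = "quotient_differential A B dB i"
  let ?p = "quotient_projection A B i"
  have q: "quotient_space (B n) (?I n)" for n
    by (intro quotient_space.intro quotient_space_axioms.intro i.D.D.M.module_axioms i.F.submodule_image)
  interpret q: quotient_space "B n" "?I n" for n by (rule q)
  have p: "?p n b = ?I n +>\<^bsub>B n\<^esub> b" for n b by (simp add: quotient_projection_def)
  have lin: "linear_map (B n) (B (Suc n)) (dB n)" for n by (rule i.D.D.linear)
  \<comment> \<open>The images form a subcomplex; this is what lets the differential descend to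
    cosets.\<close>
  have sub: "dB n ` ?I n \<subseteq> ?I (Suc n)" for n
    by (auto simp: i.commutes[symmetric])
  have dQ: "?dQ n (?p n b) = ?p (Suc n) (dB n b)" if "b \<in> carrier (B n)" for n b
    unfolding p quotient_differential_def using induced_map_coset[OF q q lin sub that] .
  have carrier: "carrier (?Q n) = ?p n ` carrier (B n)" for n
    by (auto simp: quotient_complex_def q.carrier_quotient p)
  have "cochain_complex ?Q ?dQ"
    unfolding cochain_complex_def
  proof (intro allI conjI ballI)
    fix n
    show "module field_ring (?Q n)" unfolding quotient_complex_def by (rule q.module_quotient)
    show "linear_map (?Q n) (?Q (Suc n)) (?dQ n)"
      unfolding quotient_complex_def quotient_differential_def by (rule linear_induced_map[OF q q lin sub])
    fix X assume "X \<in> carrier (?Q n)"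
    then obtain b where b: "b \<in> carrier (B n)" "X = ?p n b" by (auto simp: carrier)
    then show "?dQ (Suc n) (?dQ n X) = \<zero>\<^bsub>?Q (Suc (Suc n))\<^esub>"
      by (simp add: dQ i.D.d_d) (simp add: p q.coset_zero quotient_complex_def q.zero_quotient)
  qed
  moreover have "cochain_map B dB ?Q ?dQ ?p"
    unfolding cochain_map_def linear_map_def
  proof (intro allI conjI ballI funcsetI)
    fix n x y c assume x: "x \<in> carrier (B n)" and y: "y \<in> carrier (B n)"
    show "?p n x \<in> carrier (?Q n)" using x carrier by blast
    show "?p n (x \<oplus>\<^bsub>B n\<^esub> y) = ?p n x \<oplus>\<^bsub>?Q n\<^esub> ?p n y"
      using x y by (simp add: p quotient_complex_def q.add_quotient)
    show "?p n (c \<odot>\<^bsub>B n\<^esub> x) = c \<odot>\<^bsub>?Q n\<^esub> ?p n x"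
      using x by (simp add: p quotient_complex_def q.smult_quotient)
    show "?p (Suc n) (dB n x) = ?dQ n (?p n x)" using x by (simp add: dQ)
  qed
  moreover have "?I n = a_kernel (B n) (?Q n) (?p n)" for n
  proof -
    have "b \<in> ?I n \<longleftrightarrow> b \<in> a_kernel (B n) (?Q n) (?p n)" for b
      using q.coset_eq_U_iff[of b n] q.U_carrier[of b n]
      by (auto simp only: a_kernel_def' p quotient_complex_def q.zero_quotient mem_Collect_eq)
    then show ?thesis by blast
  qed
  ultimately show ?thesis
    unfolding short_exact_def using A B i inj carrier by (intro conjI allI) (assumption | simp only:)+
qed

section \<open>Alternating cochains\<close>

lemma del_nth_Cons [simp]:
  "del_nth 0 (x # xs) = xs" "del_nth (Suc i) (x # xs) = x # del_nth i xs"
  by (simp_all add: del_nth_def)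

lemma length_del_nth [simp]: "i < length xs \<Longrightarrow> length (del_nth i xs) = length xs - 1"
  by (simp add: del_nth_def)

lemma linearI:
  assumes "vector_space s1" "vector_space s2"
    "\<And>x y. f (x + y) = f x + f y" "\<And>c x. f (s1 c x) = s2 c (f x)"
  shows "Vector_Spaces.linear s1 s2 f"
  using assms by (simp add: Vector_Spaces.linear_iff)

lemma linear_simps:
  assumes "Vector_Spaces.linear s1 s2 f"
  shows "f (x + y) = f x + f y" "f (s1 c x) = s2 c (f x)" "f 0 = 0" "f (- x) = - f x" "f (x - y) = f x - f y"
proof -
  interpret Vector_Spaces.linear s1 s2 f by fact
  show "f (x + y) = f x + f y" "f (s1 c x) = s2 c (f x)" "f 0 = 0" "f (- x) = - f x" "f (x - y) = f x - f y"
    by (simp_all add: add scale zero neg diff)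
qed

lemma linear_vector_space:
  assumes "Vector_Spaces.linear s1 s2 f" shows "vector_space s1" "vector_space s2"
  using assms by (simp_all add: Vector_Spaces.linear_iff)

lemma linear_minus:
  assumes "Vector_Spaces.linear s1 s2 f" "Vector_Spaces.linear s1 s2 g"
  shows "Vector_Spaces.linear s1 s2 (\<lambda>x. f x - g x)"
proof -
  interpret vector_space s2 using assms linear_vector_space by blast
  show ?thesis using assms by (simp add: Vector_Spaces.linear_iff scale_right_diff_distrib)
qed

lemma linear_add:
  assumes "Vector_Spaces.linear s1 s2 f" "Vector_Spaces.linear s1 s2 g"
  shows "Vector_Spaces.linear s1 s2 (\<lambda>x. f x + g x)"
proof -
  interpret vector_space s2 using assms linear_vector_space by blast
  show ?thesis using assms by (simp add: Vector_Spaces.linear_iff scale_right_distrib)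
qed

lemma linear_scale:
  assumes "Vector_Spaces.linear s1 s2 f"
  shows "Vector_Spaces.linear s1 s2 (\<lambda>x. s2 c (f x))"
proof -
  interpret vector_space s2 using assms linear_vector_space by blast
  show ?thesis using assms by (simp add: Vector_Spaces.linear_iff scale_right_distrib scale_left_commute)
qed

lemma linear_zero:
  assumes "vector_space s1" "vector_space s2" shows "Vector_Spaces.linear s1 s2 (\<lambda>x. 0)"
proof -
  interpret vector_space s2 by fact
  show ?thesis using assms by (simp add: Vector_Spaces.linear_iff)
qed

lemma linear_sum:
  assumes "vector_space s1" "vector_space s2" "\<And>i. i \<in> I \<Longrightarrow> Vector_Spaces.linear s1 s2 (f i)"
  shows "Vector_Spaces.linear s1 s2 (\<lambda>x. \<Sum>i\<in>I. f i x)"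
  using assms(3) by (induction I rule: infinite_finite_induct) (auto intro: linear_zero linear_add assms(1,2))

lemma linear_comp:
  assumes "Vector_Spaces.linear s1 s2 f" "Vector_Spaces.linear s2 s3 g"
  shows "Vector_Spaces.linear s1 s3 (\<lambda>x. g (f x))"
  using assms by (simp add: Vector_Spaces.linear_iff)

lemma multilinear_0 [simp]: "multilinear sV sW 0 f"
  by (simp add: multilinear_def)

text \<open>Peeling off the first argument replaces updates at an arbitrary position; in this form
  multilinearity is open to induction on the number of arguments.\<close>

lemma multilinear_Suc:
  fixes f :: "'a::ab_group_add list \<Rightarrow> 'b::ab_group_add"
  shows "multilinear sV sW (Suc n) f \<longleftrightarrow>
    (\<forall>ys. length ys = n \<longrightarrow> Vector_Spaces.linear sV sW (\<lambda>x. f (x # ys))) \<and>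
    (\<forall>x. multilinear sV sW n (\<lambda>ys. f (x # ys)))"
proof (intro iffI conjI allI impI)
  fix ys :: "'a list" assume f: "multilinear sV sW (Suc n) f" and "length ys = n"
  then show "Vector_Spaces.linear sV sW (\<lambda>x. f (x # ys))"
    using f[unfolded multilinear_def, rule_format, of "_ # ys" 0] by simp
next
  fix x assume f: "multilinear sV sW (Suc n) f"
  show "multilinear sV sW n (\<lambda>ys. f (x # ys))"
    unfolding multilinear_def
  proof (intro allI impI)
    fix ys :: "'a list" and i assume "length ys = n" "i < n"
    then show "Vector_Spaces.linear sV sW (\<lambda>y. f (x # ys[i := y]))"
      using f[unfolded multilinear_def, rule_format, of "x # ys" "Suc i"] by simp
  qed
next
  assume f: "(\<forall>ys. length ys = n \<longrightarrow> Vector_Spaces.linear sV sW (\<lambda>x. f (x # ys))) \<and>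
    (\<forall>x. multilinear sV sW n (\<lambda>ys. f (x # ys)))"
  show "multilinear sV sW (Suc n) f"
    unfolding multilinear_def
  proof (intro allI impI)
    fix xs :: "'a list" and i assume xs: "length xs = Suc n" "i < Suc n"
    then obtain x ys where "xs = x # ys" "length ys = n" by (auto simp: length_Suc_conv)
    then show "Vector_Spaces.linear sV sW (\<lambda>z. f (xs[i := z]))"
      using f xs by (cases i) (auto simp: multilinear_def)
  qed
qed

text \<open>The last clause of \<open>alternating_maps\<close>, isolated so that it can be shifted
  under currying: \<open>m = 0\<close> belongs to Lie cochains, \<open>m = 1\<close> to pre-Lie
  cochains.\<close>

definition alternating_from :: "nat \<Rightarrow> nat \<Rightarrow> ('v list \<Rightarrow> 'w::zero) \<Rightarrow> bool" where
  "alternating_from m n f \<longleftrightarrow>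
    (\<forall>xs i j. length xs = n \<and> m \<le> i \<and> i < j \<and> j < n \<and> xs ! i = xs ! j \<longrightarrow> f xs = 0)"

lemma alternating_from_Suc:
  fixes f :: "'a list \<Rightarrow> 'b::zero"
  shows "alternating_from (Suc m) (Suc n) f \<longleftrightarrow> (\<forall>x. alternating_from m n (\<lambda>ys. f (x # ys)))"
proof (intro iffI allI)
  fix x assume f: "alternating_from (Suc m) (Suc n) f"
  show "alternating_from m n (\<lambda>ys. f (x # ys))"
    unfolding alternating_from_def
  proof (intro allI impI)
    fix ys :: "'a list" and i j assume "length ys = n \<and> m \<le> i \<and> i < j \<and> j < n \<and> ys ! i = ys ! j"
    then show "f (x # ys) = 0"
      using f[unfolded alternating_from_def, rule_format, of "x # ys" "Suc i" "Suc j"] by simp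
  qed
next
  assume f: "\<forall>x. alternating_from m n (\<lambda>ys. f (x # ys))"
  show "alternating_from (Suc m) (Suc n) f"
    unfolding alternating_from_def
  proof (intro allI impI)
    fix xs :: "'a list" and i j
    assume xs: "length xs = Suc n \<and> Suc m \<le> i \<and> i < j \<and> j < Suc n \<and> xs ! i = xs ! j"
    then obtain x ys i' j' where "xs = x # ys" "i = Suc i'" "j = Suc j'" "length ys = n"
      by (cases i; cases j) (auto simp: length_Suc_conv)
    then show "f xs = 0"
      using f[rule_format, of x, unfolded alternating_from_def, rule_format, of ys i' j'] xs by simp
  qed
qed

lemma alternating_from_Cons:
  fixes f :: "'a list \<Rightarrow> 'b::zero"
  assumes "alternating_from 0 (Suc n) f"
  shows "alternating_from 0 n (\<lambda>ys. f (x # ys))"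
  unfolding alternating_from_def
proof (intro allI impI)
  fix zs :: "'a list" and i j
  assume "length zs = n \<and> 0 \<le> i \<and> i < j \<and> j < n \<and> zs ! i = zs ! j"
  then show "f (x # zs) = 0"
    using assms[unfolded alternating_from_def, rule_format, of "x # zs" "Suc i" "Suc j"] by simp
qed

text \<open>The subspace \<open>S\<close> stands for the space of coefficients. It is the whole type
  for cochains of \<open>A \<otimes> P\<close>, and the set of linear maps inside a function type
  for curried pre-Lie cochains.\<close>

locale alternating_cochains =
  V: vector_space sV + W: vector_space sW
  for sV :: "'k::field \<Rightarrow> 'v::ab_group_add \<Rightarrow> 'v" and sW :: "'k \<Rightarrow> 'w::ab_group_add \<Rightarrow> 'w" +
  fixes S :: "'w set"
  assumes subspace: "W.subspace S"
begin

lemma sign_sign [simp]: "sW ((-1) ^ i) (sW ((-1) ^ i) w) = w"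
  by (simp flip: power_add mult_2_right)

definition cochain :: "nat \<Rightarrow> ('v list \<Rightarrow> 'w) \<Rightarrow> bool" where
  "cochain n f \<longleftrightarrow> multilinear sV sW n f \<and> alternating_from 0 n f \<and> (\<forall>xs. length xs = n \<longrightarrow> f xs \<in> S)"

lemma cochain_0 [simp]: "cochain 0 f \<longleftrightarrow> f [] \<in> S"
  by (simp add: cochain_def alternating_from_def)

text \<open>Polarization: expand \<open>f\<close> at \<open>x + y\<close> in both of the first two
  places. Starting from alternation instead of antisymmetry keeps this valid in characteristic
  2.\<close>

lemma swap:
  assumes f: "multilinear sV sW (Suc (Suc n)) f" and n: "length ys = n"
    and f0: "\<And>x. f (x # x # ys) = 0"
  shows "f (x # y # ys) = - f (y # x # ys)"
proof -
  have 1: "Vector_Spaces.linear sV sW (\<lambda>x. f (x # z # ys))" for z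
    using f n by (auto simp: multilinear_Suc)
  have 2: "Vector_Spaces.linear sV sW (\<lambda>x. f (z # x # ys))" for z
    using f n by (auto simp: multilinear_Suc)
  have "f ((x + y) # (x + y) # ys) = f (x # x # ys) + f (x # y # ys) + (f (y # x # ys) + f (y # y # ys))"
    using linear_simps(1)[OF 1] linear_simps(1)[OF 2] by simp
  then show ?thesis using f0 by (simp add: eq_neg_iff_add_eq_0)
qed

text \<open>The move takes \<open>p\<close> adjacent transpositions: the induction hypothesis brings
  the argument to the front of the tail, and \<open>swap\<close> exchanges it with the head.\<close>

lemma move_to_front:
  assumes "multilinear sV sW n f" "alternating_from 0 n f" "length ys = n" "p < n"
  shows "f ys = sW ((-1) ^ p) (f (ys ! p # del_nth p ys))"
  using assms
proof (induction p arbitrary: n f ys)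
  case 0
  then show ?case by (cases ys) auto
next
  case (Suc p)
  obtain y ys' where y: "ys = y # ys'" using Suc.prems(3,4) by (cases ys) auto
  define m where "m = n - 2"
  have ys: "ys = y # ys'" "length ys' = Suc m" "n = Suc (Suc m)"
    using Suc.prems(3,4) y by (auto simp: m_def)
  have a: "alternating_from 0 (Suc m) (\<lambda>ys. f (y # ys))"
    using alternating_from_Cons[of "Suc m" f y] Suc.prems(2) ys by simp
  have p: "p < Suc m" using Suc.prems(4) ys by simp
  have f0: "f (x # x # del_nth p ys') = 0" for x
    using Suc.prems(2)[unfolded alternating_from_def, rule_format, of "x # x # del_nth p ys'" 0 1] ys p by simp
  have "f (y # ys') = sW ((-1) ^ p) (f (y # ys' ! p # del_nth p ys'))"
    using Suc.IH[of "Suc m" "\<lambda>ys. f (y # ys)" ys'] Suc.prems a ys p by (simp add: multilinear_Suc)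
  also have "f (y # ys' ! p # del_nth p ys') = - f (ys' ! p # y # del_nth p ys')"
    using Suc.prems(1) f0 ys p by (intro swap[of m]) auto
  finally show ?case by (simp add: ys)
qed

text \<open>The recursive description of cochains on which the later inductions run. Equality of the
  head with an arbitrary later argument reduces to equality of the first two, because the tail map
  is alternating and \<open>move_to_front\<close> brings the later argument up.\<close>

lemma cochain_Suc:
  "cochain (Suc n) f \<longleftrightarrow>
    (\<forall>ys. length ys = n \<longrightarrow> Vector_Spaces.linear sV sW (\<lambda>x. f (x # ys))) \<and>
    (\<forall>x. cochain n (\<lambda>ys. f (x # ys))) \<and> (\<forall>x ys. Suc (length ys) = n \<longrightarrow> f (x # x # ys) = 0)"
proof (intro iffI conjI allI impI)
  assume f: "cochain (Suc n) f"
  have f0: "f xs = 0" if "length xs = Suc n" "i < j" "j < Suc n" "xs ! i = xs ! j" for xs i j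
    using f that unfolding cochain_def alternating_from_def by blast
  show "Vector_Spaces.linear sV sW (\<lambda>x. f (x # ys))" if "length ys = n" for ys
    using f that by (auto simp: cochain_def multilinear_Suc)
  show "f (x # x # ys) = 0" if "Suc (length ys) = n" for x ys
    using f0[of "x # x # ys" 0 1] that by simp
  show "cochain n (\<lambda>ys. f (x # ys))" for x
    using f alternating_from_Cons[of n f x] by (simp add: cochain_def multilinear_Suc)
next
  assume f: "(\<forall>ys. length ys = n \<longrightarrow> Vector_Spaces.linear sV sW (\<lambda>x. f (x # ys))) \<and>
    (\<forall>x. cochain n (\<lambda>ys. f (x # ys))) \<and> (\<forall>x ys. Suc (length ys) = n \<longrightarrow> f (x # x # ys) = 0)"
  have "multilinear sV sW (Suc n) f" using f by (auto simp: cochain_def multilinear_Suc)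
  moreover have "f xs \<in> S" if "length xs = Suc n" for xs
    using f that by (auto simp: cochain_def length_Suc_conv)
  moreover have "alternating_from 0 (Suc n) f"
    unfolding alternating_from_def
  proof (intro allI impI)
    fix xs :: "'v list" and i j
    assume xs: "length xs = Suc n \<and> 0 \<le> i \<and> i < j \<and> j < Suc n \<and> xs ! i = xs ! j"
    then obtain x ys j' where ys: "xs = x # ys" "j = Suc j'" "length ys = n" "j' < n"
      by (cases j) (auto simp: length_Suc_conv)
    have g: "cochain n (\<lambda>ys. f (x # ys))" using f by blast
    show "f xs = 0"
    proof (cases i)
      case 0
      have "f (x # ys) = sW ((-1) ^ j') (f (x # ys ! j' # del_nth j' ys))"
        using g ys move_to_front[of n "\<lambda>ys. f (x # ys)" ys j'] by (simp add: cochain_def)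
      also have "f (x # ys ! j' # del_nth j' ys) = 0" using f xs ys 0 by auto
      finally show ?thesis using ys by simp
    next
      case (Suc i')
      then show ?thesis using g xs ys by (auto simp: cochain_def alternating_from_def)
    qed
  qed
  ultimately show "cochain (Suc n) f" by (simp add: cochain_def)
qed

lemma cochain_linear: "cochain (Suc n) f \<Longrightarrow> length ys = n \<Longrightarrow> Vector_Spaces.linear sV sW (\<lambda>x. f (x # ys))"
  by (simp add: cochain_Suc)

lemma cochain_Cons: "cochain (Suc n) f \<Longrightarrow> cochain n (\<lambda>ys. f (x # ys))"
  by (simp add: cochain_Suc)

lemma cochain_repeat: "cochain (Suc (Suc n)) f \<Longrightarrow> length ys = n \<Longrightarrow> f (x # x # ys) = 0"
  by (simp add: cochain_Suc[of "Suc n"])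

lemma cochain_closed: "cochain n f \<Longrightarrow> length xs = n \<Longrightarrow> f xs \<in> S"
  by (simp add: cochain_def)

lemma cochain_swap: "cochain (Suc (Suc n)) f \<Longrightarrow> length ys = n \<Longrightarrow> f (x # y # ys) = - f (y # x # ys)"
  using swap[of n f ys x y] cochain_repeat[of n f ys] by (simp add: cochain_def)

lemma cochain_update_linear:
  "cochain n f \<Longrightarrow> length ys = n \<Longrightarrow> i < n \<Longrightarrow> Vector_Spaces.linear sV sW (\<lambda>x. f (ys[i := x]))"
  by (simp add: cochain_def multilinear_def)

text \<open>Coboundary formulas put a bracket in front and delete a position, whereas
  \<open>theta\<close> overwrites that position by the bracket; this converts one form into the
  other.\<close>

lemma cochain_move:
  assumes "cochain n f" "length ys = n" "p < n"
  shows "f (z # del_nth p ys) = sW ((-1) ^ p) (f (ys[p := z]))"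
proof -
  have "f (ys[p := z]) = sW ((-1) ^ p) (f (z # del_nth p ys))"
    using move_to_front[of n f "ys[p := z]" p] assms by (simp add: cochain_def del_nth_def)
  then show ?thesis by simp
qed

lemma cochain_diff:
  "cochain n f \<Longrightarrow> cochain n g \<Longrightarrow> cochain n (\<lambda>xs. f xs - g xs)"
  by (induction n arbitrary: f g) (auto simp: cochain_Suc intro: linear_minus W.subspace_diff[OF subspace])

lemma cochain_add:
  "cochain n f \<Longrightarrow> cochain n g \<Longrightarrow> cochain n (\<lambda>xs. f xs + g xs)"
  by (induction n arbitrary: f g) (auto simp: cochain_Suc intro: linear_add W.subspace_add[OF subspace])

lemma cochain_scale: "cochain n f \<Longrightarrow> cochain n (\<lambda>xs. sW c (f xs))"
  by (induction n arbitrary: f) (auto simp: cochain_Suc intro: linear_scale W.subspace_scale[OF subspace])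

lemma cochain_zero: "cochain n (\<lambda>xs. 0)"
  by (induction n) (auto simp: cochain_Suc W.subspace_0[OF subspace] intro: linear_zero V.vector_space_axioms W.vector_space_axioms)

text \<open>Values on lists of another length do not matter, so the extension by zero that the
  records demand can be put on or taken off.\<close>

lemma cochain_cong:
  assumes "cochain n f" "\<And>xs. length xs = n \<Longrightarrow> f xs = g xs" shows "cochain n g"
  using assms
proof (induction n arbitrary: f g)
  case (Suc n)
  have "Vector_Spaces.linear sV sW (\<lambda>x. g (x # ys))" if "length ys = n" for ys
    using cochain_linear[OF Suc.prems(1) that] Suc.prems(2) that by simp
  moreover have "cochain n (\<lambda>ys. g (x # ys))" for x
    using Suc.IH[OF cochain_Cons[OF Suc.prems(1)]] Suc.prems(2) by simp
  moreover have "g (x # x # ys) = 0" if "Suc (length ys) = n" for x ys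
    using Suc.prems(1) Suc.prems(2)[of "x # x # ys"] that by (simp add: cochain_Suc)
  ultimately show ?case by (simp add: cochain_Suc)
qed simp

end

section \<open>The Chevalley--Eilenberg complex\<close>

text \<open>The module laws are only required for \<open>m \<in> S\<close>: for the linear maps among all functions \<open>P \<Rightarrow> N\<close>.\<close>

locale lie_module = alternating_cochains sG sM S
  for sG :: "'k::field \<Rightarrow> 'g::ab_group_add \<Rightarrow> 'g" and sM :: "'k \<Rightarrow> 'm::ab_group_add \<Rightarrow> 'm" and S +
  fixes br :: "'g \<Rightarrow> 'g \<Rightarrow> 'g" and act :: "'g \<Rightarrow> 'm \<Rightarrow> 'm"
  assumes br_bilinear: "bilinear_map sG sG sG br"
    and br_self: "br x x = 0"
    and jacobi: "br x (br y z) = br (br x y) z + br y (br x z)"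
    and act_closed: "m \<in> S \<Longrightarrow> act x m \<in> S"
    and act_add: "m \<in> S \<Longrightarrow> m' \<in> S \<Longrightarrow> act x (m + m') = act x m + act x m'"
    and act_scale: "m \<in> S \<Longrightarrow> act x (sM c m) = sM c (act x m)"
    and act_linear: "m \<in> S \<Longrightarrow> Vector_Spaces.linear sG sM (\<lambda>x. act x m)"
    and act_br: "m \<in> S \<Longrightarrow> act (br x y) m = act x (act y m) - act y (act x m)"
begin

lemma br_left: "Vector_Spaces.linear sG sG (\<lambda>x. br x y)"
  and br_right: "Vector_Spaces.linear sG sG (br x)"
  using br_bilinear by (simp_all add: bilinear_map_def)

lemma act_zero: "act x 0 = 0"
  using act_scale[of 0 x 0] W.subspace_0[OF subspace] by simp

lemma act_diff: "m \<in> S \<Longrightarrow> m' \<in> S \<Longrightarrow> act x (m - m') = act x m - act x m'"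
  using act_add[of "m - m'" m' x] W.subspace_diff[OF subspace] by (simp add: algebra_simps)

lemma act_sum: "(\<And>i. i \<in> I \<Longrightarrow> f i \<in> S) \<Longrightarrow> act x (sum f I) = (\<Sum>i\<in>I. act x (f i))"
  by (induction I rule: infinite_finite_induct) (auto simp: act_zero act_add W.subspace_sum[OF subspace])

definition theta :: "'g \<Rightarrow> ('g list \<Rightarrow> 'm) \<Rightarrow> 'g list \<Rightarrow> 'm" where
  "theta u f us = act u (f us) - (\<Sum>j<length us. f (us[j := br u (us ! j)]))"

text \<open>Cartan's formula, read as a recursion.\<close>

primrec ce_d :: "'g list \<Rightarrow> ('g list \<Rightarrow> 'm) \<Rightarrow> 'm" where
  "ce_d [] f = 0"
| "ce_d (u # us) f = theta u f us - ce_d us (\<lambda>ys. f (u # ys))"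

lemma theta_Nil [simp]: "theta u f [] = act u (f [])"
  by (simp add: theta_def)

text \<open>Cartan's relation \<open>i_x \<theta>_u = \<theta>_u i_x - i_[u,x]\<close>, with
  \<open>i_x\<close> the insertion of \<open>x\<close> as first argument. It reduces identities
  between Lie derivatives to shorter lists.\<close>

lemma theta_Cons: "theta u f (x # ys) = theta u (\<lambda>ys. f (x # ys)) ys - f (br u x # ys)"
  by (simp add: theta_def sum.lessThan_Suc_shift del: sum.lessThan_Suc)

lemma theta_cong: "(\<And>ys. length ys = length us \<Longrightarrow> f ys = g ys) \<Longrightarrow> theta u f us = theta u g us"
  by (simp add: theta_def)

lemma theta_zero: "(\<And>ys. length ys = length us \<Longrightarrow> f ys = 0) \<Longrightarrow> theta u f us = 0"
  by (simp add: theta_def act_zero)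

lemma ce_d_cong: "(\<And>ys. Suc (length ys) = length us \<Longrightarrow> f ys = g ys) \<Longrightarrow> ce_d us f = ce_d us g"
proof (induction us arbitrary: f g)
  case (Cons u us)
  have "theta u f us = theta u g us" by (rule theta_cong) (simp add: Cons.prems)
  moreover have "ce_d us (\<lambda>ys. f (u # ys)) = ce_d us (\<lambda>ys. g (u # ys))"
    by (rule Cons.IH) (simp add: Cons.prems)
  ultimately show ?case by simp
qed simp

lemma ce_d_zero: "(\<And>ys. Suc (length ys) = length us \<Longrightarrow> f ys = 0) \<Longrightarrow> ce_d us f = 0"
  by (induction us arbitrary: f) (auto simp: theta_zero)

lemma theta_add:
  assumes "\<And>ys. length ys = length us \<Longrightarrow> f ys \<in> S" "\<And>ys. length ys = length us \<Longrightarrow> g ys \<in> S"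
  shows "theta u (\<lambda>ys. f ys + g ys) us = theta u f us + theta u g us"
  using assms by (simp add: theta_def act_add sum.distrib)

lemma theta_diff:
  assumes "\<And>ys. length ys = length us \<Longrightarrow> f ys \<in> S" "\<And>ys. length ys = length us \<Longrightarrow> g ys \<in> S"
  shows "theta u (\<lambda>ys. f ys - g ys) us = theta u f us - theta u g us"
  using assms by (simp add: theta_def act_diff sum_subtractf)

lemma theta_scale:
  assumes "\<And>ys. length ys = length us \<Longrightarrow> f ys \<in> S"
  shows "theta u (\<lambda>ys. sM c (f ys)) us = sM c (theta u f us)"
  using assms by (simp add: theta_def act_scale W.scale_right_diff_distrib W.scale_sum_right)

lemma ce_d_add:
  assumes "\<And>ys. Suc (length ys) = length us \<Longrightarrow> f ys \<in> S" "\<And>ys. Suc (length ys) = length us \<Longrightarrow> g ys \<in> S"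
  shows "ce_d us (\<lambda>ys. f ys + g ys) = ce_d us f + ce_d us g"
  using assms
proof (induction us arbitrary: f g)
  case (Cons u us)
  show ?case using Cons.IH[of "\<lambda>ys. f (u # ys)" "\<lambda>ys. g (u # ys)"] Cons.prems theta_add[of us f g u]
    by simp
qed simp

lemma ce_d_diff:
  assumes "\<And>ys. Suc (length ys) = length us \<Longrightarrow> f ys \<in> S" "\<And>ys. Suc (length ys) = length us \<Longrightarrow> g ys \<in> S"
  shows "ce_d us (\<lambda>ys. f ys - g ys) = ce_d us f - ce_d us g"
  using assms
proof (induction us arbitrary: f g)
  case (Cons u us)
  show ?case using Cons.IH[of "\<lambda>ys. f (u # ys)" "\<lambda>ys. g (u # ys)"] Cons.prems theta_diff[of us f g u]
    by simp
qed simp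

lemma ce_d_scale:
  assumes "\<And>ys. Suc (length ys) = length us \<Longrightarrow> f ys \<in> S"
  shows "ce_d us (\<lambda>ys. sM c (f ys)) = sM c (ce_d us f)"
  using assms
proof (induction us arbitrary: f)
  case (Cons u us)
  show ?case using Cons.IH[of "\<lambda>ys. f (u # ys)"] Cons.prems theta_scale[of us f u c]
    by (simp add: W.scale_right_diff_distrib)
qed simp

lemma cochain_theta: "cochain n f \<Longrightarrow> cochain n (theta u f)"
proof (induction n arbitrary: f)
  case 0
  then show ?case by (simp add: act_closed)
next
  case (Suc n)
  have lin: "Vector_Spaces.linear sG sM (\<lambda>x. theta u f (x # ys))" if ys: "length ys = n" for ys
  proof -
    have f: "Vector_Spaces.linear sG sM (\<lambda>x. f (x # zs))" if "length zs = n" for zs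
      using Suc.prems that by (rule cochain_linear)
    have "Vector_Spaces.linear sG sM (\<lambda>x. act u (f (x # ys)))"
      using linear_simps(1,2)[OF f[OF ys]] cochain_closed[OF Suc.prems] ys
      by (intro linearI V.vector_space_axioms W.vector_space_axioms) (simp_all add: act_add act_scale)
    moreover have "Vector_Spaces.linear sG sM (\<lambda>x. f (br u x # ys))"
      using linear_comp[OF br_right f[OF ys]] .
    ultimately show ?thesis
      unfolding theta_Cons unfolding theta_def
      using ys by (intro linear_minus linear_sum f V.vector_space_axioms W.vector_space_axioms) auto
  qed
  have coch: "cochain n (\<lambda>ys. theta u f (x # ys))" for x
    unfolding theta_Cons using Suc.IH cochain_Cons[OF Suc.prems] by (intro cochain_diff) auto
  have rep: "theta u f (x # x # ys) = 0" if len: "Suc (length ys) = n" for x ys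
  proof -
    obtain m where n: "n = Suc m" "length ys = m" using len by blast
    have "theta u (\<lambda>ys. f (x # x # ys)) ys = 0"
      using Suc.prems n by (intro theta_zero) (simp add: cochain_repeat)
    \<comment> \<open>The two updates that insert \<open>br u x\<close> at one of the two equal
      arguments differ by a transposition and cancel.\<close>
    moreover have "f (x # br u x # ys) = - f (br u x # x # ys)"
      using Suc.prems n by (intro cochain_swap) auto
    ultimately show ?thesis by (simp add: theta_Cons)
  qed
  show ?case using lin coch rep by (simp add: cochain_Suc)
qed

lemma cochain_ce_d: "cochain n f \<Longrightarrow> cochain (Suc n) (\<lambda>us. ce_d us f)"
proof (induction n arbitrary: f)
  case 0
  then show ?case by (simp add: cochain_Suc act_closed act_linear)
next
  case (Suc n)
  have f: "Vector_Spaces.linear sG sM (\<lambda>x. f (x # zs))" if "length zs = n" for zs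
    using Suc.prems that by (rule cochain_linear)
  have fS: "f (x # zs) \<in> S" if "length zs = n" for x zs
    using Suc.prems that by (simp add: cochain_closed)
  have lin: "Vector_Spaces.linear sG sM (\<lambda>u. ce_d (u # us) f)" if us: "length us = Suc n" for us
  proof -
    have "Vector_Spaces.linear sG sM (\<lambda>u. f (us[j := br u (us ! j)]))" if "j < length us" for j
      using linear_comp[OF br_left cochain_update_linear[OF Suc.prems us, of j]] us that by simp
    then have "Vector_Spaces.linear sG sM (\<lambda>u. theta u f us)"
      unfolding theta_def
      using us Suc.prems cochain_closed
      by (intro linear_minus linear_sum act_linear V.vector_space_axioms W.vector_space_axioms) auto
    \<comment> \<open>Here \<open>u\<close> enters only as the first argument of \<open>f\<close>,
      so linearity in \<open>u\<close> comes from linearity of \<open>ce_d\<close> in the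
      cochain.\<close>
    moreover have "Vector_Spaces.linear sG sM (\<lambda>u. ce_d us (\<lambda>ys. f (u # ys)))"
    proof (rule linearI[OF V.vector_space_axioms W.vector_space_axioms])
      fix x y and c
      have "ce_d us (\<lambda>ys. f ((x + y) # ys)) = ce_d us (\<lambda>ys. f (x # ys) + f (y # ys))"
        using us by (intro ce_d_cong) (simp add: linear_simps(1)[OF f])
      then show "ce_d us (\<lambda>ys. f ((x + y) # ys)) = ce_d us (\<lambda>ys. f (x # ys)) + ce_d us (\<lambda>ys. f (y # ys))"
        using us fS by (simp add: ce_d_add)
      have "ce_d us (\<lambda>ys. f (sG c x # ys)) = ce_d us (\<lambda>ys. sM c (f (x # ys)))"
        using us by (intro ce_d_cong) (simp add: linear_simps(2)[OF f])
      then show "ce_d us (\<lambda>ys. f (sG c x # ys)) = sM c (ce_d us (\<lambda>ys. f (x # ys)))"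
        using us fS by (simp add: ce_d_scale)
    qed
    ultimately show ?thesis by (simp add: linear_minus)
  qed
  have coch: "cochain (Suc n) (\<lambda>us. ce_d (u # us) f)" for u
    using cochain_diff[OF cochain_theta[OF Suc.prems] Suc.IH[OF cochain_Cons[OF Suc.prems]]] by simp
  \<comment> \<open>After two unfoldings the \<open>theta\<close> terms cancel up to
    \<open>f (br u u # us)\<close> by Cartan's relation; that term is zero, and inserting
    \<open>u\<close> twice gives zero by alternation.\<close>
  have rep: "ce_d (u # u # us) f = 0" if us: "length us = n" for u us
  proof -
    have "ce_d us (\<lambda>ys. f (u # u # ys)) = 0"
    proof (rule ce_d_zero)
      fix ys :: "'g list" assume "Suc (length ys) = length us"
      then have "n = Suc (length ys)" using us by simp
      then show "f (u # u # ys) = 0" using Suc.prems by (simp add: cochain_repeat)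
    qed
    moreover have "f (0 # us) = 0" using linear_simps(3)[OF f[OF us]] .
    ultimately show ?thesis by (simp add: theta_Cons br_self)
  qed
  show ?case using lin coch rep by (simp add: cochain_Suc[of "Suc n"])
qed

lemma theta_commutator:
  "cochain n f \<Longrightarrow> length us = n \<Longrightarrow>
    theta u (theta v f) us - theta v (theta u f) us = theta (br u v) f us"
proof (induction n arbitrary: f us)
  case 0
  then show ?case by (simp add: act_br)
next
  case (Suc n)
  then obtain x ys where us: "us = x # ys" "length ys = n" by (auto simp: length_Suc_conv)
  have c: "cochain n (\<lambda>ys. f (z # ys))" for z using Suc.prems cochain_Cons by blast
  have S: "f (z # zs) \<in> S" "theta w (\<lambda>ys. f (z # ys)) zs \<in> S" if "length zs = n" for w z zs
    using cochain_closed[OF c that] cochain_closed[OF cochain_theta[OF c] that] by auto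
  have expand: "theta u (theta v f) us =
      theta u (theta v (\<lambda>ys. f (x # ys))) ys - theta u (\<lambda>ys. f (br v x # ys)) ys
      - theta v (\<lambda>ys. f (br u x # ys)) ys + f (br v (br u x) # ys)" for u v
    using us S by (simp add: theta_Cons theta_diff)
  \<comment> \<open>The two middle terms of \<open>expand\<close> are exchanged by swapping
    \<open>u\<close> and \<open>v\<close> and drop out of the commutator; the last ones combine by
    the Jacobi identity.\<close>
  have "br v (br u x) - br u (br v x) = - br (br u v) x"
    using jacobi[of u v x] by simp
  then have "f (br v (br u x) # ys) - f (br u (br v x) # ys) = - f (br (br u v) x # ys)"
    using linear_simps[OF cochain_linear[OF Suc.prems(1) us(2)]] by metis
  then show ?case
    using Suc.IH[OF c us(2), of x] unfolding expand
    by (simp add: us(1) theta_Cons algebra_simps)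
qed

text \<open>The coboundary commutes with the Lie derivative. When \<open>x\<close> is peeled off,
  the two sides differ by a commutator of Lie derivatives, which is \<open>theta (br u x) f\<close>;
  Cartan's formula at the updated head \<open>br u x\<close> supplies exactly this term.\<close>

lemma ce_d_theta:
  "cochain n f \<Longrightarrow> length us = Suc n \<Longrightarrow> ce_d us (theta u f) = theta u (\<lambda>ws. ce_d ws f) us"
proof (induction n arbitrary: f us)
  case 0
  then obtain x where "us = [x]" by (auto simp: length_Suc_conv)
  then show ?case using act_br[of "f []" u x] 0 by (simp add: theta_Cons)
next
  case (Suc n)
  then obtain x ys where us: "us = x # ys" "length ys = Suc n" by (auto simp: length_Suc_conv)
  have c: "cochain n (\<lambda>ys. f (z # ys))" for z using Suc.prems cochain_Cons by blast
  have S: "f (z # zs) \<in> S" "theta w (\<lambda>ys. f (z # ys)) zs \<in> S" if "length zs = n" for w z zs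
    using cochain_closed[OF c that] cochain_closed[OF cochain_theta[OF c] that] by auto
  have dS: "theta x f zs \<in> S" "ce_d zs (\<lambda>ys. f (x # ys)) \<in> S" if "length zs = Suc n" for zs
    using cochain_closed[OF cochain_theta[OF Suc.prems(1)] that] cochain_closed[OF cochain_ce_d[OF c] that] by auto
  have "ce_d us (theta u f) = theta x (theta u f) ys - ce_d ys (theta u (\<lambda>ys. f (x # ys)))
      + ce_d ys (\<lambda>ys. f (br u x # ys))"
    using us S by (simp add: theta_Cons ce_d_diff)
  moreover have "theta u (\<lambda>ws. ce_d ws f) us = theta u (theta x f) ys
      - theta u (\<lambda>ws. ce_d ws (\<lambda>ys. f (x # ys))) ys - theta (br u x) f ys + ce_d ys (\<lambda>ys. f (br u x # ys))"
    using us dS by (simp add: theta_Cons theta_diff)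
  moreover have "theta (br u x) f ys = theta u (theta x f) ys - theta x (theta u f) ys"
    using theta_commutator[OF Suc.prems(1) us(2), of u x] by simp
  ultimately show ?case using Suc.IH[OF c us(2), of x] by simp
qed

text \<open>Cartan's formula used twice gives
  \<open>i_u d d = \<theta>_u d - d \<theta>_u + d d i_u\<close>: the first two terms cancel by
  \<open>ce_d_theta\<close>, the last vanishes by induction.\<close>

lemma ce_d_ce_d: "cochain n f \<Longrightarrow> length us = Suc (Suc n) \<Longrightarrow> ce_d us (\<lambda>ws. ce_d ws f) = 0"
proof (induction n arbitrary: f us)
  case 0
  then obtain x y where us: "us = [x, y]" by (auto simp: length_Suc_conv)
  have S: "f [] \<in> S" using 0 by simp
  have "act (br x y) (f []) = act x (act y (f [])) - act y (act x (f []))" using act_br S .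
  then show ?case by (simp add: us theta_Cons act_diff act_closed S act_zero)
next
  case (Suc n)
  then obtain u vs where us: "us = u # vs" "length vs = Suc (Suc n)" by (auto simp: length_Suc_conv)
  have c: "cochain n (\<lambda>ys. f (u # ys))" using Suc.prems cochain_Cons by blast
  have dS: "theta u f zs \<in> S" "ce_d zs (\<lambda>ys. f (u # ys)) \<in> S" if "length zs = Suc n" for zs
    using cochain_closed[OF cochain_theta[OF Suc.prems(1)] that] cochain_closed[OF cochain_ce_d[OF c] that] by auto
  have "ce_d vs (\<lambda>ws. theta u f ws - ce_d ws (\<lambda>ys. f (u # ys))) =
      ce_d vs (theta u f) - ce_d vs (\<lambda>ws. ce_d ws (\<lambda>ys. f (u # ys)))"
    using us dS by (intro ce_d_diff) auto
  then show ?case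
    using Suc.IH[OF c us(2)] ce_d_theta[OF Suc.prems(1) us(2), of u] us by simp
qed

text \<open>The terms of the explicit formula in which the head \<open>u\<close> acts or is
  bracketed make up \<open>theta u\<close>. In all the others \<open>u\<close> is a mere argument of
  \<open>f\<close>; swapping it in front of the bracket leaves minus the explicit formula for
  \<open>f (u # _)\<close>.\<close>

lemma lie_coboundary_eq_ce_d:
  "cochain n f \<Longrightarrow> length us = Suc n \<Longrightarrow> lie_coboundary sM br act n f us = ce_d us f"
proof (induction n arbitrary: f us)
  case 0
  then obtain x where "us = [x]" by (auto simp: length_Suc_conv)
  then show ?case by (simp add: lie_coboundary_def)
next
  case (Suc n)
  then obtain u vs where us: "us = u # vs" "length vs = Suc n" by (auto simp: length_Suc_conv)
  have c: "cochain n (\<lambda>ys. f (u # ys))" using Suc.prems cochain_Cons by blast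
  let ?g = "\<lambda>ys. f (u # ys)"
  have act: "(\<Sum>i<Suc (Suc n). sM ((-1) ^ i) (act (us ! i) (f (del_nth i us)))) =
      act u (f vs) - (\<Sum>i<Suc n. sM ((-1) ^ i) (act (vs ! i) (?g (del_nth i vs))))"
    by (subst sum.lessThan_Suc_shift) (simp add: us(1) sum_negf del: sum.lessThan_Suc)
  have br: "(\<Sum>i<Suc j. sM ((-1) ^ (i + Suc j)) (f (br (us ! i) (us ! Suc j) # del_nth i (del_nth (Suc j) us)))) =
      - f (vs[j := br u (vs ! j)]) - (\<Sum>i<j. sM ((-1) ^ (i + j)) (?g (br (vs ! i) (vs ! j) # del_nth i (del_nth j vs))))"
    if j: "j < Suc n" for j
  proof -
    have swap: "f (z # u # del_nth i (del_nth j vs)) = - f (u # z # del_nth i (del_nth j vs))"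
      if i: "i < j" for i z
      using Suc.prems(1) us(2) i j by (intro cochain_swap[of "n - 1"]) auto
    have "f (br u (vs ! j) # del_nth j vs) = sM ((-1) ^ j) (f (vs[j := br u (vs ! j)]))"
      using cochain_move[OF Suc.prems(1) us(2) j] .
    then show ?thesis
      by (subst sum.lessThan_Suc_shift) (simp add: us(1) swap sum_negf del: sum.lessThan_Suc)
  qed
  have "(\<Sum>j<Suc (Suc n). \<Sum>i<j. sM ((-1) ^ (i + j)) (f (br (us ! i) (us ! j) # del_nth i (del_nth j us)))) =
     (\<Sum>j<Suc n. \<Sum>i<Suc j. sM ((-1) ^ (i + Suc j)) (f (br (us ! i) (us ! Suc j) # del_nth i (del_nth (Suc j) us))))"
    by (subst sum.lessThan_Suc_shift) (simp del: sum.lessThan_Suc power_Suc)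
  also have "\<dots> = - (\<Sum>j<Suc n. f (vs[j := br u (vs ! j)])) -
     (\<Sum>j<Suc n. \<Sum>i<j. sM ((-1) ^ (i + j)) (?g (br (vs ! i) (vs ! j) # del_nth i (del_nth j vs))))"
    using br by (simp add: sum_subtractf sum_negf del: sum.lessThan_Suc)
  finally have "lie_coboundary sM br act (Suc n) f us = theta u f vs - lie_coboundary sM br act n ?g vs"
    unfolding lie_coboundary_def using act us by (simp add: theta_def del: sum.lessThan_Suc)
  then show ?case using Suc.IH[OF c us(2)] us by simp
qed

end

section \<open>The pre-Lie complex\<close>

lemma module_alternating_maps:
  assumes "vector_space sV" "vector_space sW"
  shows "module field_ring (alternating_maps m sV sW n)"
proof -
  interpret V: vector_space sV by fact
  interpret W: vector_space sW by fact
  let ?M = "alternating_maps m sV sW n"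
  have add: "(\<lambda>xs. f xs + g xs) \<in> carrier ?M" if "f \<in> carrier ?M" "g \<in> carrier ?M" for f g
    using that by (auto simp: alternating_maps_def multilinear_def intro: linear_add)
  have scale: "(\<lambda>xs. sW c (f xs)) \<in> carrier ?M" if "f \<in> carrier ?M" for c f
    using that by (auto simp: alternating_maps_def multilinear_def intro: linear_scale)
  have zero: "(\<lambda>xs. 0) \<in> carrier ?M"
    by (auto simp: alternating_maps_def multilinear_def intro: linear_zero assms)
  note ops = alternating_maps_def[THEN arg_cong[where f = ring.add], simplified]
    alternating_maps_def[THEN arg_cong[where f = ring.zero], simplified]
    alternating_maps_def[THEN arg_cong[where f = module.smult], simplified]
  show ?thesis
  proof (rule moduleI[OF cring_field_ring])
    show "abelian_group ?M"
    proof (rule abelian_groupI)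
      fix f assume f: "f \<in> carrier ?M"
      show "\<exists>g\<in>carrier ?M. g \<oplus>\<^bsub>?M\<^esub> f = \<zero>\<^bsub>?M\<^esub>"
        using scale[OF f, of "- 1"] by (intro bexI[of _ "\<lambda>xs. sW (- 1) (f xs)"]) (simp_all add: ops)
    qed (use add zero in \<open>simp_all add: ops ac_simps\<close>)
  qed (use scale in \<open>simp_all add: ops W.scale_left_distrib W.scale_right_distrib\<close>)
qed

lemma alternating_maps_simps [simp]:
  "\<zero>\<^bsub>alternating_maps m sV sW n\<^esub> = (\<lambda>xs. 0)"
  "f \<oplus>\<^bsub>alternating_maps m sV sW n\<^esub> g = (\<lambda>xs. f xs + g xs)"
  "c \<odot>\<^bsub>alternating_maps m sV sW n\<^esub> f = (\<lambda>xs. sW c (f xs))"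
  by (simp_all add: alternating_maps_def)

lemma carrier_alternating_maps:
  "f \<in> carrier (alternating_maps m sV sW n) \<longleftrightarrow>
    (\<forall>xs. length xs \<noteq> n \<longrightarrow> f xs = 0) \<and> multilinear sV sW n f \<and> alternating_from m n f"
  by (simp add: alternating_maps_def alternating_from_def)

lemma (in alternating_cochains) carrier_lie_cochains:
  assumes "S = UNIV"
  shows "f \<in> carrier (lie_cochains sV sW n) \<longleftrightarrow> (\<forall>xs. length xs \<noteq> n \<longrightarrow> f xs = 0) \<and> cochain n f"
  unfolding cochain_def using assms by (simp add: lie_cochains_def carrier_alternating_maps)

lemma (in lie_module) lie_coboundary_eq:
  "cochain n f \<Longrightarrow> lie_coboundary sM br act n f = (\<lambda>us. if length us = Suc n then ce_d us f else 0)"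
  using lie_coboundary_eq_ce_d by (auto simp: lie_coboundary_def fun_eq_iff)

lemma (in lie_module) cochain_complex_lie:
  assumes S: "S = UNIV"
  shows "cochain_complex (lie_cochains sG sM) (lie_coboundary sM br act)"
  unfolding cochain_complex_def
proof (intro allI conjI ballI)
  fix n
  note carrier = carrier_lie_cochains[OF S]
  show "module field_ring (lie_cochains sG sM n)"
    unfolding lie_cochains_def by (intro module_alternating_maps V.vector_space_axioms W.vector_space_axioms)
  have ext: "cochain (Suc n) (\<lambda>us. if length us = Suc n then ce_d us f else 0)" if "cochain n f" for n f
    by (rule cochain_cong[OF cochain_ce_d[OF that]]) simp
  show "linear_map (lie_cochains sG sM n) (lie_cochains sG sM (Suc n)) (lie_coboundary sM br act n)"
    unfolding linear_map_def
  proof (intro conjI funcsetI ballI allI)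
    fix f assume f: "f \<in> carrier (lie_cochains sG sM n)"
    then have cf: "cochain n f" by (simp add: carrier)
    show "lie_coboundary sM br act n f \<in> carrier (lie_cochains sG sM (Suc n))"
      using ext[OF cf] by (simp add: carrier lie_coboundary_eq[OF cf])
    show "lie_coboundary sM br act n (c \<odot>\<^bsub>lie_cochains sG sM n\<^esub> f) =
        c \<odot>\<^bsub>lie_cochains sG sM (Suc n)\<^esub> lie_coboundary sM br act n f" for c
      using ce_d_scale[of _ f c] S
      by (auto simp: lie_cochains_def lie_coboundary_eq[OF cf] lie_coboundary_eq[OF cochain_scale[OF cf]] fun_eq_iff)
    fix g assume "g \<in> carrier (lie_cochains sG sM n)"
    then have cg: "cochain n g" by (simp add: carrier)
    show "lie_coboundary sM br act n (f \<oplus>\<^bsub>lie_cochains sG sM n\<^esub> g) =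
        lie_coboundary sM br act n f \<oplus>\<^bsub>lie_cochains sG sM (Suc n)\<^esub> lie_coboundary sM br act n g"
      using ce_d_add[of _ f g] S
      by (auto simp: lie_cochains_def lie_coboundary_eq[OF cf] lie_coboundary_eq[OF cg]
          lie_coboundary_eq[OF cochain_add[OF cf cg]] fun_eq_iff)
  qed
  fix f assume "f \<in> carrier (lie_cochains sG sM n)"
  then have cf: "cochain n f" by (simp add: carrier)
  have "ce_d us (\<lambda>us. if length us = Suc n then ce_d us f else 0) = 0" if us: "length us = Suc (Suc n)" for us
  proof -
    have "ce_d us (\<lambda>us. if length us = Suc n then ce_d us f else 0) = ce_d us (\<lambda>us. ce_d us f)"
      using us by (intro ce_d_cong) simp
    then show ?thesis using ce_d_ce_d[OF cf us] by simp
  qed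
  then show "lie_coboundary sM br act (Suc n) (lie_coboundary sM br act n f) = \<zero>\<^bsub>lie_cochains sG sM (Suc (Suc n))\<^esub>"
    unfolding lie_coboundary_eq[OF cf] lie_coboundary_eq[OF ext[OF cf]]
    by (auto simp: lie_cochains_def fun_eq_iff)
qed

lemma sum_fun_apply: "(\<Sum>i\<in>I. f i) x = (\<Sum>i\<in>I. f i (x :: 'a) :: 'b::comm_monoid_add)"
  by (induction I rule: infinite_finite_induct) auto

lemma del_nth_del_nth: "i < j \<Longrightarrow> j < length xs \<Longrightarrow> del_nth (j - 1) (del_nth i xs) = del_nth i (del_nth j xs)"
proof (induction xs arbitrary: i j)
  case (Cons x xs)
  then obtain j' where j: "j = Suc j'" by (cases j) auto
  show ?case
  proof (cases i)
    case (Suc i')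
    then show ?thesis using Cons.IH[of i' j'] Cons.prems j by (cases j') auto
  qed (simp add: j)
qed simp

lemma del_nth_update: "i < j \<Longrightarrow> j < length xs \<Longrightarrow> (del_nth i xs)[j - 1 := z] = del_nth i (xs[j := z])"
proof (induction xs arbitrary: i j)
  case (Cons x xs)
  then obtain j' where j: "j = Suc j'" by (cases j) auto
  show ?case
  proof (cases i)
    case (Suc i')
    then show ?thesis using Cons.IH[of i' j'] Cons.prems j by (cases j') auto
  qed (simp add: j)
qed simp

section \<open>The Lie module \<open>Hom(P, N)\<close> and the curried pre-Lie complex\<close>

locale pre_lie_module =
  fixes sP :: "'k::field \<Rightarrow> 'p::ab_group_add \<Rightarrow> 'p" and mP :: "'p \<Rightarrow> 'p \<Rightarrow> 'p"
    and sN :: "'k \<Rightarrow> 'n::ab_group_add \<Rightarrow> 'n"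
    and lN :: "'p \<Rightarrow> 'n \<Rightarrow> 'n" and rN :: "'n \<Rightarrow> 'p \<Rightarrow> 'n"
  assumes pre_lie: "pre_lie_algebra sP mP"
    and bimodule: "pre_lie_bimodule sP mP sN lN rN"
begin

lemma right_symmetric: "mP (mP a b) c - mP a (mP b c) = mP (mP a c) b - mP a (mP c b)"
  using pre_lie by (simp add: pre_lie_algebra_def)

lemma bimodule_left: "lN (mP a b) m - lN a (lN b m) = rN (lN a m) b - lN a (rN m b)"
  and bimodule_right: "rN (rN m a) b - rN m (mP a b) = rN (rN m b) a - rN m (mP b a)"
  using bimodule unfolding pre_lie_bimodule_def by blast+

sublocale P: vector_space sP
  using pre_lie by (simp add: pre_lie_algebra_def)

sublocale N: vector_space sN
  using bimodule by (simp add: pre_lie_bimodule_def)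

lemma mP_linear: "Vector_Spaces.linear sP sP (mP x)" "Vector_Spaces.linear sP sP (\<lambda>x. mP x y)"
  using pre_lie by (simp_all add: pre_lie_algebra_def bilinear_map_def)

lemma lN_linear: "Vector_Spaces.linear sN sN (lN x)" "Vector_Spaces.linear sP sN (\<lambda>x. lN x m)"
  and rN_linear: "Vector_Spaces.linear sP sN (rN m)" "Vector_Spaces.linear sN sN (\<lambda>m. rN m x)"
  using bimodule by (simp_all add: pre_lie_bimodule_def bilinear_map_def)

lemmas mP_simps = linear_simps[OF mP_linear(1)] linear_simps[OF mP_linear(2)]
lemmas lN_simps = linear_simps[OF lN_linear(1)] linear_simps[OF lN_linear(2)]
lemmas rN_simps = linear_simps[OF rN_linear(1)] linear_simps[OF rN_linear(2)]

definition hom_scale :: "'k \<Rightarrow> ('p \<Rightarrow> 'n) \<Rightarrow> 'p \<Rightarrow> 'n" where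
  "hom_scale c \<phi> = (\<lambda>x. sN c (\<phi> x))"

text \<open>Opposite to \<open>pre_lie_bracket\<close>, so that right multiplication becomes a
  representation.\<close>

definition op_br :: "'p \<Rightarrow> 'p \<Rightarrow> 'p" where
  "op_br x y = mP y x - mP x y"

text \<open>The three single sums of the pre-Lie coboundary, taken together for one index:
  \<open>x\<close> is the first argument and \<open>u\<close> the argument that is singled
  out.\<close>

definition hom_act :: "'p \<Rightarrow> ('p \<Rightarrow> 'n) \<Rightarrow> 'p \<Rightarrow> 'n" where
  "hom_act u \<phi> = (\<lambda>x. lN x (\<phi> u) - \<phi> (mP x u) + rN (\<phi> x) u)"

abbreviation Hom :: "('p \<Rightarrow> 'n) set" where "Hom \<equiv> {\<phi>. Vector_Spaces.linear sP sN \<phi>}"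

lemma vector_space_hom: "vector_space hom_scale"
  by unfold_locales (auto simp: hom_scale_def fun_eq_iff N.scale_left_distrib N.scale_right_distrib)

sublocale H: vector_space hom_scale by (rule vector_space_hom)

lemma linear_hom_iff:
  "Vector_Spaces.linear sP hom_scale F \<longleftrightarrow> (\<forall>x. Vector_Spaces.linear sP sN (\<lambda>u. F u x))"
  using P.vector_space_axioms N.vector_space_axioms vector_space_hom
  by (auto simp: Vector_Spaces.linear_iff fun_eq_iff hom_scale_def)

lemma hom_simps:
  assumes "\<phi> \<in> Hom"
  shows "\<phi> (x + y) = \<phi> x + \<phi> y" "\<phi> (sP c x) = sN c (\<phi> x)" "\<phi> 0 = 0" "\<phi> (- x) = - \<phi> x" "\<phi> (x - y) = \<phi> x - \<phi> y"
  using linear_simps[of sP sN \<phi>] assms by auto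

text \<open>The Jacobi defect is a signed sum of three right-symmetry defects, one for each choice
  of the left factor.\<close>

lemma op_br_jacobi: "op_br x (op_br y z) = op_br (op_br x y) z + op_br y (op_br x z)"
proof -
  have "op_br x (op_br y z) - (op_br (op_br x y) z + op_br y (op_br x z)) =
      (mP (mP y x) z - mP y (mP x z) - (mP (mP y z) x - mP y (mP z x)))
      - (mP (mP x y) z - mP x (mP y z) - (mP (mP x z) y - mP x (mP z y)))
      - (mP (mP z x) y - mP z (mP x y) - (mP (mP z y) x - mP z (mP y x)))"
    by (simp add: op_br_def mP_simps algebra_simps)
  then show ?thesis
    using right_symmetric[of x y z] right_symmetric[of y x z] right_symmetric[of z x y] by simp
qed

sublocale hom: lie_module sP hom_scale Hom op_br hom_act
proof (intro lie_module.intro alternating_cochains.intro alternating_cochains_axioms.intro lie_module_axioms.intro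
    P.vector_space_axioms vector_space_hom)
  show "H.subspace Hom"
    unfolding H.subspace_def
    by (auto simp: hom_scale_def zero_fun_def plus_fun_def intro: linear_zero linear_add linear_scale P.vector_space_axioms N.vector_space_axioms)
  show "bilinear_map sP sP sP op_br"
    unfolding bilinear_map_def op_br_def by (auto intro: linear_minus mP_linear)
  show "op_br x x = 0" for x by (simp add: op_br_def)
  show "op_br x (op_br y z) = op_br (op_br x y) z + op_br y (op_br x z)" for x y z
    by (rule op_br_jacobi)
  fix \<phi> \<phi>' c x y assume \<phi>: "\<phi> \<in> Hom"
  show "hom_act x \<phi> \<in> Hom"
    using \<phi> unfolding hom_act_def
    by (auto intro!: linear_add linear_minus lN_linear linear_comp[OF mP_linear(2)] linear_comp[OF _ rN_linear(2)])
  show "hom_act x (hom_scale c \<phi>) = hom_scale c (hom_act x \<phi>)"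
    by (auto simp: hom_act_def hom_scale_def fun_eq_iff lN_simps rN_simps N.scale_right_distrib
        N.scale_right_diff_distrib)
  show "Vector_Spaces.linear sP hom_scale (\<lambda>x. hom_act x \<phi>)"
    unfolding linear_hom_iff using \<phi> unfolding hom_act_def
    by (auto intro!: linear_add linear_minus rN_linear linear_comp[OF _ lN_linear(1)] linear_comp[OF mP_linear(1)])
  show "hom_act (op_br x y) \<phi> = hom_act x (hom_act y \<phi>) - hom_act y (hom_act x \<phi>)"
  proof
    fix z
    \<comment> \<open>The defect of the module law splits into two defects of the left bimodule
      axiom, one of the right axiom, and \<open>\<phi>\<close> applied to one right-symmetry
      defect.\<close>
    have "hom_act (op_br x y) \<phi> z - (hom_act x (hom_act y \<phi>) - hom_act y (hom_act x \<phi>)) z =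
        (lN (mP z x) (\<phi> y) - lN z (lN x (\<phi> y)) - (rN (lN z (\<phi> y)) x - lN z (rN (\<phi> y) x)))
        - (lN (mP z y) (\<phi> x) - lN z (lN y (\<phi> x)) - (rN (lN z (\<phi> x)) y - lN z (rN (\<phi> x) y)))
        + (rN (rN (\<phi> z) x) y - rN (\<phi> z) (mP x y) - (rN (rN (\<phi> z) y) x - rN (\<phi> z) (mP y x)))
        - (\<phi> (mP (mP z x) y - mP z (mP x y)) - \<phi> (mP (mP z y) x - mP z (mP y x)))"
      by (simp add: hom_act_def op_br_def lN_simps rN_simps mP_simps hom_simps[OF \<phi>] algebra_simps)
    then show "hom_act (op_br x y) \<phi> z = (hom_act x (hom_act y \<phi>) - hom_act y (hom_act x \<phi>)) z"
      using bimodule_left[of z x "\<phi> y"] bimodule_left[of z y "\<phi> x"] bimodule_right[of "\<phi> z" x y]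
        right_symmetric[of z x y]
      by simp
  qed
  assume "\<phi>' \<in> Hom"
  show "hom_act x (\<phi> + \<phi>') = hom_act x \<phi> + hom_act x \<phi>'"
    by (auto simp: hom_act_def fun_eq_iff lN_simps rN_simps)
qed

definition curry1 :: "('p list \<Rightarrow> 'n) \<Rightarrow> 'p list \<Rightarrow> 'p \<Rightarrow> 'n" where
  "curry1 f as = (\<lambda>x. f (x # as))"

text \<open>Linearity in the first argument turns into the requirement that values lie in
  \<open>Hom\<close>; linearity and alternation in the other arguments can be tested pointwise in
  the first.\<close>

lemma curry1_cochain_iff:
  "hom.cochain n (curry1 f) \<longleftrightarrow> multilinear sP sN (Suc n) f \<and> alternating_from (Suc 0) (Suc n) f"
proof -
  have "multilinear sP hom_scale n (curry1 f) \<longleftrightarrow> (\<forall>x. multilinear sP sN n (\<lambda>ys. f (x # ys)))"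
    unfolding multilinear_def linear_hom_iff curry1_def by blast
  moreover have "alternating_from 0 n (curry1 f) \<longleftrightarrow> alternating_from (Suc 0) (Suc n) f"
    unfolding alternating_from_Suc unfolding alternating_from_def curry1_def zero_fun_def fun_eq_iff by blast
  ultimately show ?thesis
    unfolding hom.cochain_def multilinear_Suc by (auto simp: curry1_def)
qed

lemma carrier_pre_cochains_0 [simp]: "carrier (pre_cochains sP sN 0) = {\<lambda>xs. 0}"
  by (simp add: pre_cochains_def)

lemma carrier_pre_cochains_Suc:
  "f \<in> carrier (pre_cochains sP sN (Suc n)) \<longleftrightarrow>
    (\<forall>xs. length xs \<noteq> Suc n \<longrightarrow> f xs = 0) \<and> hom.cochain n (curry1 f)"
  by (simp add: pre_cochains_def carrier_alternating_maps curry1_cochain_iff)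

lemma pre_coboundary_eq_lie:
  assumes f: "hom.cochain n (curry1 f)" and as: "length as = Suc n"
  shows "pre_coboundary mP sN lN rN (Suc n) f (x # as) =
    lie_coboundary hom_scale op_br hom_act n (curry1 f) as x"
proof -
  have br: "sN ((-1) ^ i) (f (x # del_nth i (as[j := pre_lie_bracket mP (as ! i) (as ! j)]))) =
      hom_scale ((-1) ^ (i + j)) (curry1 f (op_br (as ! i) (as ! j) # del_nth i (del_nth j as))) x"
    if ij: "i < j" "j < Suc n" for i j
  proof -
    let ?z = "pre_lie_bracket mP (as ! i) (as ! j)"
    obtain m where n: "n = Suc m" using ij by (cases n) auto
    have d: "length (del_nth i (del_nth j as)) = m" using as ij n by simp
    have "curry1 f (op_br (as ! i) (as ! j) # del_nth i (del_nth j as)) =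
        - curry1 f (?z # del_nth i (del_nth j as))"
      using linear_simps(4)[OF hom.cochain_linear[OF f[unfolded n] d], of ?z]
      by (simp add: op_br_def pre_lie_bracket_def)
    \<comment> \<open>Once position \<open>i\<close> is deleted, the bracket stands at position
      \<open>j - 1\<close>. Moving it to the front costs \<open>(-1) ^ (j - 1)\<close> and the
      opposite bracket costs one more sign, which reduces \<open>(-1) ^ (i + j)\<close> to
      \<open>(-1) ^ i\<close>.\<close>
    also have "curry1 f (?z # del_nth i (del_nth j as)) =
        hom_scale ((-1) ^ (j - 1)) (curry1 f (del_nth i (as[j := ?z])))"
    proof -
      have "j - 1 < n" using ij by linarith
      then show ?thesis
        using hom.cochain_move[OF f, of "del_nth i as" "j - 1" ?z] as ij
          del_nth_del_nth[of i j as] del_nth_update[of i j as ?z] by simp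
    qed
    finally have "hom_scale ((-1) ^ (i + j)) (curry1 f (op_br (as ! i) (as ! j) # del_nth i (del_nth j as))) =
       hom_scale (- ((-1) ^ (i + j) * (-1) ^ (j - 1))) (curry1 f (del_nth i (as[j := ?z])))"
      by (simp add: hom_scale_def fun_eq_iff)
    moreover have "- ((-1) ^ (i + j) * (-1) ^ (j - 1)) = ((-1) ^ i :: 'k)"
    proof -
      obtain j' where "j = Suc j'" using ij by (cases j) auto
      then show ?thesis by (simp add: power_add)
    qed
    ultimately have "hom_scale ((-1) ^ (i + j)) (curry1 f (op_br (as ! i) (as ! j) # del_nth i (del_nth j as))) =
       hom_scale ((-1) ^ i) (curry1 f (del_nth i (as[j := ?z])))" by (simp only:)
    then show ?thesis by (simp add: curry1_def hom_scale_def fun_eq_iff)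
  qed
  \<comment> \<open>The sums of \<open>pre_coboundary\<close> start at 1 because position 0 holds
    the first argument \<open>x\<close>; after currying the positions of \<open>as\<close> start at
    0.\<close>
  have shift: "(\<Sum>i=1..Suc n. F i) = (\<Sum>i<Suc n. F (Suc i))" for F :: "nat \<Rightarrow> 'n"
    by (simp only: One_nat_def sum.atLeast1_atMost_eq)
  have shift2: "(\<Sum>j=1..Suc n. \<Sum>i=1..<j. F i j) = (\<Sum>j<Suc n. \<Sum>i<j. F (Suc i) (Suc j))"
    for F :: "nat \<Rightarrow> nat \<Rightarrow> 'n"
    by (simp only: One_nat_def sum.atLeast1_atMost_eq sum.atLeast_Suc_lessThan_Suc_shift atLeast0LessThan o_def)
  have sign: "sN ((-1) ^ (Suc i + 1)) y = sN ((-1) ^ i) y" for i y by simp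
  have "(\<Sum>j<Suc n. \<Sum>i<j. sN ((-1) ^ (Suc i + 1))
          (f (del_nth (Suc i) ((x # as)[Suc j := pre_lie_bracket mP ((x # as) ! Suc i) ((x # as) ! Suc j)])))) =
      (\<Sum>j<Suc n. \<Sum>i<j. hom_scale ((-1) ^ (i + j)) (curry1 f (op_br (as ! i) (as ! j) # del_nth i (del_nth j as))) x)"
    unfolding sign using br by (intro sum.cong refl) simp
  then show ?thesis
    unfolding pre_coboundary_def lie_coboundary_def unfolding shift2 unfolding shift
    using as
    by (simp add: sum_fun_apply sum_negf hom_scale_def hom_act_def curry1_def N.scale_right_distrib
        N.scale_right_diff_distrib sum.distrib sum_subtractf del: sum.lessThan_Suc)
qed

lemma pre_coboundary_eq_ce_d:
  assumes f: "hom.cochain n (curry1 f)" and as: "length as = Suc n"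
  shows "curry1 (pre_coboundary mP sN lN rN (Suc n) f) as = hom.ce_d as (curry1 f)"
  using pre_coboundary_eq_lie[OF assms] hom.lie_coboundary_eq_ce_d[OF assms] by (simp add: curry1_def)

lemma pre_coboundary_0: "pre_coboundary mP sN lN rN 0 f = (\<lambda>xs. 0)"
  by (auto simp: pre_coboundary_def fun_eq_iff)

lemma pre_coboundary_length: "length as \<noteq> Suc n \<Longrightarrow> pre_coboundary mP sN lN rN n f as = 0"
  by (auto simp: pre_coboundary_def)

lemma cochain_pre_coboundary:
  assumes "hom.cochain n (curry1 f)"
  shows "hom.cochain (Suc n) (curry1 (pre_coboundary mP sN lN rN (Suc n) f))"
  using hom.cochain_cong[OF hom.cochain_ce_d[OF assms]] pre_coboundary_eq_ce_d[OF assms] by metis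

lemma pre_coboundary_pre_coboundary:
  assumes f: "hom.cochain n (curry1 f)"
  shows "pre_coboundary mP sN lN rN (Suc (Suc n)) (pre_coboundary mP sN lN rN (Suc n) f) = (\<lambda>xs. 0)"
proof
  fix xs
  show "pre_coboundary mP sN lN rN (Suc (Suc n)) (pre_coboundary mP sN lN rN (Suc n) f) xs = 0"
  proof (cases "length xs = Suc (Suc (Suc n))")
    case True
    then obtain x as where xs: "xs = x # as" "length as = Suc (Suc n)" by (auto simp: length_Suc_conv)
    have "hom.ce_d as (curry1 (pre_coboundary mP sN lN rN (Suc n) f)) = hom.ce_d as (\<lambda>ws. hom.ce_d ws (curry1 f))"
      using xs pre_coboundary_eq_ce_d[OF f] by (intro hom.ce_d_cong) simp
    also have "\<dots> = 0" using hom.ce_d_ce_d[OF f xs(2)] .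
    finally have "curry1 (pre_coboundary mP sN lN rN (Suc (Suc n)) (pre_coboundary mP sN lN rN (Suc n) f)) as = 0"
      using pre_coboundary_eq_ce_d[OF cochain_pre_coboundary[OF f] xs(2)] by simp
    then show ?thesis using xs by (simp add: curry1_def fun_eq_iff)
  qed (simp add: pre_coboundary_length)
qed

lemma pre_cochains_simps [simp]:
  "\<zero>\<^bsub>pre_cochains sP sN n\<^esub> = (\<lambda>xs. 0)"
  "f \<oplus>\<^bsub>pre_cochains sP sN n\<^esub> g = (\<lambda>xs. f xs + g xs)"
  "c \<odot>\<^bsub>pre_cochains sP sN n\<^esub> f = (\<lambda>xs. sN c (f xs))"
  using alternating_maps_simps[where m = 1 and sV = sP and sW = sN and n = n]
  by (simp_all add: pre_cochains_def)

lemma module_pre_cochains: "module field_ring (pre_cochains sP sN n)"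
proof (cases n)
  case 0
  show ?thesis unfolding 0
  proof (rule moduleI[OF cring_field_ring])
    show "abelian_group (pre_cochains sP sN 0)" by (rule abelian_groupI) simp_all
  qed simp_all
next
  case (Suc m)
  then show ?thesis
    using module_alternating_maps[OF P.vector_space_axioms N.vector_space_axioms, of 1 n]
    by (simp add: pre_cochains_def)
qed

lemma cochain_complex_pre: "cochain_complex (pre_cochains sP sN) (pre_coboundary mP sN lN rN)"
  unfolding cochain_complex_def
proof (intro allI conjI ballI)
  fix n
  let ?C = "pre_cochains sP sN" and ?d = "pre_coboundary mP sN lN rN"
  show "module field_ring (?C n)" by (rule module_pre_cochains)
  show "linear_map (?C n) (?C (Suc n)) (?d n)"
  proof (cases n)
    case 0
    then show ?thesis
      using abelian_group.axioms(1)[OF module.axioms(2)[OF module_pre_cochains[of "Suc 0"]], THEN abelian_monoid.zero_closed]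
      by (simp add: linear_map_def pre_coboundary_0)
  next
    case (Suc m)
    show ?thesis unfolding linear_map_def
    proof (intro conjI funcsetI ballI allI)
      fix f g c assume f: "f \<in> carrier (?C n)"
      then show "?d n f \<in> carrier (?C (Suc n))"
        using cochain_pre_coboundary[of m f] pre_coboundary_length[of _ n f]
        by (simp add: Suc carrier_pre_cochains_Suc)
      show "?d n (f \<oplus>\<^bsub>?C n\<^esub> g) = ?d n f \<oplus>\<^bsub>?C (Suc n)\<^esub> ?d n g"
        by (auto simp: pre_coboundary_def fun_eq_iff lN_simps rN_simps N.scale_right_distrib sum.distrib
            sum_subtractf sum_negf)
      show "?d n (c \<odot>\<^bsub>?C n\<^esub> f) = c \<odot>\<^bsub>?C (Suc n)\<^esub> ?d n f"
        by (auto simp: pre_coboundary_def fun_eq_iff lN_simps rN_simps N.scale_right_distrib N.scale_sum_right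
            N.scale_right_diff_distrib mult.commute)
    qed
  qed
  fix f assume "f \<in> carrier (?C n)"
  then show "?d (Suc n) (?d n f) = \<zero>\<^bsub>?C (Suc (Suc n))\<^esub>"
    using pre_coboundary_pre_coboundary[of _ f]
    by (cases n) (auto simp: carrier_pre_cochains_Suc pre_coboundary_0 pre_coboundary_def[of _ _ _ _ "Suc 0"]
        fun_eq_iff lN_simps rN_simps)
qed

end

section \<open>Tensor products\<close>

lemma lookup_free_scale [simp]: "Poly_Mapping.lookup (free_scale c p) k = c * Poly_Mapping.lookup p k"
  by (simp add: free_scale_def Poly_Mapping.map.rep_eq when_def)

lemma vector_space_free_scale: "vector_space (free_scale :: 'k::field \<Rightarrow> ('b \<Rightarrow>\<^sub>0 'k) \<Rightarrow> _)"
  by unfold_locales (auto intro!: poly_mapping_eqI simp: lookup_add algebra_simps)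

lemma space_of_simps [simp]:
  "carrier (space_of s) = UNIV" "\<zero>\<^bsub>space_of s\<^esub> = 0" "x \<oplus>\<^bsub>space_of s\<^esub> y = x + y" "c \<odot>\<^bsub>space_of s\<^esub> x = s c x"
  by (simp_all add: space_of_def)

lemma module_space_of:
  assumes "vector_space s" shows "module field_ring (space_of s)"
proof -
  interpret vector_space s by fact
  show ?thesis
  proof (rule moduleI[OF cring_field_ring])
    show "abelian_group (space_of s)"
    proof (rule abelian_groupI)
      fix x
      show "\<exists>y\<in>carrier (space_of s). y \<oplus>\<^bsub>space_of s\<^esub> x = \<zero>\<^bsub>space_of s\<^esub>"
        by (intro bexI[of _ "- x"]) auto
    qed (simp_all add: ac_simps)
  qed (simp_all add: scale_left_distrib scale_right_distrib)
qed

lemma minus_space_of [simp]: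
  assumes "vector_space s" shows "x \<ominus>\<^bsub>space_of s\<^esub> y = x - y"
proof -
  interpret module field_ring "space_of s" using assms by (rule module_space_of)
  have "\<ominus>\<^bsub>space_of s\<^esub> y = - y" using M.minus_equality[of "- y" y] by simp
  then show ?thesis by (simp add: a_minus_def)
qed

lemma quotient_space_space_of:
  assumes "vector_space s" "module.subspace s U" shows "quotient_space (space_of s) U"
proof -
  interpret vector_space s by fact
  interpret M: module field_ring "space_of s" using assms(1) by (rule module_space_of)
  have "submodule U field_ring (space_of s)"
  proof (rule M.submoduleI)
    fix a assume a: "a \<in> U"
    have "\<ominus>\<^bsub>space_of s\<^esub> a = - a" using M.M.minus_equality[of "- a" a] by simp
    then show "\<ominus>\<^bsub>space_of s\<^esub> a \<in> U" using a assms(2) subspace_neg by simp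
  qed (use assms(2) in \<open>simp_all add: subspace_def\<close>)
  then show ?thesis by (intro quotient_space.intro quotient_space_axioms.intro M.module_axioms)
qed

definition linear_ext :: "('k::field \<Rightarrow> 'w::ab_group_add \<Rightarrow> 'w) \<Rightarrow> ('x \<Rightarrow> 'w) \<Rightarrow> ('x \<Rightarrow>\<^sub>0 'k) \<Rightarrow> 'w" where
  "linear_ext s g p = (\<Sum>k\<in>Poly_Mapping.keys p. s (Poly_Mapping.lookup p k) (g k))"

lemma linear_ext_superset:
  assumes "vector_space s" "finite K" "Poly_Mapping.keys p \<subseteq> K"
  shows "linear_ext s g p = (\<Sum>k\<in>K. s (Poly_Mapping.lookup p k) (g k))"
proof -
  interpret vector_space s by fact
  show ?thesis
    unfolding linear_ext_def by (rule sum.mono_neutral_left) (use assms in \<open>auto simp: in_keys_iff\<close>)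
qed

lemma linear_linear_ext:
  fixes g :: "'x \<Rightarrow> 'w::ab_group_add" and s :: "'k::field \<Rightarrow> 'w \<Rightarrow> 'w"
  assumes s: "vector_space s"
  shows "Vector_Spaces.linear free_scale s (linear_ext s g)"
proof (rule linearI[OF vector_space_free_scale s])
  interpret vector_space s by fact
  fix p q :: "'x \<Rightarrow>\<^sub>0 'k" and c :: 'k
  let ?K = "Poly_Mapping.keys p \<union> Poly_Mapping.keys q"
  have "linear_ext s g (p + q) = (\<Sum>k\<in>?K. s (Poly_Mapping.lookup (p + q) k) (g k))"
    by (rule linear_ext_superset[OF s]) (auto simp: keys_add)
  moreover have "linear_ext s g p = (\<Sum>k\<in>?K. s (Poly_Mapping.lookup p k) (g k))"
    "linear_ext s g q = (\<Sum>k\<in>?K. s (Poly_Mapping.lookup q k) (g k))"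
    by (auto intro: linear_ext_superset[OF s])
  ultimately show "linear_ext s g (p + q) = linear_ext s g p + linear_ext s g q"
    by (simp add: lookup_add scale_left_distrib sum.distrib)
  have "linear_ext s g (free_scale c p) = (\<Sum>k\<in>Poly_Mapping.keys p. s (Poly_Mapping.lookup (free_scale c p) k) (g k))"
    by (rule linear_ext_superset[OF s]) (auto simp: in_keys_iff)
  then show "linear_ext s g (free_scale c p) = s c (linear_ext s g p)"
    by (simp add: linear_ext_def scale_sum_right)
qed

lemma linear_ext_single:
  assumes "vector_space s" shows "linear_ext s g (Poly_Mapping.single k c) = s c (g k)"
proof -
  interpret vector_space s by fact
  show ?thesis by (cases "c = 0") (simp_all add: linear_ext_def)
qed

lemma sum_scaled_singles:
  "(\<Sum>k\<in>Poly_Mapping.keys f. free_scale (Poly_Mapping.lookup f k) (Poly_Mapping.single k 1)) = f"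
proof (rule poly_mapping_eqI)
  fix k
  have "(\<Sum>a\<in>Poly_Mapping.keys f. Poly_Mapping.lookup f a * (1 when a = k)) =
      (\<Sum>a\<in>Poly_Mapping.keys f. if k = a then Poly_Mapping.lookup f a else 0)"
    by (intro sum.cong) (auto simp: when_def)
  then show "Poly_Mapping.lookup (\<Sum>k\<in>Poly_Mapping.keys f.
      free_scale (Poly_Mapping.lookup f k) (Poly_Mapping.single k 1)) k = Poly_Mapping.lookup f k"
    by (simp add: lookup_sum lookup_single in_keys_iff)
qed

lemma bilinear_map_simps:
  assumes "bilinear_map s1 s2 s3 B"
  shows "B (x + x') y = B x y + B x' y" "B x (y + y') = B x y + B x y'"
    "B (s1 c x) y = s3 c (B x y)" "B x (s2 c y) = s3 c (B x y)"
    "B 0 y = 0" "B x 0 = 0" "B (- x) y = - B x y" "B x (- y) = - B x y"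
    "B (x - x') y = B x y - B x' y" "B x (y - y') = B x y - B x y'"
  using assms linear_simps[of s1 s3 "\<lambda>x. B x y"] linear_simps[of s2 s3 "B x"]
  by (simp_all add: bilinear_map_def)

lemma bilinear_map_vector_space:
  assumes "bilinear_map s1 s2 s3 B" shows "vector_space s1" "vector_space s2" "vector_space s3"
  using assms linear_vector_space unfolding bilinear_map_def by blast+

lemma bilinear_map_linear:
  assumes "bilinear_map s1 s2 s3 B"
  shows "Vector_Spaces.linear s2 s3 (B x)" "Vector_Spaces.linear s1 s3 (\<lambda>x. B x y)"
  using assms by (auto simp: bilinear_map_def)

lemma linear_span_zero:
  assumes "Vector_Spaces.linear s1 s2 f" "\<And>x. x \<in> B \<Longrightarrow> f x = 0" "x \<in> module.span s1 B"
  shows "f x = 0"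
proof -
  interpret Vector_Spaces.linear s1 s2 f by fact
  show ?thesis using assms(2,3) by (rule eq_0_on_span)
qed

locale tensor =
  A: vector_space sA + P: vector_space sP + T: vector_space sT
  for sA :: "'k::field \<Rightarrow> 'a::ab_group_add \<Rightarrow> 'a" and sP :: "'k \<Rightarrow> 'p::ab_group_add \<Rightarrow> 'p"
    and sT :: "'k \<Rightarrow> 't::ab_group_add \<Rightarrow> 't" +
  fixes \<tau> :: "'a \<Rightarrow> 'p \<Rightarrow> 't"
  assumes tensor_product: "tensor_product sA sP sT \<tau>"
begin

abbreviation "F \<equiv> space_of (free_scale :: 'k \<Rightarrow> ('a \<times> 'p \<Rightarrow>\<^sub>0 'k) \<Rightarrow> _)"
abbreviation "R \<equiv> module.span free_scale (tensor_relations sA sP)"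
abbreviation "e a p \<equiv> Poly_Mapping.single (a, p) (1::'k)"

interpretation F: vector_space "free_scale :: 'k \<Rightarrow> ('a \<times> 'p \<Rightarrow>\<^sub>0 'k) \<Rightarrow> _"
  by (rule vector_space_free_scale)

interpretation Q: quotient_space F R
  by (intro quotient_space_space_of vector_space_free_scale F.subspace_span)

definition \<phi> :: "'t \<Rightarrow> ('a \<times> 'p \<Rightarrow>\<^sub>0 'k) set" where
  "\<phi> = (SOME \<phi>. linear_iso (space_of sT) (quotient_module F R) \<phi> \<and> (\<forall>a p. \<phi> (\<tau> a p) = R +>\<^bsub>F\<^esub> e a p))"

lemma \<phi>_iso: "linear_iso (space_of sT) (quotient_module F R) \<phi>"
  and \<phi>_tau: "\<phi> (\<tau> a p) = R +>\<^bsub>F\<^esub> e a p"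
proof -
  have "\<exists>\<phi>. linear_iso (space_of sT) (quotient_module F R) \<phi> \<and> (\<forall>a p. \<phi> (\<tau> a p) = R +>\<^bsub>F\<^esub> e a p)"
    using tensor_product by (simp add: tensor_product_def Let_def)
  note \<phi> = someI_ex[OF this, folded \<phi>_def]
  show "linear_iso (space_of sT) (quotient_module F R) \<phi>" using \<phi> by (rule conjunct1)
  show "\<phi> (\<tau> a p) = R +>\<^bsub>F\<^esub> e a p" using \<phi>[THEN conjunct2] by simp
qed

lemma inj_\<phi>: "inj \<phi>"
  using \<phi>_iso by (simp add: linear_iso_def bij_betw_def)

lemma \<phi>_add: "\<phi> (x + y) = \<phi> x \<oplus>\<^bsub>quotient_module F R\<^esub> \<phi> y"
  and \<phi>_scale: "\<phi> (sT c x) = c \<odot>\<^bsub>quotient_module F R\<^esub> \<phi> x"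
  using \<phi>_iso by (simp_all add: linear_iso_def linear_map_def)

lemma \<phi>_cases: obtains f where "\<phi> t = R +>\<^bsub>F\<^esub> f"
proof -
  have "\<phi> t \<in> carrier (quotient_module F R)" using \<phi>_iso by (auto simp: linear_iso_def linear_map_def)
  then show ?thesis using that by (rule Q.quotient_cases)
qed

lemma coset_eq_iff: "R +>\<^bsub>F\<^esub> f = R +>\<^bsub>F\<^esub> g \<longleftrightarrow> f - g \<in> R"
  using Q.coset_eq_iff[of f g] by (simp add: minus_space_of[OF vector_space_free_scale])

lemma relations:
  "e (a + a') p - e a p - e a' p \<in> R" "e a (p + p') - e a p - e a p' \<in> R"
  "e (sA c a) p - free_scale c (e a p) \<in> R" "e a (sP c p) - free_scale c (e a p) \<in> R"
  by (rule F.span_base, force simp: tensor_relations_def Let_def)+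

lemma bilinear_tau: "bilinear_map sA sP sT \<tau>"
proof -
  have eq: "\<phi> (\<tau> (a + a') p) = \<phi> (\<tau> a p + \<tau> a' p)" "\<phi> (\<tau> a (p + p')) = \<phi> (\<tau> a p + \<tau> a p')"
    "\<phi> (\<tau> (sA c a) p) = \<phi> (sT c (\<tau> a p))" "\<phi> (\<tau> a (sP c p)) = \<phi> (sT c (\<tau> a p))" for a a' p p' c
    using relations(1)[of a a' p] relations(2)[of a p p'] relations(3)[of c a p] relations(4)[of a c p]
    by (simp_all add: \<phi>_add \<phi>_scale \<phi>_tau Q.add_quotient Q.smult_quotient coset_eq_iff diff_diff_eq)
  have "\<tau> (a + a') p = \<tau> a p + \<tau> a' p" "\<tau> a (p + p') = \<tau> a p + \<tau> a p'"
    "\<tau> (sA c a) p = sT c (\<tau> a p)" "\<tau> a (sP c p) = sT c (\<tau> a p)" for a a' p p' c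
    by (rule injD[OF inj_\<phi>], rule eq)+
  then show ?thesis
    unfolding bilinear_map_def
    by (auto intro!: linearI A.vector_space_axioms P.vector_space_axioms T.vector_space_axioms)
qed

lemmas tau_simps = bilinear_map_simps[OF bilinear_tau]

text \<open>Every element is a sum of scaled pure tensors, and a scalar can be absorbed into the
  first factor; so closure under addition suffices.\<close>

lemma tensor_induct [case_names pure add]:
  assumes pure: "\<And>a p. Q (\<tau> a p)" and add: "\<And>t u. Q t \<Longrightarrow> Q u \<Longrightarrow> Q (t + u)"
  shows "Q t"
proof -
  let ?\<tau> = "\<lambda>k. \<tau> (fst k) (snd k)"
  have Q0: "Q 0" using pure[of 0 0] by (simp add: tau_simps)
  have Qsum: "Q (\<Sum>k\<in>K. sT (h k) (?\<tau> k))" if "finite K" for K h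
    using that
  proof (induction K)
    case (insert k K)
    then show ?case using add pure[of "sA (h k) (fst k)" "snd k"] by (simp add: tau_simps)
  qed (simp add: Q0)
  have \<phi>sum: "\<phi> (\<Sum>k\<in>K. sT (h k) (?\<tau> k)) = R +>\<^bsub>F\<^esub> (\<Sum>k\<in>K. free_scale (h k) (e (fst k) (snd k)))"
    if "finite K" for K h
    using that
  proof (induction K)
    case empty
    have "\<phi> 0 = R +>\<^bsub>F\<^esub> 0"
      using \<phi>_scale[of 0 "\<tau> 0 0"] \<phi>_tau[of 0 0] Q.smult_quotient[of "e 0 0" 0] by simp
    then show ?case by simp
  next
    case (insert k K)
    then show ?case by (simp add: \<phi>_add \<phi>_scale \<phi>_tau Q.add_quotient Q.smult_quotient)
  qed
  obtain f where f: "\<phi> t = R +>\<^bsub>F\<^esub> f" by (rule \<phi>_cases)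
  have "\<phi> (\<Sum>k\<in>Poly_Mapping.keys f. sT (Poly_Mapping.lookup f k) (?\<tau> k)) = \<phi> t"
    using \<phi>sum f by (simp add: sum_scaled_singles)
  then have "t = (\<Sum>k\<in>Poly_Mapping.keys f. sT (Poly_Mapping.lookup f k) (?\<tau> k))"
    using injD[OF inj_\<phi>] by metis
  then show ?thesis using Qsum by simp
qed

lemma linear_eq:
  assumes "\<And>x y. L (x + y) = L x + L y" "\<And>x y. M (x + y) = M x + M y" "\<And>a p. L (\<tau> a p) = M (\<tau> a p)"
  shows "L t = M t"
  by (induction t rule: tensor_induct) (simp_all add: assms)

text \<open>The linear extension of \<open>B\<close> to the free space kills the bilinearity
  relations, hence their span. Its value at a representative of the coset \<open>\<phi> t\<close>
  therefore does not depend on the representative.\<close>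

lemma universal:
  assumes B: "bilinear_map sA sP sW B"
  shows "\<exists>L. Vector_Spaces.linear sT sW L \<and> (\<forall>a p. L (\<tau> a p) = B a p)"
proof -
  interpret W: vector_space sW using bilinear_map_vector_space(3)[OF B] .
  let ?E = "linear_ext sW (\<lambda>k. B (fst k) (snd k))"
  have E: "Vector_Spaces.linear free_scale sW ?E" by (rule linear_linear_ext[OF W.vector_space_axioms])
  note B' = bilinear_map_simps[OF B]
  have ER: "?E r = 0" if "r \<in> R" for r
  proof (rule linear_span_zero[OF E _ that])
    fix x assume "x \<in> tensor_relations sA sP"
    then show "?E x = 0"
      unfolding tensor_relations_def Let_def
      by (auto simp: linear_simps[OF E] linear_ext_single[OF W.vector_space_axioms] B')
  qed
  define L where "L t = ?E (SOME f. \<phi> t = R +>\<^bsub>F\<^esub> f)" for t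
  have L: "L t = ?E f" if "\<phi> t = R +>\<^bsub>F\<^esub> f" for t f
  proof -
    have "\<phi> t = R +>\<^bsub>F\<^esub> (SOME f. \<phi> t = R +>\<^bsub>F\<^esub> f)" using that by (rule someI)
    then have "(SOME f. \<phi> t = R +>\<^bsub>F\<^esub> f) - f \<in> R" using that coset_eq_iff by metis
    then have "?E ((SOME f. \<phi> t = R +>\<^bsub>F\<^esub> f) - f) = 0" by (rule ER)
    then show ?thesis by (simp add: L_def linear_simps[OF E])
  qed
  have "Vector_Spaces.linear sT sW L"
  proof (rule linearI[OF T.vector_space_axioms W.vector_space_axioms])
    fix x y c
    obtain f where f: "\<phi> x = R +>\<^bsub>F\<^esub> f" by (rule \<phi>_cases)
    obtain g where g: "\<phi> y = R +>\<^bsub>F\<^esub> g" by (rule \<phi>_cases)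
    have "\<phi> (x + y) = R +>\<^bsub>F\<^esub> (f + g)" using f g by (simp add: \<phi>_add Q.add_quotient)
    then show "L (x + y) = L x + L y" using L f g by (simp add: linear_simps[OF E])
    have "\<phi> (sT c x) = R +>\<^bsub>F\<^esub> (free_scale c f)" using f by (simp add: \<phi>_scale Q.smult_quotient)
    then show "L (sT c x) = sW c (L x)" using L f by (simp add: linear_simps[OF E])
  qed
  moreover have "L (\<tau> a p) = B a p" for a p using L[OF \<phi>_tau] by (simp add: linear_ext_single[OF W.vector_space_axioms])
  ultimately show ?thesis by blast
qed

text \<open>The definite description is meaningful: existence is \<open>universal\<close>,
  uniqueness holds because pure tensors generate.\<close>

lemma tensor_lift:
  assumes B: "bilinear_map sA sP sW B"
  shows "Vector_Spaces.linear sT sW (tensor_lift sT \<tau> sW B)" "tensor_lift sT \<tau> sW B (\<tau> a p) = B a p"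
proof -
  have "\<exists>!L. Vector_Spaces.linear sT sW L \<and> (\<forall>a p. L (\<tau> a p) = B a p)"
  proof (rule ex_ex1I[OF universal[OF B]])
    fix L M assume "Vector_Spaces.linear sT sW L \<and> (\<forall>a p. L (\<tau> a p) = B a p)"
      "Vector_Spaces.linear sT sW M \<and> (\<forall>a p. M (\<tau> a p) = B a p)"
    then show "L = M" using linear_simps(1)[of sT sW L] linear_simps(1)[of sT sW M] by - (rule ext, rule linear_eq[of L M], simp_all)
  qed
  note L = theI'[OF this, folded tensor_lift_def]
  show "Vector_Spaces.linear sT sW (tensor_lift sT \<tau> sW B)" using L by (rule conjunct1)
  show "tensor_lift sT \<tau> sW B (\<tau> a p) = B a p" using L[THEN conjunct2] by simp
qed

text \<open>Serves nested lifts, where the outer arguments are parameters of an inner one. On pure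
  tensors the lift is \<open>B\<close> itself, and the rest follows by tensor induction.\<close>

lemma linear_tensor_lift_parameter:
  assumes B: "\<And>x. bilinear_map sA sP sW (B x)" and lin: "\<And>a p. Vector_Spaces.linear s0 sW (\<lambda>x. B x a p)"
  shows "Vector_Spaces.linear s0 sW (\<lambda>x. tensor_lift sT \<tau> sW (B x) t)"
proof (induction t rule: tensor_induct)
  case (pure a p)
  then show ?case using lin by (simp add: tensor_lift(2)[OF B])
next
  case (add t u)
  then show ?case by (simp add: linear_simps[OF tensor_lift(1)[OF B]] linear_add)
qed

text \<open>The diagonal at a sum contains the cross terms \<open>D t u + D u t\<close>.
  Antisymmetry, extended from pure tensors in one argument and then in the other, cancels
  them.\<close>

lemma alternating_on_pure:
  assumes "\<And>t. Vector_Spaces.linear sT sW (D t)" "\<And>t. Vector_Spaces.linear sT sW (\<lambda>u. D u t)"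
    and "\<And>a p. D (\<tau> a p) (\<tau> a p) = 0"
    and "\<And>a p b q. D (\<tau> a p) (\<tau> b q) = - D (\<tau> b q) (\<tau> a p)"
  shows "D t t = 0"
proof -
  note D = linear_simps[OF assms(1)] linear_simps[OF assms(2)]
  have "D (\<tau> a p) u = - D u (\<tau> a p)" for a p u
    by (induction u rule: tensor_induct) (simp_all add: assms(4)[of a] D)
  then have anti: "D t u = - D u t" for t u
    by (induction t rule: tensor_induct) (simp_all add: D)
  show ?thesis
  proof (induction t rule: tensor_induct)
    case (add t u)
    then show ?case using anti[of t u] by (simp add: D)
  qed (simp add: assms)
qed

text \<open>The condition under which a formula in the factors of pure tensors, given as two
  parallel lists, extends to a multilinear map on the tensor product: bilinearity in each pair of
  factors.\<close>

fun pure_multilinear :: "('k \<Rightarrow> 'w::ab_group_add \<Rightarrow> 'w) \<Rightarrow> nat \<Rightarrow> ('a list \<Rightarrow> 'p list \<Rightarrow> 'w) \<Rightarrow> bool" where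
  "pure_multilinear sW 0 B \<longleftrightarrow> True"
| "pure_multilinear sW (Suc n) B \<longleftrightarrow>
    (\<forall>as ps. length as = n \<longrightarrow> length ps = n \<longrightarrow> bilinear_map sA sP sW (\<lambda>a p. B (a # as) (p # ps))) \<and>
    (\<forall>a p. pure_multilinear sW n (\<lambda>as ps. B (a # as) (p # ps)))"

primrec mlift :: "('k \<Rightarrow> 'w::ab_group_add \<Rightarrow> 'w) \<Rightarrow> 't list \<Rightarrow> ('a list \<Rightarrow> 'p list \<Rightarrow> 'w) \<Rightarrow> 'w" where
  "mlift sW [] B = B [] []"
| "mlift sW (u # us) B = tensor_lift sT \<tau> sW (\<lambda>a p. mlift sW us (\<lambda>as ps. B (a # as) (p # ps))) u"

lemma mlift_cong:
  "(\<And>as ps. length as = length us \<Longrightarrow> length ps = length us \<Longrightarrow> B as ps = C as ps) \<Longrightarrow>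
    mlift sW us B = mlift sW us C"
proof (induction us arbitrary: B C)
  case (Cons u us)
  have "mlift sW us (\<lambda>as ps. B (a # as) (p # ps)) = mlift sW us (\<lambda>as ps. C (a # as) (p # ps))" for a p
    by (rule Cons.IH) (simp add: Cons.prems)
  then show ?case by simp
qed simp

lemma bilinear_add:
  "bilinear_map sA sP sW B \<Longrightarrow> bilinear_map sA sP sW C \<Longrightarrow> bilinear_map sA sP sW (\<lambda>a p. B a p + C a p)"
  by (simp add: bilinear_map_def linear_add)

lemma bilinear_scale: "bilinear_map sA sP sW B \<Longrightarrow> bilinear_map sA sP sW (\<lambda>a p. sW c (B a p))"
  by (auto simp: bilinear_map_def intro: linear_scale)

lemma tensor_lift_add:
  assumes "bilinear_map sA sP sW B" "bilinear_map sA sP sW C"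
  shows "tensor_lift sT \<tau> sW (\<lambda>a p. B a p + C a p) t = tensor_lift sT \<tau> sW B t + tensor_lift sT \<tau> sW C t"
  by (rule linear_eq)
    (simp_all add: linear_simps[OF tensor_lift(1)] tensor_lift(2) assms bilinear_add)

lemma tensor_lift_scale:
  assumes "bilinear_map sA sP sW B"
  shows "tensor_lift sT \<tau> sW (\<lambda>a p. sW c (B a p)) t = sW c (tensor_lift sT \<tau> sW B t)"
proof -
  interpret W: vector_space sW using bilinear_map_vector_space(3)[OF assms] .
  show ?thesis
    by (rule linear_eq)
      (simp_all add: linear_simps[OF tensor_lift(1)] tensor_lift(2) assms bilinear_scale W.scale_right_distrib)
qed

text \<open>Lifting the head requires the lifted tail to be bilinear in the factors of the head,
  hence linearity of the tail lift in \<open>B\<close>. That linearity is proved by an induction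
  that uses the present fact, so it is a premise here, for \<open>us\<close> alone.\<close>

lemma bilinear_mlift_if_additive:
  assumes "pure_multilinear sW (Suc (length us)) B"
    and "\<And>B C. pure_multilinear sW (length us) B \<Longrightarrow> pure_multilinear sW (length us) C \<Longrightarrow>
      mlift sW us (\<lambda>as ps. B as ps + C as ps) = mlift sW us B + mlift sW us C"
    and "\<And>B c. pure_multilinear sW (length us) B \<Longrightarrow>
      mlift sW us (\<lambda>as ps. sW c (B as ps)) = sW c (mlift sW us B)"
  shows "bilinear_map sA sP sW (\<lambda>a p. mlift sW us (\<lambda>as ps. B (a # as) (p # ps)))"
proof -
  have B: "bilinear_map sA sP sW (\<lambda>a p. B (a # as) (p # ps))"
    if "length as = length us" "length ps = length us" for as ps using assms(1) that by simp
  have pm: "pure_multilinear sW (length us) (\<lambda>as ps. B (a # as) (p # ps))" for a p using assms(1) by simp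
  have W: "vector_space sW"
    using bilinear_map_vector_space(3)[OF B[of "replicate (length us) 0" "replicate (length us) 0"]] by simp
  note B' = bilinear_map_simps[OF B] and add = assms(2)[OF pm pm, symmetric] and scale = assms(3)[OF pm, symmetric]
  show ?thesis
    unfolding bilinear_map_def
  proof (intro conjI allI linearI A.vector_space_axioms P.vector_space_axioms W)
    fix a a' p p' c
    show "mlift sW us (\<lambda>as ps. B (a # as) ((p + p') # ps)) =
        mlift sW us (\<lambda>as ps. B (a # as) (p # ps)) + mlift sW us (\<lambda>as ps. B (a # as) (p' # ps))"
      unfolding add by (rule mlift_cong) (simp add: B')
    show "mlift sW us (\<lambda>as ps. B ((a + a') # as) (p # ps)) =
        mlift sW us (\<lambda>as ps. B (a # as) (p # ps)) + mlift sW us (\<lambda>as ps. B (a' # as) (p # ps))"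
      unfolding add by (rule mlift_cong) (simp add: B')
    show "mlift sW us (\<lambda>as ps. B (a # as) (sP c p # ps)) = sW c (mlift sW us (\<lambda>as ps. B (a # as) (p # ps)))"
      unfolding scale by (rule mlift_cong) (simp add: B')
    show "mlift sW us (\<lambda>as ps. B (sA c a # as) (p # ps)) = sW c (mlift sW us (\<lambda>as ps. B (a # as) (p # ps)))"
      unfolding scale by (rule mlift_cong) (simp add: B')
  qed
qed

text \<open>Additivity and homogeneity go through one induction, because bilinearity in the head
  needs both for the tail.\<close>

lemma mlift_add_scale:
  "(\<forall>B C. pure_multilinear sW (length us) B \<longrightarrow> pure_multilinear sW (length us) C \<longrightarrow>
      mlift sW us (\<lambda>as ps. B as ps + C as ps) = mlift sW us B + mlift sW us C) \<and>
   (\<forall>B c. pure_multilinear sW (length us) B \<longrightarrow>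
      mlift sW us (\<lambda>as ps. sW c (B as ps)) = sW c (mlift sW us B))"
proof (induction us)
  case (Cons u us)
  then have IH: "\<And>B C. pure_multilinear sW (length us) B \<Longrightarrow> pure_multilinear sW (length us) C \<Longrightarrow>
      mlift sW us (\<lambda>as ps. B as ps + C as ps) = mlift sW us B + mlift sW us C"
    "\<And>B c. pure_multilinear sW (length us) B \<Longrightarrow>
      mlift sW us (\<lambda>as ps. sW c (B as ps)) = sW c (mlift sW us B)" by blast+
  show ?case
  proof (intro conjI allI impI)
    fix B C c assume B: "pure_multilinear sW (length (u # us)) B"
    then have bB: "bilinear_map sA sP sW (\<lambda>a p. mlift sW us (\<lambda>as ps. B (a # as) (p # ps)))"
      by (intro bilinear_mlift_if_additive IH) auto
    show "mlift sW (u # us) (\<lambda>as ps. sW c (B as ps)) = sW c (mlift sW (u # us) B)"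
      using B by (simp add: IH(2) tensor_lift_scale[OF bB])
    assume C: "pure_multilinear sW (length (u # us)) C"
    then have bC: "bilinear_map sA sP sW (\<lambda>a p. mlift sW us (\<lambda>as ps. C (a # as) (p # ps)))"
      by (intro bilinear_mlift_if_additive IH) auto
    show "mlift sW (u # us) (\<lambda>as ps. B as ps + C as ps) = mlift sW (u # us) B + mlift sW (u # us) C"
      using B C by (simp add: IH(1) tensor_lift_add[OF bB bC])
  qed
qed simp

lemma mlift_scale:
  "pure_multilinear sW (length us) B \<Longrightarrow> mlift sW us (\<lambda>as ps. sW c (B as ps)) = sW c (mlift sW us B)"
  using mlift_add_scale by blast

lemma bilinear_mlift:
  assumes "pure_multilinear sW (Suc (length us)) B"
  shows "bilinear_map sA sP sW (\<lambda>a p. mlift sW us (\<lambda>as ps. B (a # as) (p # ps)))"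
  by (rule bilinear_mlift_if_additive[OF assms]) (use mlift_add_scale in blast)+

lemma mlift_Cons_pure:
  assumes "pure_multilinear sW (Suc (length us)) B"
  shows "mlift sW (\<tau> a p # us) B = mlift sW us (\<lambda>as ps. B (a # as) (p # ps))"
  using tensor_lift(2)[OF bilinear_mlift[OF assms]] by simp

lemma multilinear_mlift: "pure_multilinear sW n B \<Longrightarrow> multilinear sT sW n (\<lambda>us. mlift sW us B)"
proof (induction n arbitrary: B)
  case (Suc n)
  have head: "Vector_Spaces.linear sT sW (\<lambda>u. mlift sW (u # us) B)" if "length us = n" for us
  proof -
    have "pure_multilinear sW (Suc (length us)) B" using Suc.prems that by simp
    from tensor_lift(1)[OF bilinear_mlift[OF this]] show ?thesis by simp
  qed
  have tail: "multilinear sT sW n (\<lambda>us. mlift sW (u # us) B)" for u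
    unfolding multilinear_def mlift.simps
  proof (intro allI impI linear_tensor_lift_parameter)
    fix us :: "'t list" and i x a p assume us: "length us = n" "i < n"
    show "bilinear_map sA sP sW (\<lambda>a p. mlift sW (us[i := x]) (\<lambda>as ps. B (a # as) (p # ps)))"
      using Suc.prems us by (intro bilinear_mlift) simp
    show "Vector_Spaces.linear sT sW (\<lambda>x. mlift sW (us[i := x]) (\<lambda>as ps. B (a # as) (p # ps)))"
      using Suc.IH[of "\<lambda>as ps. B (a # as) (p # ps)"] Suc.prems us by (simp add: multilinear_def)
  qed
  show ?case using head tail by (simp add: multilinear_Suc del: mlift.simps)
qed simp

lemma mlift_pure:
  "pure_multilinear sW n B \<Longrightarrow> length as = n \<Longrightarrow> length ps = n \<Longrightarrow> mlift sW (map2 \<tau> as ps) B = B as ps"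
proof (induction n arbitrary: B as ps)
  case (Suc n)
  then obtain a as' p ps' where l: "as = a # as'" "ps = p # ps'" "length as' = n" "length ps' = n"
    by (auto simp: length_Suc_conv)
  have "mlift sW (\<tau> a p # map2 \<tau> as' ps') B = mlift sW (map2 \<tau> as' ps') (\<lambda>as ps. B (a # as) (p # ps))"
    using Suc.prems l by (intro mlift_Cons_pure) simp
  also have "\<dots> = B (a # as') (p # ps')"
    using Suc.IH[of "\<lambda>as ps. B (a # as) (p # ps)" as' ps'] Suc.prems(1) l by simp
  finally show ?case by (simp add: l)
qed simp

lemma multilinear_eq:
  "multilinear sT sW n f \<Longrightarrow> multilinear sT sW n g \<Longrightarrow>
    (\<And>as ps. length as = n \<Longrightarrow> length ps = n \<Longrightarrow> f (map2 \<tau> as ps) = g (map2 \<tau> as ps)) \<Longrightarrow>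
    length us = n \<Longrightarrow> f us = g us"
proof (induction n arbitrary: f g us)
  case 0
  then show ?case using "0.prems"(3)[of "[]" "[]"] by simp
next
  case (Suc n)
  then obtain u vs where us: "us = u # vs" "length vs = n" by (auto simp: length_Suc_conv)
  have "f (t # vs) = g (t # vs)" for t
  proof (induction t rule: tensor_induct)
    case (pure a p)
    show ?case
    proof (rule Suc.IH[of "\<lambda>vs. f (\<tau> a p # vs)" "\<lambda>vs. g (\<tau> a p # vs)"])
      fix as ps assume "length (as :: 'a list) = n" "length (ps :: 'p list) = n"
      then show "f (\<tau> a p # map2 \<tau> as ps) = g (\<tau> a p # map2 \<tau> as ps)"
        using Suc.prems(3)[of "a # as" "p # ps"] by simp
    qed (use Suc.prems us in \<open>auto simp: multilinear_Suc\<close>)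
  next
    case (add t u)
    have "Vector_Spaces.linear sT sW (\<lambda>x. f (x # vs))" "Vector_Spaces.linear sT sW (\<lambda>x. g (x # vs))"
      using Suc.prems us by (auto simp: multilinear_Suc)
    then show ?case using add linear_simps(1)[of sT sW "\<lambda>x. f (x # vs)"] linear_simps(1)[of sT sW "\<lambda>x. g (x # vs)"]
      by simp
  qed
  then show ?case using us by simp
qed

end

section \<open>The Lie algebra of a Perm algebra and a pre-Lie algebra\<close>

context alternating_cochains begin

text \<open>Antisymmetrization over the choice of one distinguished argument, that is, over the (1,
  n-1)-shuffles. The recursion on the list matches that of \<open>ce_d\<close>.\<close>

primrec altern :: "'v list \<Rightarrow> ('v \<Rightarrow> 'v list \<Rightarrow> 'w) \<Rightarrow> 'w" where
  "altern [] G = 0"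
| "altern (u # us) G = G u us - altern us (\<lambda>x xs. G x (u # xs))"

lemma altern_cong:
  "(\<And>x xs. Suc (length xs) = length us \<Longrightarrow> G x xs = H x xs) \<Longrightarrow> altern us G = altern us H"
proof (induction us arbitrary: G H)
  case (Cons u us)
  have "altern us (\<lambda>x xs. G x (u # xs)) = altern us (\<lambda>x xs. H x (u # xs))"
    by (rule Cons.IH) (simp add: Cons.prems)
  then show ?case by (simp add: Cons.prems)
qed simp

lemma altern_zero: "(\<And>x xs. Suc (length xs) = length us \<Longrightarrow> G x xs = 0) \<Longrightarrow> altern us G = 0"
  by (induction us arbitrary: G) auto

lemma altern_sum: "altern us G = (\<Sum>i<length us. sW ((-1) ^ i) (G (us ! i) (del_nth i us)))"
proof (induction us arbitrary: G)
  case (Cons u us)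
  show ?case
    by (simp add: Cons.IH sum.lessThan_Suc_shift sum_negf del: sum.lessThan_Suc)
qed simp

lemma cochain_altern:
  "(\<And>xs. length xs = n \<Longrightarrow> Vector_Spaces.linear sV sW (\<lambda>x. G x xs)) \<Longrightarrow> (\<And>x. cochain n (G x)) \<Longrightarrow>
    cochain (Suc n) (\<lambda>us. altern us G)"
proof (induction n arbitrary: G)
  case 0
  then show ?case by (simp add: cochain_Suc)
next
  case (Suc n)
  have lin: "Vector_Spaces.linear sV sW (\<lambda>u. altern (u # us) G)" if us: "length us = Suc n" for us
  proof -
    have "Vector_Spaces.linear sV sW (\<lambda>u. G (us ! i) (u # del_nth i us))" if "i < length us" for i
      using cochain_linear[OF Suc.prems(2)] us that by simp
    then show ?thesis
      unfolding altern.simps unfolding altern_sum using us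
      by (intro linear_minus Suc.prems(1) linear_sum linear_scale V.vector_space_axioms W.vector_space_axioms) auto
  qed
  have coch: "cochain (Suc n) (\<lambda>us. altern (u # us) G)" for u
    unfolding altern.simps
  proof (intro cochain_diff Suc.prems(2) Suc.IH)
    show "Vector_Spaces.linear sV sW (\<lambda>x. G x (u # xs))" if "length xs = n" for xs
      using Suc.prems(1) that by simp
    show "cochain n (\<lambda>xs. G x (u # xs))" for x using cochain_Cons[OF Suc.prems(2)] .
  qed
  \<comment> \<open>The summands that distinguish the first or the second \<open>u\<close> are equal
    with opposite signs; all others contain \<open>u\<close> twice among the alternating
    arguments.\<close>
  have rep: "altern (u # u # us) G = 0" if us: "length us = n" for u us
  proof -
    have "altern us (\<lambda>x xs. G x (u # u # xs)) = 0"
    proof (rule altern_zero)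
      fix x and xs :: "'v list" assume "Suc (length xs) = length us"
      then have "n = Suc (length xs)" using us by simp
      then show "G x (u # u # xs) = 0" using Suc.prems(2)[of x] by (simp add: cochain_repeat)
    qed
    then show ?thesis by simp
  qed
  show ?case using lin coch rep by (simp add: cochain_Suc[of "Suc n"])
qed

end

text \<open>The common pattern of \<open>tensor_bracket\<close> and \<open>tensor_action\<close>:
  two nested lifts of a map that is bilinear in each pair of factors.\<close>

lemma bilinear_tensor_lift2:
  assumes "tensor sA sP sT \<tau>" "tensor sB sQ sU \<upsilon>"
    and B1: "\<And>a p. bilinear_map sB sQ sW (B a p)"
    and B2: "\<And>b q. bilinear_map sA sP sW (\<lambda>a p. B a p b q)"
  shows "bilinear_map sT sU sW (\<lambda>u v. tensor_lift sT \<tau> sW (\<lambda>a p. tensor_lift sU \<upsilon> sW (B a p) v) u)"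
    and "tensor_lift sT \<tau> sW (\<lambda>a p. tensor_lift sU \<upsilon> sW (B a p) (\<upsilon> b q)) (\<tau> a p) = B a p b q"
proof -
  interpret T: tensor sA sP sT \<tau> by fact
  interpret U: tensor sB sQ sU \<upsilon> by fact
  have bil: "bilinear_map sA sP sW (\<lambda>a p. tensor_lift sU \<upsilon> sW (B a p) v)" for v
    unfolding bilinear_map_def
    using bilinear_map_linear[OF B2] by (auto intro!: U.linear_tensor_lift_parameter B1)
  show "bilinear_map sT sU sW (\<lambda>u v. tensor_lift sT \<tau> sW (\<lambda>a p. tensor_lift sU \<upsilon> sW (B a p) v) u)"
    unfolding bilinear_map_def
    by (auto intro!: T.linear_tensor_lift_parameter T.tensor_lift(1) bil U.tensor_lift(1) B1)
  show "tensor_lift sT \<tau> sW (\<lambda>a p. tensor_lift sU \<upsilon> sW (B a p) (\<upsilon> b q)) (\<tau> a p) = B a p b q"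
    by (simp add: T.tensor_lift(2)[OF B2] U.tensor_lift(2)[OF B1])
qed

lemma bilinear_minus:
  "bilinear_map s1 s2 s3 B \<Longrightarrow> bilinear_map s1 s2 s3 C \<Longrightarrow> bilinear_map s1 s2 s3 (\<lambda>a p. B a p - C a p)"
  by (simp add: bilinear_map_def linear_minus)

lemma bilinear_comp:
  assumes "bilinear_map s1 s2 s3 B" "Vector_Spaces.linear t1 s1 f" "Vector_Spaces.linear t2 s2 g"
  shows "bilinear_map t1 t2 s3 (\<lambda>a p. B (f a) (g p))"
  using assms unfolding bilinear_map_def by (auto intro: linear_comp)

text \<open>The Perm identities are stated as rewrite rules: \<open>mA_assoc\<close> brackets to the
  left, and \<open>mA_perm\<close> exchanges two factors after the first.\<close>

locale perm_pre_lie = pre_lie_module sP mP sN lN rN +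
  T: tensor sA sP sT \<tau> + S: tensor sA sN sS \<sigma>
  for sP :: "'k::field \<Rightarrow> 'p::ab_group_add \<Rightarrow> 'p" and mP
    and sN :: "'k \<Rightarrow> 'n::ab_group_add \<Rightarrow> 'n" and lN rN
    and sA :: "'k \<Rightarrow> 'a::ab_group_add \<Rightarrow> 'a"
    and sT :: "'k \<Rightarrow> 't::ab_group_add \<Rightarrow> 't" and \<tau>
    and sS :: "'k \<Rightarrow> 's::ab_group_add \<Rightarrow> 's" and \<sigma> +
  fixes mA :: "'a \<Rightarrow> 'a \<Rightarrow> 'a"
  assumes bilinear_mA: "bilinear_map sA sA sA mA"
    and mA_assoc: "mA a (mA b c) = mA (mA a b) c"
    and mA_perm: "mA (mA a b) c = mA (mA a c) b"
begin

lemmas mA_linear = bilinear_map_linear[OF bilinear_mA]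

definition br :: "'t \<Rightarrow> 't \<Rightarrow> 't" where
  "br = tensor_bracket mA mP sT \<tau>"

definition act :: "'t \<Rightarrow> 's \<Rightarrow> 's" where
  "act = tensor_action mA lN rN sT \<tau> sS \<sigma>"

lemma bilinear_br: "bilinear_map sT sT sT br"
  and br_pure: "br (\<tau> a p) (\<tau> b q) = \<tau> (mA a b) (mP p q) - \<tau> (mA b a) (mP q p)"
proof -
  have 1: "bilinear_map sA sP sT (\<lambda>b q. \<tau> (mA a b) (mP p q) - \<tau> (mA b a) (mP q p))" for a p
    by (intro bilinear_minus bilinear_comp[OF T.bilinear_tau] mA_linear mP_linear)
  have 2: "bilinear_map sA sP sT (\<lambda>a p. \<tau> (mA a b) (mP p q) - \<tau> (mA b a) (mP q p))" for b q
    by (intro bilinear_minus bilinear_comp[OF T.bilinear_tau] mA_linear mP_linear)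
  note lift = bilinear_tensor_lift2[OF T.tensor_axioms T.tensor_axioms 1 2]
  show "bilinear_map sT sT sT br" using lift(1) unfolding br_def tensor_bracket_def .
  show "br (\<tau> a p) (\<tau> b q) = \<tau> (mA a b) (mP p q) - \<tau> (mA b a) (mP q p)"
    using lift(2) unfolding br_def tensor_bracket_def .
qed

lemma bilinear_act: "bilinear_map sT sS sS act"
  and act_pure: "act (\<tau> a p) (\<sigma> b n) = \<sigma> (mA a b) (lN p n) - \<sigma> (mA b a) (rN n p)"
proof -
  have 1: "bilinear_map sA sN sS (\<lambda>b n. \<sigma> (mA a b) (lN p n) - \<sigma> (mA b a) (rN n p))" for a p
    by (intro bilinear_minus bilinear_comp[OF S.bilinear_tau] mA_linear lN_linear rN_linear)
  have 2: "bilinear_map sA sP sS (\<lambda>a p. \<sigma> (mA a b) (lN p n) - \<sigma> (mA b a) (rN n p))" for b n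
    by (intro bilinear_minus bilinear_comp[OF S.bilinear_tau] mA_linear lN_linear rN_linear)
  note lift = bilinear_tensor_lift2[OF T.tensor_axioms S.tensor_axioms 1 2]
  show "bilinear_map sT sS sS act" using lift(1) unfolding act_def tensor_action_def .
  show "act (\<tau> a p) (\<sigma> b n) = \<sigma> (mA a b) (lN p n) - \<sigma> (mA b a) (rN n p)"
    using lift(2) unfolding act_def tensor_action_def .
qed

lemmas br_simps = bilinear_map_simps[OF bilinear_br]
lemmas act_simps = bilinear_map_simps[OF bilinear_act]

lemma br_same: "br x x = 0"
  by (rule T.alternating_on_pure[of sT br]) (simp_all add: bilinear_map_linear[OF bilinear_br] br_pure)

text \<open>At pure tensors a triple product in \<open>A\<close> depends only on its first factor.
  The Jacobi defect thus has three parts, and the second tensor factor of each is a right-symmetry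
  defect of \<open>P\<close>.\<close>

lemma br_jacobi: "br x (br y z) = br (br x y) z + br y (br x z)"
proof (induction x rule: T.tensor_induct)
  case (pure a p)
  show ?case
  proof (induction y rule: T.tensor_induct)
    case (pure b q)
    show ?case
    proof (induction z rule: T.tensor_induct)
      case (pure c r)
      have "br (\<tau> a p) (br (\<tau> b q) (\<tau> c r)) - (br (br (\<tau> a p) (\<tau> b q)) (\<tau> c r) + br (\<tau> b q) (br (\<tau> a p) (\<tau> c r))) =
          \<tau> (mA (mA b a) c) (mP (mP q p) r - mP q (mP p r) - (mP (mP q r) p - mP q (mP r p)))
          - \<tau> (mA (mA a b) c) (mP (mP p q) r - mP p (mP q r) - (mP (mP p r) q - mP p (mP r q)))
          - \<tau> (mA (mA c a) b) (mP (mP r p) q - mP r (mP p q) - (mP (mP r q) p - mP r (mP q p)))"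
        by (simp add: br_pure br_simps T.tau_simps mA_assoc mA_perm[of a c b] mA_perm[of b c a] mA_perm[of c b a])
      then show ?case
        using right_symmetric[of q p r] right_symmetric[of p q r] right_symmetric[of r p q]
        by (simp add: T.tau_simps)
    qed (simp add: br_simps algebra_simps)
  qed (simp add: br_simps algebra_simps)
qed (simp add: br_simps algebra_simps)

text \<open>Again sorted by the first factor: the parts that begin with \<open>a\<close> or
  \<open>b\<close> vanish by the left bimodule axiom, the part that begins with \<open>c\<close> by
  the right one.\<close>

lemma act_bracket: "act (br x y) m = act x (act y m) - act y (act x m)"
proof (induction x rule: T.tensor_induct)
  case (pure a p)
  show ?case
  proof (induction y rule: T.tensor_induct)
    case (pure b q)
    show ?case
    proof (induction m rule: S.tensor_induct)
      case (pure c n)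
      have "act (br (\<tau> a p) (\<tau> b q)) (\<sigma> c n) - (act (\<tau> a p) (act (\<tau> b q) (\<sigma> c n)) - act (\<tau> b q) (act (\<tau> a p) (\<sigma> c n))) =
          \<sigma> (mA (mA a b) c) (lN (mP p q) n - lN p (lN q n) - (rN (lN p n) q - lN p (rN n q)))
          - \<sigma> (mA (mA b a) c) (lN (mP q p) n - lN q (lN p n) - (rN (lN q n) p - lN q (rN n p)))
          + \<sigma> (mA (mA c a) b) (rN (rN n p) q - rN n (mP p q) - (rN (rN n q) p - rN n (mP q p)))"
        by (simp add: br_pure act_pure act_simps S.tau_simps mA_assoc mA_perm[of a c b] mA_perm[of b c a] mA_perm[of c b a])
      then show ?case
        using bimodule_left[of p q n] bimodule_left[of q p n] bimodule_right[of n p q]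
        by (simp add: S.tau_simps)
    qed (simp add: act_simps algebra_simps)
  qed (simp add: br_simps act_simps algebra_simps)
qed (simp add: br_simps act_simps algebra_simps)

sublocale L: lie_module sT sS UNIV br act
  by (intro lie_module.intro alternating_cochains.intro alternating_cochains_axioms.intro lie_module_axioms.intro
      T.T.vector_space_axioms S.T.vector_space_axioms bilinear_br br_same br_jacobi act_bracket)
    (auto simp: act_simps S.T.subspace_def intro: bilinear_map_linear[OF bilinear_act])

lemma linear_foldl: "Vector_Spaces.linear sA sA (\<lambda>a. foldl mA a as)"
proof (induction as)
  case Nil
  show ?case by (simp add: linearI T.A.vector_space_axioms)
next
  case (Cons b as)
  then show ?case using linear_comp[OF mA_linear(2) Cons] by simp
qed

lemma foldl_mA_right: "foldl mA (mA a b) as = mA (foldl mA a as) b"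
proof (induction as arbitrary: a)
  case (Cons c as)
  have "foldl mA (mA (mA a b) c) as = foldl mA (mA (mA a c) b) as" by (simp add: mA_perm[of a b c])
  then show ?case using Cons.IH by simp
qed simp

lemma mA_foldl: "mA a (foldl mA b as) = foldl mA (mA a b) as"
  by (induction as arbitrary: b) (simp_all add: mA_assoc)

lemma pure_multilinear_product:
  "multilinear sP sN n g \<Longrightarrow> T.pure_multilinear sS n (\<lambda>as ps. \<sigma> (foldl mA a as) (g ps))"
proof (induction n arbitrary: a g)
  case (Suc n)
  have "bilinear_map sA sP sS (\<lambda>b p. \<sigma> (foldl mA (mA a b) as) (g (p # ps)))" if "length ps = n" for as ps
    using Suc.prems that
    by (intro bilinear_comp[OF S.bilinear_tau] linear_comp[OF mA_linear(1) linear_foldl]) (simp add: multilinear_Suc)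
  moreover have "T.pure_multilinear sS n (\<lambda>as ps. \<sigma> (foldl mA (mA a b) as) (g (p # ps)))" for b p
    using Suc.prems by (intro Suc.IH) (simp add: multilinear_Suc)
  ultimately show ?case by simp
qed simp

text \<open>A pre-Lie cochain \<open>f\<close> enters through \<open>c ps p = f (p # ps)\<close>, and \<open>G c\<close> is the multilinear extension of
  the summand of index \<open>0\<close> of \<open>\<Psi> f\<close>.\<close>

definition H :: "('p list \<Rightarrow> 'n) \<Rightarrow> 'a \<Rightarrow> 't list \<Rightarrow> 's" where
  "H g a us = T.mlift sS us (\<lambda>as ps. \<sigma> (foldl mA a as) (g ps))"

definition G :: "('p list \<Rightarrow> 'p \<Rightarrow> 'n) \<Rightarrow> 't \<Rightarrow> 't list \<Rightarrow> 's" where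
  "G c u us = tensor_lift sT \<tau> sS (\<lambda>a p. H (\<lambda>ps. c ps p) a us) u"

text \<open>With \<open>a\<close> fixed as first factor, the factors of all the arguments may be
  permuted in the product. Alternation of \<open>g\<close> is therefore enough;
  \<open>alternating_on_pure\<close> carries it from pure tensors to all elements.\<close>

lemma H_cochain:
  "multilinear sP sN n g \<Longrightarrow> alternating_from 0 n g \<Longrightarrow> L.cochain n (H g a)"
proof (induction n arbitrary: a g)
  case (Suc n)
  interpret P: alternating_cochains sP sN UNIV
    by unfold_locales (simp add: N.subspace_def)
  have g: "P.cochain (Suc n) g" using Suc.prems by (simp add: P.cochain_def)
  have pm: "T.pure_multilinear sS (Suc n) (\<lambda>as ps. \<sigma> (foldl mA a as) (g ps))"
    using Suc.prems(1) by (rule pure_multilinear_product[of "Suc n"])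
  have ml: "multilinear sT sS (Suc n) (H g a)"
    unfolding H_def using T.multilinear_mlift[OF pm] .
  have H_pure: "H g a (\<tau> b p # us) = H (\<lambda>ps. g (p # ps)) (mA a b) us" if "length us = n" for b p us
    unfolding H_def
    using T.mlift_Cons_pure[of sS us "\<lambda>as ps. \<sigma> (foldl mA a as) (g ps)" b p] pm that
    by (simp del: T.pure_multilinear.simps T.mlift.simps)
  have lin: "Vector_Spaces.linear sT sS (\<lambda>u. H g a (u # us))" if "length us = n" for us
    using ml that by (simp add: multilinear_Suc)
  have coch: "L.cochain n (\<lambda>us. H g a (u # us))" for u
  proof (induction u rule: T.tensor_induct)
    case (pure b p)
    have "L.cochain n (H (\<lambda>ps. g (p # ps)) (mA a b))"
      using P.cochain_Cons[OF g, of p] by (intro Suc.IH) (simp_all add: P.cochain_def)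
    then show ?case by (rule L.cochain_cong) (simp add: H_pure)
  next
    case (add t u)
    show ?case
      using L.cochain_cong[OF L.cochain_add[OF add]] linear_simps(1)[OF lin] by simp
  qed
  have rep: "H g a (u # u # us) = 0" if us: "Suc (length us) = n" for u us
  proof -
    obtain m where n: "n = Suc m" "length us = m" using us by metis
    let ?D = "\<lambda>u v. H g a (u # v # us)"
    have pure2: "?D (\<tau> b p) (\<tau> b' p') = H (\<lambda>ps. g (p # p' # ps)) (mA (mA a b) b') us" for b b' p p'
    proof -
      have "T.pure_multilinear sS (Suc m) (\<lambda>as ps. \<sigma> (foldl mA (mA a b) as) (g (p # ps)))"
        using Suc.prems(1) n by (intro pure_multilinear_product) (simp add: multilinear_Suc[of _ _ "Suc m"])
      then show ?thesis
        using H_pure[of "\<tau> b' p' # us" b p] n T.mlift_Cons_pure[of sS us "\<lambda>as ps. \<sigma> (foldl mA (mA a b) as) (g (p # ps))"]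
        by (simp add: H_def)
    qed
    show ?thesis
    proof (rule T.alternating_on_pure[of sS ?D])
      show "Vector_Spaces.linear sT sS (?D t)" for t
        using L.cochain_linear[of m "\<lambda>us. H g a (t # us)" us] coch[of t] n by simp
      show "Vector_Spaces.linear sT sS (\<lambda>u. ?D u t)" for t using lin us by simp
      have cong: "H g1 b us = H g2 b us" if "\<And>ps. length ps = m \<Longrightarrow> g1 ps = g2 ps" for g1 g2 b
        unfolding H_def using that n by (intro T.mlift_cong) simp
      have zero: "H (\<lambda>_. 0) b us = 0" for b
      proof -
        have "T.pure_multilinear sS (length us) (\<lambda>as ps. 0)"
          using pure_multilinear_product[of "length us" "\<lambda>_. 0" b] P.cochain_zero[of "length us"]
          by (simp add: P.cochain_def S.tau_simps)
        from T.mlift_scale[OF this, of 0] show ?thesis by (simp add: H_def S.tau_simps)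
      qed
      show "?D (\<tau> b p) (\<tau> b p) = 0" for b p
        unfolding pure2 zero[of "mA (mA a b) b", symmetric]
        using g n by (intro cong) (simp add: P.cochain_repeat)
      fix b p b' p'
      have "H (\<lambda>ps. g (p # p' # ps)) (mA (mA a b) b') us = H (\<lambda>ps. sN (- 1) (g (p' # p # ps))) (mA (mA a b) b') us"
        using g n P.cochain_swap[of m g _ p p'] by (intro cong) simp
      also have "\<dots> = sS (- 1) (H (\<lambda>ps. g (p' # p # ps)) (mA (mA a b) b') us)"
      proof -
        have "P.cochain m (\<lambda>ps. g (p' # p # ps))"
          using g n P.cochain_Cons[of m "\<lambda>ps. g (p' # ps)"] P.cochain_Cons[of "Suc m" g] by simp
        then have "T.pure_multilinear sS (length us) (\<lambda>as ps. \<sigma> (foldl mA (mA (mA a b) b') as) (g (p' # p # ps)))"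
          using n by (intro pure_multilinear_product) (simp add: P.cochain_def)
        then show ?thesis
          using T.mlift_scale[of sS us _ "- 1"] by (simp add: H_def S.tau_simps(4) del: N.scale_minus_left)
      qed
      finally show "?D (\<tau> b p) (\<tau> b' p') = - ?D (\<tau> b' p') (\<tau> b p)"
        by (simp add: pure2 mA_perm[of a b b'])
    qed
  qed
  show ?case using lin coch rep by (simp add: L.cochain_Suc)
qed (simp add: H_def)

end

section \<open>The map \<open>\<Psi>\<close> and the coboundaries\<close>

text \<open>For \<open>j \<noteq> i\<close>, the position that entry \<open>j\<close> takes after
  entry \<open>i\<close> has been deleted.\<close>

definition skip :: "nat \<Rightarrow> nat \<Rightarrow> nat" where
  "skip i j = (if j < i then j else j - 1)"

lemma del_nth_update_skip:
  "i \<noteq> j \<Longrightarrow> i < length xs \<Longrightarrow> j < length xs \<Longrightarrow> del_nth i (xs[j := x]) = (del_nth i xs)[skip i j := x]"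
proof (induction xs arbitrary: i j)
  case (Cons y ys)
  show ?case
  proof (cases "i = 0 \<or> j = 0")
    case True
    then show ?thesis using Cons.prems by (cases i; cases j) (auto simp: skip_def)
  next
    case False
    then obtain i' j' where "i = Suc i'" "j = Suc j'" by (metis not0_implies_Suc)
    then show ?thesis using Cons.IH[of i' j'] Cons.prems by (cases j') (auto simp: skip_def)
  qed
qed simp

lemma del_nth_update_same: "del_nth i (xs[i := x]) = del_nth i xs"
  by (simp add: del_nth_def)

lemma nth_del_nth_skip: "i \<noteq> j \<Longrightarrow> i < length xs \<Longrightarrow> j < length xs \<Longrightarrow> del_nth i xs ! skip i j = xs ! j"
proof (induction xs arbitrary: i j)
  case (Cons y ys)
  show ?case
  proof (cases "i = 0 \<or> j = 0")
    case True
    then show ?thesis using Cons.prems by (cases i; cases j) (auto simp: skip_def)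
  next
    case False
    then obtain i' j' where "i = Suc i'" "j = Suc j'" by (metis not0_implies_Suc)
    then show ?thesis using Cons.IH[of i' j'] Cons.prems by (cases j') (auto simp: skip_def)
  qed
qed simp

lemma skip_less: "i \<noteq> j \<Longrightarrow> i < n \<Longrightarrow> j < n \<Longrightarrow> skip i j < n - 1"
  by (auto simp: skip_def)

lemma sum_skip:
  assumes "i < Suc k"
  shows "(\<Sum>j\<in>{..<Suc k} - {i}. F (skip i j)) = (\<Sum>j<k. F j)"
proof (rule sum.reindex_bij_betw)
  show "bij_betw (skip i) ({..<Suc k} - {i}) {..<k}"
    using assms by (intro bij_betwI[of _ _ _ "\<lambda>j. if j < i then j else Suc j"]) (auto simp: skip_def split: if_splits)
qed

lemma del_nth_map2:
  "length as = length bs \<Longrightarrow> del_nth i (map2 f as bs) = map2 f (del_nth i as) (del_nth i bs)"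
  by (simp add: del_nth_def take_map drop_map take_zip drop_zip zip_append)

lemma map2_update:
  "length as = length bs \<Longrightarrow> (map2 f as bs)[j := f x y] = map2 f (as[j := x]) (bs[j := y])"
  by (induction as bs arbitrary: j rule: list_induct2) (auto split: nat.split)

context perm_pre_lie begin

lemma H_Cons:
  assumes "multilinear sP sN (Suc n) g" "length us = n"
  shows "H g a (\<tau> b p # us) = H (\<lambda>ps. g (p # ps)) (mA a b) us"
  unfolding H_def
  using T.mlift_Cons_pure[of sS us "\<lambda>as ps. \<sigma> (foldl mA a as) (g ps)" b p] pure_multilinear_product[OF assms(1), of a] assms(2)
  by (simp del: T.pure_multilinear.simps T.mlift.simps)

lemma H_pure:
  assumes "multilinear sP sN n g" "length as = n" "length ps = n"
  shows "H g a (map2 \<tau> as ps) = \<sigma> (foldl mA a as) (g ps)"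
  unfolding H_def by (rule T.mlift_pure[OF pure_multilinear_product]) fact+

lemma multilinear_H: "multilinear sP sN n g \<Longrightarrow> multilinear sT sS n (H g a)"
  using T.multilinear_mlift[OF pure_multilinear_product] by (simp add: H_def[abs_def])

lemma hom_cochain_slice:
  assumes "hom.cochain n c"
  shows "multilinear sP sN n (\<lambda>ps. c ps p)" "alternating_from 0 n (\<lambda>ps. c ps p)"
  using assms unfolding hom.cochain_def multilinear_def linear_hom_iff alternating_from_def
  by (auto simp: fun_eq_iff)

lemma G_bilinear:
  assumes "hom.cochain n c" "length us = n"
  shows "bilinear_map sA sP sS (\<lambda>a p. H (\<lambda>ps. c ps p) a us)"
proof -
  \<comment> \<open>The distinguished tensor is put at the head of the lists, so that
    \<open>bilinear_mlift\<close> yields bilinearity in its factors.\<close>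
  let ?B = "\<lambda>as ps. \<sigma> (foldl mA (hd as) (tl as)) (c (tl ps) (hd ps))"
  have "bilinear_map sA sP sS (\<lambda>a p. \<sigma> (foldl mA a as) (c ps p))" if "length ps = n" for as ps
  proof (rule bilinear_comp[OF S.bilinear_tau linear_foldl])
    show "Vector_Spaces.linear sP sN (c ps)" using hom.cochain_closed[OF assms(1) that] by simp
  qed
  then have "T.pure_multilinear sS (Suc n) ?B"
    using pure_multilinear_product[OF hom_cochain_slice(1)[OF assms(1)]] by simp
  from T.bilinear_mlift[of sS us ?B] this show ?thesis
    using assms(2) by (simp add: H_def del: T.pure_multilinear.simps)
qed

lemma G_pure: "hom.cochain n c \<Longrightarrow> length us = n \<Longrightarrow> G c (\<tau> a p) us = H (\<lambda>ps. c ps p) a us"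
  unfolding G_def using T.tensor_lift(2)[OF G_bilinear] .

lemma G_linear: "hom.cochain n c \<Longrightarrow> length us = n \<Longrightarrow> Vector_Spaces.linear sT sS (\<lambda>u. G c u us)"
  unfolding G_def using T.tensor_lift(1)[OF G_bilinear] .

lemma G_cochain:
  assumes c: "hom.cochain n c" shows "L.cochain n (G c u)"
proof (induction u rule: T.tensor_induct)
  case (pure a p)
  show ?case
    by (rule L.cochain_cong[OF H_cochain[OF hom_cochain_slice[OF c]]]) (simp add: G_pure[OF c])
next
  case (add t u)
  show ?case
    by (rule L.cochain_cong[OF L.cochain_add[OF add]]) (simp add: linear_simps(1)[OF G_linear[OF c]])
qed

lemma cochain_altern_G: "hom.cochain n c \<Longrightarrow> L.cochain (Suc n) (\<lambda>us. L.altern us (G c))"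
  by (rule L.cochain_altern[OF G_linear G_cochain])

text \<open>The formula of \<open>Psi_value\<close> for a curried cochain, with products in Perm
  normal form: the chosen factor first, the others in their given order.\<close>

definition Psi_c :: "('p list \<Rightarrow> 'p \<Rightarrow> 'n) \<Rightarrow> 'a list \<Rightarrow> 'p list \<Rightarrow> 's" where
  "Psi_c c as bs =
    (\<Sum>i<length as. sS ((-1) ^ i) (\<sigma> (foldl mA (as ! i) (del_nth i as)) (c (del_nth i bs) (bs ! i))))"

lemma altern_G_pure:
  assumes c: "hom.cochain n c" and l: "length as = Suc n" "length bs = Suc n"
  shows "L.altern (map2 \<tau> as bs) (G c) = Psi_c c as bs"
  unfolding L.altern_sum Psi_c_def
  using l by (auto intro!: sum.cong simp: G_pure[OF c] del_nth_map2 H_pure[OF hom_cochain_slice(1)[OF c]])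

definition rmul :: "'a \<Rightarrow> 's \<Rightarrow> 's" where
  "rmul a = tensor_lift sS \<sigma> sS (\<lambda>c n. \<sigma> (mA c a) n)"

lemma linear_rmul: "Vector_Spaces.linear sS sS (rmul a)"
  and rmul_pure: "rmul a (\<sigma> c n) = \<sigma> (mA c a) n"
proof -
  have "Vector_Spaces.linear sN sN (\<lambda>n. n)" by (rule linearI) (auto simp: N.vector_space_axioms)
  then have "bilinear_map sA sN sS (\<lambda>c n. \<sigma> (mA c a) n)"
    by (intro bilinear_comp[OF S.bilinear_tau] mA_linear)
  from S.tensor_lift[OF this] show "Vector_Spaces.linear sS sS (rmul a)" "rmul a (\<sigma> c n) = \<sigma> (mA c a) n"
    by (simp_all add: rmul_def)
qed

lemmas rmul_simps = linear_simps[OF linear_rmul]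

text \<open>The action puts its factor before or after the given one; a factor multiplied on the
  right never comes first, so it can be exchanged with later ones.\<close>

lemma rmul_act: "act u (rmul a s) = rmul a (act u s)"
proof (induction u rule: T.tensor_induct)
  case (pure b p)
  show ?case
  proof (induction s rule: S.tensor_induct)
    case (pure c n)
    show ?case by (simp add: rmul_pure act_pure rmul_simps mA_assoc mA_perm[of c a b])
  qed (simp add: act_simps rmul_simps)
qed (simp add: act_simps rmul_simps)

lemma rmul_sum: "rmul a (sum f I) = (\<Sum>i\<in>I. rmul a (f i))"
  by (induction I rule: infinite_finite_induct) (simp_all add: rmul_simps)

lemma theta_rmul: "L.theta u (\<lambda>ys. rmul a (F ys)) us = rmul a (L.theta u F us)"
  by (simp add: L.theta_def rmul_act rmul_simps rmul_sum)

lemma ce_d_rmul: "L.ce_d us (\<lambda>ys. rmul a (F ys)) = rmul a (L.ce_d us F)"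
  by (induction us arbitrary: F) (simp_all add: theta_rmul rmul_simps)

lemma H_rmul:
  assumes "multilinear sP sN n g" "length us = n"
  shows "H g (mA b a) us = rmul a (H g b us)"
proof (rule T.multilinear_eq[OF multilinear_H[OF assms(1)] _ _ assms(2)])
  show "multilinear sT sS n (\<lambda>us. rmul a (H g b us))"
    using multilinear_H[OF assms(1)] linear_comp[OF _ linear_rmul] unfolding multilinear_def by blast
  fix as ps assume "length (as :: 'a list) = n" "length (ps :: 'p list) = n"
  then show "H g (mA b a) (map2 \<tau> as ps) = rmul a (H g b (map2 \<tau> as ps))"
    by (simp add: H_pure[OF assms(1)] rmul_pure foldl_mA_right)
qed

text \<open>The tensor inserted here is not the distinguished one, so \<open>a\<close> is not the
  first factor and can be moved to the end of the product, where it becomes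
  \<open>rmul a\<close>.\<close>

lemma G_Cons:
  assumes c: "hom.cochain (Suc m) c" and us: "length us = m"
  shows "G c x (\<tau> a b # us) = rmul a (G (\<lambda>ps. c (b # ps)) x us)"
proof (induction x rule: T.tensor_induct)
  case (pure a' p)
  have cb: "hom.cochain m (\<lambda>ps. c (b # ps))" using hom.cochain_Cons[OF c] .
  show ?case
    using us H_rmul[OF hom_cochain_slice(1)[OF cb] us]
    by (simp add: G_pure[OF c] G_pure[OF cb] H_Cons[OF hom_cochain_slice(1)[OF c]])
next
  case (add t u)
  have cb: "hom.cochain m (\<lambda>ps. c (b # ps))" using hom.cochain_Cons[OF c] .
  show ?case
    using add us by (simp add: linear_simps(1)[OF G_linear[OF c]] linear_simps(1)[OF G_linear[OF cb]] rmul_simps)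
qed

lemma altern_G_Cons:
  assumes c: "hom.cochain k c" and ys: "length ys = k"
  shows "L.altern (\<tau> a b # ys) (G c) = H (\<lambda>ps. c ps b) a ys - rmul a (L.altern ys (G (\<lambda>ps. c (b # ps))))"
proof -
  have "L.altern ys (\<lambda>x xs. G c x (\<tau> a b # xs)) = rmul a (L.altern ys (G (\<lambda>ps. c (b # ps))))"
  proof (cases k)
    \<comment> \<open>Both alternating sums are empty. This case is separate because
      \<open>c (b # ps)\<close> is a cochain only when \<open>c\<close> has positive degree.\<close>
    case 0
    then show ?thesis using ys by (simp add: rmul_simps)
  next
    case (Suc m)
    have "L.altern ys (\<lambda>x xs. G c x (\<tau> a b # xs)) = L.altern ys (\<lambda>x xs. rmul a (G (\<lambda>ps. c (b # ps)) x xs))"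
      using c ys Suc by (intro L.altern_cong G_Cons) auto
    also have "\<dots> = rmul a (L.altern ys (G (\<lambda>ps. c (b # ps))))"
      by (simp add: L.altern_sum rmul_sum rmul_simps)
    finally show ?thesis .
  qed
  then show ?thesis using G_pure[OF c ys] by simp
qed

lemma foldl_move: "i < length as \<Longrightarrow> foldl mA (mA a (as ! i)) (del_nth i as) = foldl mA a as"
proof (induction as arbitrary: a i)
  case (Cons b as)
  then show ?case using Cons.IH[of "i - 1" "mA a b"] by (cases i) (auto simp: mA_perm[of a _ b])
qed simp

text \<open>Multiplying a factor that is not the first by \<open>z\<close>, on either side,
  multiplies the whole product by \<open>z\<close>. This is why both halves of a bracket at such a
  position give the same product.\<close>

lemma foldl_update_mA:
  "j < length ys \<Longrightarrow> foldl mA x (ys[j := mA z (ys ! j)]) = foldl mA (mA x z) ys"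
  "j < length ys \<Longrightarrow> foldl mA x (ys[j := mA (ys ! j) z]) = foldl mA (mA x z) ys"
proof (induction ys arbitrary: x j)
  case (Cons y ys)
  { case 1 show ?case using Cons.IH(1)[of "j - 1" "mA x y"] 1 by (cases j) (auto simp: mA_assoc mA_perm[of x y z]) }
  { case 2 show ?case using Cons.IH(2)[of "j - 1" "mA x y"] 2 by (cases j) (auto simp: mA_assoc mA_perm[of x y z]) }
qed simp_all

lemma sigma_sum: "\<sigma> q (sum f I) = (\<Sum>i\<in>I. \<sigma> q (f i))"
  by (induction I rule: infinite_finite_induct) (simp_all add: S.tau_simps)

text \<open>The part of Cartan's formula for \<open>a \<otimes> b\<close> that does not pass to the
  smaller cochain \<open>c (b # _)\<close>. Every term carries a product that begins with
  \<open>a\<close> or with some \<open>as ! i\<close>. Sorted accordingly, the second tensor factors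
  are the coboundary and the Lie derivative of \<open>c\<close>, taken in the complex of
  \<open>P\<close> with values in \<open>Hom\<close>.\<close>

lemma coboundary_step:
  assumes c: "hom.cochain k c" and as: "length as = Suc k" and bs: "length bs = Suc k"
  shows "L.theta (\<tau> a b) (\<lambda>us. L.altern us (G c)) (map2 \<tau> as bs) - L.ce_d (map2 \<tau> as bs) (H (\<lambda>ps. c ps b) a) =
    \<sigma> (foldl mA a as) (hom.ce_d bs c b) -
    (\<Sum>i<Suc k. sS ((-1) ^ i) (\<sigma> (foldl mA (mA (as ! i) a) (del_nth i as)) (hom.theta b c (del_nth i bs) (bs ! i))))"
proof -
  let ?us = "map2 \<tau> as bs"
  let ?q = "foldl mA a as"
  let ?r = "\<lambda>i. foldl mA (mA (as ! i) a) (del_nth i as)"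
  let ?d = "\<lambda>i. del_nth i bs"
  \<comment> \<open>\<open>X1\<close>, \<open>X3\<close>, \<open>X7\<close> and \<open>Y\<close>
    will accompany the product \<open>?q\<close>, which begins with \<open>a\<close>; they add up to
    \<open>hom.ce_d bs c b\<close>. \<open>X2\<close>, \<open>X4\<close>, \<open>X5\<close> and
    \<open>X6\<close> will accompany \<open>?r i\<close>, which begins with \<open>as ! i\<close>;
    they add up to \<open>hom.theta b c\<close>.\<close>
  define X1 where "X1 i = lN b (c (?d i) (bs ! i))" for i
  define X2 where "X2 i = rN (c (?d i) (bs ! i)) b" for i
  define X3 where "X3 i = c (?d i) (mP b (bs ! i))" for i
  define X4 where "X4 i = c (?d i) (mP (bs ! i) b)" for i
  define X5 where "X5 i = (\<Sum>j<k. c ((?d i)[j := op_br b (?d i ! j)]) (bs ! i))" for i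
  define X6 where "X6 i = lN (bs ! i) (c (?d i) b)" for i
  define X7 where "X7 i = rN (c (?d i) b) (bs ! i)" for i
  define Y where "Y = (\<Sum>j<Suc k. \<Sum>i<j. sN ((-1) ^ (i + j)) (c (op_br (bs ! i) (bs ! j) # del_nth i (del_nth j bs)) b))"
  have us: "length ?us = Suc k" "\<And>i. i < Suc k \<Longrightarrow> ?us ! i = \<tau> (as ! i) (bs ! i)" using as bs by auto

  have 1: "act (\<tau> a b) (L.altern ?us (G c)) = (\<Sum>i<Suc k. sS ((-1) ^ i) (\<sigma> ?q (X1 i) - \<sigma> (?r i) (X2 i)))"
  proof -
    have "act (\<tau> a b) (\<sigma> (foldl mA (as ! i) (del_nth i as)) n) = \<sigma> ?q (lN b n) - \<sigma> (?r i) (rN n b)"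
      if "i < Suc k" for i n
    proof -
      have "mA a (foldl mA (as ! i) (del_nth i as)) = ?q" using that as by (simp add: mA_foldl foldl_move)
      then show ?thesis by (simp add: act_pure foldl_mA_right)
    qed
    then show ?thesis
      unfolding altern_G_pure[OF c as bs] Psi_c_def X1_def X2_def
      using as by (simp add: L.act_sum act_simps del: sum.lessThan_Suc)
  qed

  have 2: "(\<Sum>j<Suc k. L.altern (?us[j := br (\<tau> a b) (?us ! j)]) (G c)) =
      (\<Sum>i<Suc k. sS ((-1) ^ i) (\<sigma> ?q (X3 i) - \<sigma> (?r i) (X4 i) - \<sigma> (?r i) (X5 i)))"
  proof -
    let ?M = "\<lambda>i. sS ((-1) ^ i) (\<sigma> ?q (X3 i) - \<sigma> (?r i) (X4 i))"
    let ?F = "\<lambda>i j. - sS ((-1) ^ i) (\<sigma> (?r i) (c ((?d i)[j := op_br b (?d i ! j)]) (bs ! i)))"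
    \<comment> \<open>When the bracket hits the distinguished position, its two halves have
      different first factors. Elsewhere both halves give the product \<open>?r i\<close>, and they
      combine into \<open>op_br\<close> inside \<open>c\<close>, with a minus sign since the bracket
      is the opposite one.\<close>
    have summand: "L.altern (?us[j := br (\<tau> a b) (?us ! j)]) (G c) =
        (\<Sum>i<Suc k. if i = j then ?M i else ?F i (skip i j))"
      if j: "j < Suc k" for j
    proof -
      let ?x = "mA a (as ! j)" and ?x' = "mA (as ! j) a" and ?y = "mP b (bs ! j)" and ?y' = "mP (bs ! j) b"
      have "L.altern (?us[j := br (\<tau> a b) (?us ! j)]) (G c) =
          L.altern (?us[j := \<tau> ?x ?y]) (G c) - L.altern (?us[j := \<tau> ?x' ?y']) (G c)"
        using linear_simps(5)[OF L.cochain_update_linear[OF cochain_altern_G[OF c] us(1) j]] j us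
        by (simp add: br_pure)
      also have "\<dots> = Psi_c c (as[j := ?x]) (bs[j := ?y]) - Psi_c c (as[j := ?x']) (bs[j := ?y'])"
        using as bs by (simp add: map2_update altern_G_pure[OF c])
      also have "\<dots> = (\<Sum>i<Suc k. if i = j then ?M i else ?F i (skip i j))"
        unfolding Psi_c_def length_list_update as sum_subtractf[symmetric]
      proof (intro sum.cong refl)
        fix i assume i: "i \<in> {..<Suc k}"
        show "sS ((-1) ^ i) (\<sigma> (foldl mA (as[j := ?x] ! i) (del_nth i (as[j := ?x]))) (c (del_nth i (bs[j := ?y])) (bs[j := ?y] ! i)))
            - sS ((-1) ^ i) (\<sigma> (foldl mA (as[j := ?x'] ! i) (del_nth i (as[j := ?x']))) (c (del_nth i (bs[j := ?y'])) (bs[j := ?y'] ! i)))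
          = (if i = j then ?M i else ?F i (skip i j))"
        proof (cases "i = j")
          case True
          then show ?thesis
            using j as bs by (simp add: del_nth_update_same foldl_move X3_def X4_def S.T.scale_right_diff_distrib)
        next
          case False
          have s: "skip i j < k" using False i j skip_less[of i j "Suc k"] by simp
          have r: "foldl mA (as ! i) (del_nth i (as[j := ?x])) = ?r i" "foldl mA (as ! i) (del_nth i (as[j := ?x'])) = ?r i"
            using foldl_update_mA[of "skip i j" "del_nth i as" "as ! i" a] False i j as s
            by (simp_all add: del_nth_update_skip nth_del_nth_skip)
          have "Vector_Spaces.linear sP hom_scale (\<lambda>x. c ((?d i)[skip i j := x]))"
            using c bs i s by (intro hom.cochain_update_linear) auto
          from linear_simps(5)[OF this, of ?y' ?y]
          have "c ((?d i)[skip i j := op_br b (bs ! j)]) (bs ! i) =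
              c ((?d i)[skip i j := ?y']) (bs ! i) - c ((?d i)[skip i j := ?y]) (bs ! i)"
            by (simp add: op_br_def)
          then show ?thesis
            using False i j bs r
            by (simp add: del_nth_update_skip nth_del_nth_skip S.tau_simps S.T.scale_right_diff_distrib)
        qed
      qed
      finally show ?thesis .
    qed
    have "(\<Sum>j<Suc k. L.altern (?us[j := br (\<tau> a b) (?us ! j)]) (G c)) =
        (\<Sum>i<Suc k. \<Sum>j<Suc k. if i = j then ?M i else ?F i (skip i j))"
      using summand by (subst sum.swap) (intro sum.cong refl, simp)
    also have "\<dots> = (\<Sum>i<Suc k. sS ((-1) ^ i) (\<sigma> ?q (X3 i) - \<sigma> (?r i) (X4 i) - \<sigma> (?r i) (X5 i)))"
    proof (intro sum.cong refl)
      fix i assume i: "i \<in> {..<Suc k}"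
      have "(\<Sum>j<Suc k. if i = j then ?M i else ?F i (skip i j)) =
          ?M i + (\<Sum>j\<in>{..<Suc k} - {i}. ?F i (skip i j))"
        using i by (subst sum.remove[of _ i]) (auto intro!: sum.cong)
      also have "(\<Sum>j\<in>{..<Suc k} - {i}. ?F i (skip i j)) = (\<Sum>j<k. ?F i j)"
        using i by (intro sum_skip) simp
      also have "\<dots> = - sS ((-1) ^ i) (\<sigma> (?r i) (X5 i))"
        by (simp add: X5_def sigma_sum S.T.scale_sum_right sum_negf)
      finally show "(\<Sum>j<Suc k. if i = j then ?M i else ?F i (skip i j)) =
          sS ((-1) ^ i) (\<sigma> ?q (X3 i) - \<sigma> (?r i) (X4 i) - \<sigma> (?r i) (X5 i))"
        by (simp add: S.T.scale_right_diff_distrib)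
    qed
    finally show ?thesis .
  qed

  have 3: "L.ce_d ?us (H (\<lambda>ps. c ps b) a) =
      - \<sigma> ?q Y + (\<Sum>i<Suc k. sS ((-1) ^ i) (\<sigma> (?r i) (X6 i) - \<sigma> ?q (X7 i)))"
  proof -
    note slice = hom_cochain_slice[OF c, of b]
    have coch: "L.cochain k (H (\<lambda>ps. c ps b) a)" using H_cochain[OF slice] .
    have "H (\<lambda>ps. c ps b) a (br (?us ! i) (?us ! j) # del_nth i (del_nth j ?us)) =
        - \<sigma> ?q (c (op_br (bs ! i) (bs ! j) # del_nth i (del_nth j bs)) b)" if ij: "i < j" "j < Suc k" for i j
    proof -
      obtain m where k: "k = Suc m" using ij by (cases k) auto
      let ?das = "del_nth i (del_nth j as)" and ?dbs = "del_nth i (del_nth j bs)"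
      have l: "length ?das = m" "length ?dbs = m" using ij as bs k by auto
      have d: "del_nth i (del_nth j ?us) = map2 \<tau> ?das ?dbs"
        using as bs ij by (simp add: del_nth_map2)
      have pure: "H (\<lambda>ps. c ps b) a (\<tau> x y # map2 \<tau> ?das ?dbs) = \<sigma> (foldl mA (mA a x) ?das) (c (y # ?dbs) b)" for x y
        using H_pure[OF slice(1), of "x # ?das" "y # ?dbs" a] l k by simp
      \<comment> \<open>Both products of the bracket stand behind the first factor \<open>a\<close>,
        so both equal the full product \<open>?q\<close>.\<close>
      have move: "foldl mA (mA a (mA (as ! i) (as ! j))) ?das = ?q" "foldl mA (mA a (mA (as ! j) (as ! i))) ?das = ?q"
      proof -
        have "as ! i = del_nth j as ! i" using ij as by (simp add: del_nth_def nth_append)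
        then have "foldl mA (mA (mA a (as ! j)) (as ! i)) ?das = foldl mA (mA a (as ! j)) (del_nth j as)"
          using foldl_move[of i "del_nth j as"] ij as by simp
        also have "\<dots> = ?q" using foldl_move[of j as] ij as by simp
        finally show "foldl mA (mA a (mA (as ! j) (as ! i))) ?das = ?q" by (simp add: mA_assoc)
        then show "foldl mA (mA a (mA (as ! i) (as ! j))) ?das = ?q"
          by (simp add: mA_assoc mA_perm[of a "as ! i" "as ! j"])
      qed
      have lin: "Vector_Spaces.linear sT sS (\<lambda>u. H (\<lambda>ps. c ps b) a (u # map2 \<tau> ?das ?dbs))"
        using coch l k by (intro L.cochain_linear[of m]) auto
      have "Vector_Spaces.linear sP hom_scale (\<lambda>x. c (x # ?dbs))"
        using c l k by (intro hom.cochain_linear[of m]) auto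
      from linear_simps(5)[OF this, of "mP (bs ! j) (bs ! i)" "mP (bs ! i) (bs ! j)"]
      have "c (op_br (bs ! i) (bs ! j) # ?dbs) b = c (mP (bs ! j) (bs ! i) # ?dbs) b - c (mP (bs ! i) (bs ! j) # ?dbs) b"
        by (simp add: op_br_def)
      then show ?thesis
        using ij us(2) unfolding d
        by (simp add: br_pure linear_simps(5)[OF lin] pure move S.tau_simps)
    qed
    then have dbl: "(\<Sum>j<Suc k. \<Sum>i<j. sS ((-1) ^ (i + j)) (H (\<lambda>ps. c ps b) a (br (?us ! i) (?us ! j) # del_nth i (del_nth j ?us)))) =
        - \<sigma> ?q Y"
      by (simp add: Y_def sigma_sum S.tau_simps sum_negf del: sum.lessThan_Suc)
    have "act (?us ! i) (H (\<lambda>ps. c ps b) a (del_nth i ?us)) = \<sigma> (?r i) (X6 i) - \<sigma> ?q (X7 i)" if i: "i < Suc k" for i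
    proof -
      have "H (\<lambda>ps. c ps b) a (del_nth i ?us) = \<sigma> (foldl mA a (del_nth i as)) (c (?d i) b)"
        using as bs i by (simp add: del_nth_map2 H_pure[OF slice(1)])
      then show ?thesis
        using us(2)[OF i] i as foldl_move[of i as a]
        by (simp add: act_pure mA_foldl X6_def X7_def flip: foldl_mA_right)
    qed
    then have sgl: "(\<Sum>i<Suc k. sS ((-1) ^ i) (act (?us ! i) (H (\<lambda>ps. c ps b) a (del_nth i ?us)))) =
        (\<Sum>i<Suc k. sS ((-1) ^ i) (\<sigma> (?r i) (X6 i) - \<sigma> ?q (X7 i)))" by simp
    show ?thesis
      unfolding L.lie_coboundary_eq_ce_d[OF coch us(1), symmetric] lie_coboundary_def
      using dbl sgl us(1) by (simp del: sum.lessThan_Suc)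
  qed

  have 4: "hom.ce_d bs c b = Y + (\<Sum>i<Suc k. sN ((-1) ^ i) (X1 i - X3 i + X7 i))"
    unfolding hom.lie_coboundary_eq_ce_d[OF c bs, symmetric] lie_coboundary_def
    using bs by (simp add: sum_fun_apply hom_scale_def hom_act_def Y_def X1_def X3_def X7_def del: sum.lessThan_Suc)

  have 5: "hom.theta b c (?d i) (bs ! i) = X6 i - X4 i + X2 i - X5 i" if "i < Suc k" for i
    using bs that by (simp add: hom.theta_def sum_fun_apply hom_act_def X6_def X4_def X2_def X5_def)

  show ?thesis
    unfolding L.theta_def us(1) 1 2 3 4
    by (simp add: 5 S.tau_simps sigma_sum sum.distrib sum_subtractf S.T.scale_right_distrib
        S.T.scale_right_diff_distrib algebra_simps del: sum.lessThan_Suc)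
qed

text \<open>Currying lowers the degree of \<open>c\<close> to \<open>n - 1\<close>. The disjunct
  \<open>n = 0\<close> lets the induction start from an empty alternating sum, where
  \<open>c\<close> is arbitrary.\<close>

lemma ce_d_altern_G:
  "n = 0 \<or> hom.cochain (n - 1) c \<Longrightarrow> length as = Suc n \<Longrightarrow> length bs = Suc n \<Longrightarrow>
    L.ce_d (map2 \<tau> as bs) (\<lambda>us. L.altern us (G c)) = Psi_c (\<lambda>bs. hom.ce_d bs c) as bs"
proof (induction n arbitrary: c as bs)
  case 0
  then obtain a b where "as = [a]" "bs = [b]" by (auto simp: length_Suc_conv)
  then show ?case by (simp add: Psi_c_def act_simps S.tau_simps)
next
  case (Suc k)
  have c: "hom.cochain k c" using Suc.prems(1) by simp
  obtain a as' where as: "as = a # as'" "length as' = Suc k" using Suc.prems(2) by (auto simp: length_Suc_conv)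
  obtain b bs' where bs: "bs = b # bs'" "length bs' = Suc k" using Suc.prems(3) by (auto simp: length_Suc_conv)
  let ?us = "map2 \<tau> as' bs'" and ?cb = "\<lambda>ps. c (b # ps)"
  have "k = 0 \<or> hom.cochain (k - 1) ?cb" using c hom.cochain_Cons[of "k - 1" c b] by (cases k) auto
  then have IH: "L.ce_d ?us (\<lambda>us. L.altern us (G ?cb)) = Psi_c (\<lambda>bs. hom.ce_d bs ?cb) as' bs'"
    using as bs by (intro Suc.IH)
  have "L.ce_d ?us (\<lambda>ys. L.altern (\<tau> a b # ys) (G c)) =
      L.ce_d ?us (\<lambda>ys. H (\<lambda>ps. c ps b) a ys - rmul a (L.altern ys (G ?cb)))"
    using as bs by (intro L.ce_d_cong altern_G_Cons[OF c]) simp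
  also have "\<dots> = L.ce_d ?us (H (\<lambda>ps. c ps b) a) - rmul a (Psi_c (\<lambda>bs. hom.ce_d bs ?cb) as' bs')"
    by (simp add: L.ce_d_diff ce_d_rmul IH)
  finally have "L.ce_d (map2 \<tau> as bs) (\<lambda>us. L.altern us (G c)) =
      L.theta (\<tau> a b) (\<lambda>us. L.altern us (G c)) ?us - L.ce_d ?us (H (\<lambda>ps. c ps b) a)
      + rmul a (Psi_c (\<lambda>bs. hom.ce_d bs ?cb) as' bs')"
    by (simp add: as bs del: L.altern.simps)
  also have "\<dots> = \<sigma> (foldl mA a as') (hom.ce_d bs' c b) -
    (\<Sum>i<Suc k. sS ((-1) ^ i) (\<sigma> (foldl mA (mA (as' ! i) a) (del_nth i as')) (hom.theta b c (del_nth i bs') (bs' ! i))))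
    + rmul a (Psi_c (\<lambda>bs. hom.ce_d bs ?cb) as' bs')"
    using coboundary_step[OF c as(2) bs(2)] by simp
  also have "rmul a (Psi_c (\<lambda>bs. hom.ce_d bs ?cb) as' bs') =
      (\<Sum>i<Suc k. sS ((-1) ^ i) (\<sigma> (foldl mA (mA (as' ! i) a) (del_nth i as')) (hom.ce_d (del_nth i bs') ?cb (bs' ! i))))"
    by (simp add: Psi_c_def as(2) rmul_sum rmul_simps rmul_pure foldl_mA_right del: sum.lessThan_Suc)
  \<comment> \<open>Summand 0 of \<open>Psi_c\<close> distinguishes \<open>b\<close>. In every other
    summand \<open>b\<close> heads the list of remaining arguments, and the recursion of
    \<open>hom.ce_d\<close> splits it into the Lie derivative and the coboundary of
    \<open>c (b # _)\<close>; the index shift produces the minus sign.\<close>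
  also have "\<sigma> (foldl mA a as') (hom.ce_d bs' c b) -
    (\<Sum>i<Suc k. sS ((-1) ^ i) (\<sigma> (foldl mA (mA (as' ! i) a) (del_nth i as')) (hom.theta b c (del_nth i bs') (bs' ! i))))
    + (\<Sum>i<Suc k. sS ((-1) ^ i) (\<sigma> (foldl mA (mA (as' ! i) a) (del_nth i as')) (hom.ce_d (del_nth i bs') ?cb (bs' ! i)))) =
    Psi_c (\<lambda>bs. hom.ce_d bs c) as bs"
    unfolding Psi_c_def as(1) bs(1) length_Cons as(2) sum.lessThan_Suc_shift[of _ "Suc k"]
    by (simp add: S.tau_simps S.T.scale_right_diff_distrib sum_subtractf sum_negf algebra_simps del: sum.lessThan_Suc)
  finally show ?case .
qed

end

section \<open>Free Perm algebras\<close>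

lemma linear_ext_eq:
  fixes p :: "'x \<Rightarrow>\<^sub>0 'k::field"
  assumes f: "Vector_Spaces.linear free_scale s f"
  shows "f p = linear_ext s (\<lambda>k. f (Poly_Mapping.single k 1)) p"
proof -
  interpret vector_space s using linear_vector_space[OF f] by blast
  have f_sum: "f (\<Sum>k\<in>K. g k) = (\<Sum>k\<in>K. f (g k))" for K :: "'x set" and g
    by (induction K rule: infinite_finite_induct) (simp_all add: linear_simps[OF f])
  have "f (\<Sum>k\<in>Poly_Mapping.keys p. free_scale (Poly_Mapping.lookup p k) (Poly_Mapping.single k 1)) =
      linear_ext s (\<lambda>k. f (Poly_Mapping.single k 1)) p"
    unfolding f_sum linear_ext_def by (simp add: linear_simps[OF f])
  then show ?thesis by (simp add: sum_scaled_singles)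
qed

lemma linear_free_eq:
  assumes "Vector_Spaces.linear free_scale s f" "Vector_Spaces.linear free_scale s g"
    and "\<And>k. f (Poly_Mapping.single k 1) = g (Poly_Mapping.single k 1)"
  shows "f p = g p"
  using linear_ext_eq[OF assms(1), of p] linear_ext_eq[OF assms(2), of p] assms(3) by simp

lemma free_scale_single: "free_scale c (Poly_Mapping.single k d) = Poly_Mapping.single k (c * d)"
  by (rule poly_mapping_eqI) (simp add: lookup_single when_def)

text \<open>As an iterated linear extension from words, the product inherits bilinearity.\<close>

lemma fa_mult_eq:
  "fa_mult p q = linear_ext free_scale (\<lambda>u. linear_ext free_scale (\<lambda>v. Poly_Mapping.single (u @ v) 1) q) p"
proof -
  interpret vector_space "free_scale :: 'b \<Rightarrow> ('a list \<Rightarrow>\<^sub>0 'b) \<Rightarrow> _" by (rule vector_space_free_scale)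
  show ?thesis by (simp add: fa_mult_def linear_ext_def scale_sum_right free_scale_single)
qed

lemma bilinear_fa_mult: "bilinear_map free_scale free_scale free_scale (fa_mult :: ('x list \<Rightarrow>\<^sub>0 'k::field) \<Rightarrow> _)"
  unfolding bilinear_map_def
proof (intro conjI allI)
  interpret vector_space "free_scale :: 'k \<Rightarrow> ('x list \<Rightarrow>\<^sub>0 'k) \<Rightarrow> _" by (rule vector_space_free_scale)
  fix p q :: "'x list \<Rightarrow>\<^sub>0 'k"
  show "Vector_Spaces.linear free_scale free_scale (fa_mult p)"
    unfolding fa_mult_eq[abs_def] linear_ext_def[of free_scale _ p]
    by (intro linear_sum linear_scale linear_linear_ext vector_space_free_scale)
  show "Vector_Spaces.linear free_scale free_scale (\<lambda>p. fa_mult p q)"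
    unfolding fa_mult_eq by (rule linear_linear_ext[OF vector_space_free_scale])
qed

lemmas fa_mult_linear = bilinear_map_linear[OF bilinear_fa_mult]
lemmas fa_mult_simps = bilinear_map_simps[OF bilinear_fa_mult]

lemma fa_mult_single: "fa_mult (Poly_Mapping.single u c) (Poly_Mapping.single v d) = Poly_Mapping.single (u @ v) (c * d)"
  by (simp add: fa_mult_eq linear_ext_single[OF vector_space_free_scale] free_scale_single)

text \<open>Linearity in the three factors, used one after the other, reduces the claim to words,
  where it is associativity of concatenation.\<close>

lemma fa_mult_assoc:
  fixes p q r :: "'x list \<Rightarrow>\<^sub>0 'k::field"
  shows "fa_mult (fa_mult p q) r = fa_mult p (fa_mult q r)"
proof (rule linear_free_eq[of free_scale "\<lambda>p. fa_mult (fa_mult p q) r"])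
  show "Vector_Spaces.linear free_scale free_scale (\<lambda>p. fa_mult (fa_mult p q) r)"
    by (rule linear_comp[OF fa_mult_linear(2) fa_mult_linear(2)])
  show "Vector_Spaces.linear free_scale free_scale (\<lambda>p. fa_mult p (fa_mult q r))"
    by (rule fa_mult_linear(2))
  fix u :: "'x list"
  let ?u = "Poly_Mapping.single u 1 :: 'x list \<Rightarrow>\<^sub>0 'k"
  show "fa_mult (fa_mult ?u q) r = fa_mult ?u (fa_mult q r)"
  proof (rule linear_free_eq[of free_scale "\<lambda>q. fa_mult (fa_mult ?u q) r"])
    show "Vector_Spaces.linear free_scale free_scale (\<lambda>q. fa_mult (fa_mult ?u q) r)"
      by (rule linear_comp[OF fa_mult_linear(1) fa_mult_linear(2)])
    show "Vector_Spaces.linear free_scale free_scale (\<lambda>q. fa_mult ?u (fa_mult q r))"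
      by (rule linear_comp[OF fa_mult_linear(2) fa_mult_linear(1)])
    fix v :: "'x list"
    let ?v = "Poly_Mapping.single v 1 :: 'x list \<Rightarrow>\<^sub>0 'k"
    show "fa_mult (fa_mult ?u ?v) r = fa_mult ?u (fa_mult ?v r)"
    proof (rule linear_free_eq[of free_scale "\<lambda>r. fa_mult (fa_mult ?u ?v) r"])
      show "Vector_Spaces.linear free_scale free_scale (fa_mult (fa_mult ?u ?v))"
        by (rule fa_mult_linear(1))
      show "Vector_Spaces.linear free_scale free_scale (\<lambda>r. fa_mult ?u (fa_mult ?v r))"
        by (rule linear_comp[OF fa_mult_linear(1) fa_mult_linear(1)])
    qed (simp add: fa_mult_single)
  qed
qed

lemma carrier_free_assoc: "carrier (free_assoc X) = {p. Poly_Mapping.keys p \<subseteq> {w. w \<noteq> [] \<and> set w \<subseteq> X}}"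
  by (simp add: free_assoc_def)

lemma free_assoc_simps [simp]:
  "\<zero>\<^bsub>free_assoc X\<^esub> = 0" "p \<oplus>\<^bsub>free_assoc X\<^esub> q = p + q" "c \<odot>\<^bsub>free_assoc X\<^esub> p = free_scale c p"
  "p \<otimes>\<^bsub>free_assoc X\<^esub> q = fa_mult p q"
  by (simp_all add: free_assoc_def algebra_of_def space_of_def)

lemma uminus_free_assoc [simp]: "- p \<in> carrier (free_assoc X) \<longleftrightarrow> p \<in> carrier (free_assoc X)"
  by (simp add: carrier_free_assoc)

lemma zero_free_assoc [simp]: "0 \<in> carrier (free_assoc X)"
  by (simp add: carrier_free_assoc)

lemma diff_free_assoc: "p \<in> carrier (free_assoc X) \<Longrightarrow> q \<in> carrier (free_assoc X) \<Longrightarrow> p - q \<in> carrier (free_assoc X)"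
  using keys_add[of p "- q"] by (auto simp: carrier_free_assoc)

lemma free_scale_simps:
  "free_scale (a + b) p = free_scale a p + free_scale b p" "free_scale a (p + q) = free_scale a p + free_scale a q"
  "free_scale (a * b) p = free_scale a (free_scale b p)" "free_scale 1 p = p"
  by (rule poly_mapping_eqI, simp add: lookup_add algebra_simps)+

lemma keys_sum_subset: "(\<And>i. i \<in> I \<Longrightarrow> Poly_Mapping.keys (f i) \<subseteq> K) \<Longrightarrow> Poly_Mapping.keys (sum f I) \<subseteq> K"
  by (induction I rule: infinite_finite_induct) (use keys_add in \<open>fastforce+\<close>)

lemma fa_mult_closed:
  assumes "p \<in> carrier (free_assoc X)" "q \<in> carrier (free_assoc X)"
  shows "fa_mult p q \<in> carrier (free_assoc X)"
proof -
  have "Poly_Mapping.keys (fa_mult p q) \<subseteq> {w. w \<noteq> [] \<and> set w \<subseteq> X}"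
    unfolding fa_mult_def
  proof (intro keys_sum_subset)
    fix u v assume "u \<in> Poly_Mapping.keys p" "v \<in> Poly_Mapping.keys q"
    then have "u @ v \<noteq> []" "set (u @ v) \<subseteq> X" using assms by (auto simp: carrier_free_assoc)
    then show "Poly_Mapping.keys (Poly_Mapping.single (u @ v) (Poly_Mapping.lookup p u * Poly_Mapping.lookup q v))
        \<subseteq> {w. w \<noteq> [] \<and> set w \<subseteq> X}" by (auto split: if_splits)
  qed
  then show ?thesis by (simp add: carrier_free_assoc)
qed

lemma module_free_assoc: "module field_ring (free_assoc X :: ('k::field, 'x list \<Rightarrow>\<^sub>0 'k) module)"
proof (rule moduleI[OF cring_field_ring])
  let ?F = "free_assoc X :: ('k, 'x list \<Rightarrow>\<^sub>0 'k) module"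
  interpret vector_space "free_scale :: 'k \<Rightarrow> ('x list \<Rightarrow>\<^sub>0 'k) \<Rightarrow> _" by (rule vector_space_free_scale)
  show "abelian_group ?F"
  proof (rule abelian_groupI)
    fix p q assume "p \<in> carrier ?F" "q \<in> carrier ?F"
    then show "p \<oplus>\<^bsub>?F\<^esub> q \<in> carrier ?F" using keys_add[of p q] by (auto simp: carrier_free_assoc)
  next
    fix p assume "p \<in> carrier ?F"
    then show "\<exists>q\<in>carrier ?F. q \<oplus>\<^bsub>?F\<^esub> p = \<zero>\<^bsub>?F\<^esub>" by (intro bexI[of _ "- p"]) (auto simp: carrier_free_assoc)
  qed (simp_all add: ac_simps carrier_free_assoc)
  fix c p assume "p \<in> carrier ?F"
  moreover have "Poly_Mapping.keys (free_scale c p) \<subseteq> Poly_Mapping.keys p"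
    by (auto simp: in_keys_iff)
  ultimately show "c \<odot>\<^bsub>?F\<^esub> p \<in> carrier ?F" by (auto simp: carrier_free_assoc)
qed (simp_all add: free_scale_simps)

section \<open>The free associative algebra modulo a two-sided ideal\<close>

context
  fixes X :: "'x set" and I :: "('x list \<Rightarrow>\<^sub>0 'k::field) set"
  assumes ideal: "two_sided_ideal (free_assoc X) I"
begin

interpretation Q: quotient_space "free_assoc X :: ('k, 'x list \<Rightarrow>\<^sub>0 'k) module" I
  using ideal unfolding two_sided_ideal_def by (intro quotient_space.intro quotient_space_axioms.intro module_free_assoc) blast

lemma minus_free_assoc: "p \<in> carrier (free_assoc X) \<Longrightarrow> q \<in> carrier (free_assoc X) \<Longrightarrow>
    p \<ominus>\<^bsub>free_assoc X :: ('k, 'x list \<Rightarrow>\<^sub>0 'k) module\<^esub> q = p - q"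
  using Q.M.minus_equality[of "- q" q] by (simp add: a_minus_def)

lemma quotient_mult:
  assumes p: "p \<in> carrier (free_assoc X)" and q: "q \<in> carrier (free_assoc X)"
  shows "(I +>\<^bsub>free_assoc X\<^esub> p) \<otimes>\<^bsub>quotient_module (free_assoc X) I\<^esub> (I +>\<^bsub>free_assoc X\<^esub> q) =
    I +>\<^bsub>free_assoc X\<^esub> (fa_mult p q)"
proof -
  let ?F = "free_assoc X :: ('k, 'x list \<Rightarrow>\<^sub>0 'k) module"
  have "I +>\<^bsub>?F\<^esub> (fa_mult a b) = I +>\<^bsub>?F\<^esub> (fa_mult p q)"
    if a: "a \<in> I +>\<^bsub>?F\<^esub> p" and b: "b \<in> I +>\<^bsub>?F\<^esub> q" for a b
  proof (rule Q.coset_eqI)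
    have ac: "a \<in> carrier ?F" "b \<in> carrier ?F" using Q.coset_carrier a b p q by blast+
    show "fa_mult a b \<in> carrier ?F" "fa_mult p q \<in> carrier ?F" using fa_mult_closed ac p q by blast+
    have "a - p \<in> I" "b - q \<in> I"
      using a b Q.mem_coset_iff[OF p ac(1)] Q.mem_coset_iff[OF q ac(2)] minus_free_assoc[OF ac(1) p] minus_free_assoc[OF ac(2) q]
      by auto
    then have "fa_mult (a - p) b \<in> I" "fa_mult p (b - q) \<in> I"
      using ideal ac p by (auto simp: two_sided_ideal_def)
    then have "fa_mult (a - p) b + fa_mult p (b - q) \<in> I" using Q.U_simps(5) by simp
    \<comment> \<open>The usual splitting of \<open>a b - p q\<close>: the left multiples and the
      right multiples in the ideal are used once each.\<close>
    moreover have "fa_mult (a - p) b + fa_mult p (b - q) = fa_mult a b - fa_mult p q"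
      by (simp add: fa_mult_simps)
    ultimately show "fa_mult a b \<ominus>\<^bsub>?F\<^esub> fa_mult p q \<in> I"
      using ac p q by (simp add: minus_free_assoc fa_mult_closed)
  qed
  then have "(\<Union>a\<in>I +>\<^bsub>?F\<^esub> p. \<Union>b\<in>I +>\<^bsub>?F\<^esub> q. I +>\<^bsub>?F\<^esub> (fa_mult a b)) =
      (\<Union>a\<in>I +>\<^bsub>?F\<^esub> p. \<Union>b\<in>I +>\<^bsub>?F\<^esub> q. I +>\<^bsub>?F\<^esub> (fa_mult p q))"
    by (intro SUP_cong refl)
  also have "\<dots> = I +>\<^bsub>?F\<^esub> (fa_mult p q)" using Q.coset_self[OF p] Q.coset_self[OF q] by blast
  finally show ?thesis by (simp add: quotient_module_def rcoset_mult_def)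
qed

lemma quotient_eq_iff:
  "p \<in> carrier (free_assoc X) \<Longrightarrow> q \<in> carrier (free_assoc X) \<Longrightarrow>
    I +>\<^bsub>free_assoc X\<^esub> p = I +>\<^bsub>free_assoc X\<^esub> q \<longleftrightarrow> p - q \<in> I"
  using Q.coset_eq_iff[of p q] by (simp add: minus_free_assoc)

lemmas quotient_ops = Q.add_quotient Q.smult_quotient Q.carrier_quotient

end

definition perm_relators :: "'x set \<Rightarrow> ('x list \<Rightarrow>\<^sub>0 'k::field) set" where
  "perm_relators X = {fa_mult x (fa_mult y z) - fa_mult x (fa_mult z y) | x y z.
        x \<in> carrier (free_assoc X :: ('k, _) module) \<and> y \<in> carrier (free_assoc X :: ('k, _) module) \<and>
        z \<in> carrier (free_assoc X :: ('k, _) module)}"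

lemma perm_ideal_eq: "perm_ideal X = \<Inter> {J. two_sided_ideal (free_assoc X) J \<and> perm_relators X \<subseteq> J}"
  by (simp add: perm_ideal_def perm_relators_def)

lemma two_sided_ideal_carrier: "two_sided_ideal (free_assoc X) (carrier (free_assoc X :: ('k::field, 'x list \<Rightarrow>\<^sub>0 'k) module))"
proof -
  interpret module field_ring "free_assoc X :: ('k, 'x list \<Rightarrow>\<^sub>0 'k) module" by (rule module_free_assoc)
  have "submodule (carrier (free_assoc X)) field_ring (free_assoc X :: ('k, 'x list \<Rightarrow>\<^sub>0 'k) module)"
  proof (rule submoduleI)
    fix a b :: "'x list \<Rightarrow>\<^sub>0 'k" and c :: 'k
    assume a: "a \<in> carrier (free_assoc X)"
    show "\<ominus>\<^bsub>free_assoc X\<^esub> a \<in> carrier (free_assoc X)" using M.a_inv_closed[OF a] .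
    show "c \<odot>\<^bsub>free_assoc X\<^esub> a \<in> carrier (free_assoc X)" using smult_closed[of c a] a by simp
    assume b: "b \<in> carrier (free_assoc X)"
    show "a \<oplus>\<^bsub>free_assoc X\<^esub> b \<in> carrier (free_assoc X)" using M.a_closed[OF a b] .
  qed (use M.zero_closed in auto)
  then show ?thesis using fa_mult_closed unfolding two_sided_ideal_def free_assoc_simps(4) by blast
qed

lemma two_sided_ideal_perm_ideal: "two_sided_ideal (free_assoc X) (perm_ideal X :: ('x list \<Rightarrow>\<^sub>0 'k::field) set)"
proof -
  let ?F = "free_assoc X :: ('k, 'x list \<Rightarrow>\<^sub>0 'k) module"
  interpret module field_ring ?F by (rule module_free_assoc)
  let ?Js = "{J. two_sided_ideal ?F J \<and> perm_relators X \<subseteq> J}"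
  have J: "submodule J field_ring ?F" if "J \<in> ?Js" for J using that by (simp add: two_sided_ideal_def)
  have "perm_relators X \<subseteq> carrier ?F"
    unfolding perm_relators_def by (auto intro!: diff_free_assoc fa_mult_closed)
  \<comment> \<open>The family of ideals is not empty, so its intersection does stay inside the
    carrier.\<close>
  then have carrier: "carrier ?F \<in> ?Js" using two_sided_ideal_carrier by simp
  have "submodule (perm_ideal X) field_ring ?F"
    unfolding perm_ideal_eq
  proof (rule submoduleI)
    show "\<Inter> ?Js \<subseteq> carrier ?F" using carrier by blast
    show "\<zero>\<^bsub>?F\<^esub> \<in> \<Inter> ?Js"
    proof
      fix J assume "J \<in> ?Js"
      then interpret Q: quotient_space ?F J by (intro quotient_space.intro quotient_space_axioms.intro module_axioms J)
      show "\<zero>\<^bsub>?F\<^esub> \<in> J" by (rule Q.U_zero)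
    qed
    fix a b :: "'x list \<Rightarrow>\<^sub>0 'k" and c :: 'k assume a: "a \<in> \<Inter> ?Js"
    show "\<ominus>\<^bsub>?F\<^esub> a \<in> \<Inter> ?Js"
    proof
      fix J assume "J \<in> ?Js"
      then show "\<ominus>\<^bsub>?F\<^esub> a \<in> J" using a submoduleE(3)[OF J, of J a] by blast
    qed
    show "c \<odot>\<^bsub>?F\<^esub> a \<in> \<Inter> ?Js"
    proof
      fix J assume "J \<in> ?Js"
      then show "c \<odot>\<^bsub>?F\<^esub> a \<in> J" using a submoduleE(4)[OF J, of J c a] by auto
    qed
    assume b: "b \<in> \<Inter> ?Js"
    show "a \<oplus>\<^bsub>?F\<^esub> b \<in> \<Inter> ?Js"
    proof
      fix J assume "J \<in> ?Js"
      then show "a \<oplus>\<^bsub>?F\<^esub> b \<in> J" using a b submoduleE(5)[OF J, of J a b] by blast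
    qed
  qed
  then show ?thesis unfolding two_sided_ideal_def perm_ideal_eq by blast
qed

lemma perm_relators_subset: "perm_relators X \<subseteq> perm_ideal X"
  unfolding perm_ideal_eq by blast

lemma free_perm_algebra_presentation:
  assumes "free_perm_algebra X sA mA"
  obtains \<phi> :: "'a::ab_group_add \<Rightarrow> ('x list \<Rightarrow>\<^sub>0 'k::field) set" where "inj \<phi>"
    "\<And>a b. \<phi> (a + b) = \<phi> a \<oplus>\<^bsub>Perm X\<^esub> \<phi> b" "\<And>c a. \<phi> (sA c a) = c \<odot>\<^bsub>Perm X\<^esub> \<phi> a"
    "\<And>a b. \<phi> (mA a b) = \<phi> a \<otimes>\<^bsub>Perm X\<^esub> \<phi> b"
    "\<And>a. \<exists>p \<in> carrier (free_assoc X). \<phi> a = perm_ideal X +>\<^bsub>free_assoc X\<^esub> p"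
    "\<And>p. p \<in> carrier (free_assoc X) \<Longrightarrow> \<exists>a. \<phi> a = perm_ideal X +>\<^bsub>free_assoc X\<^esub> p"
proof -
  obtain \<phi> where \<phi>: "algebra_iso (algebra_of sA mA) (Perm X) \<phi>"
    using assms by (auto simp: free_perm_algebra_def)
  have bij: "bij_betw \<phi> UNIV ((\<lambda>p. perm_ideal X +>\<^bsub>free_assoc X\<^esub> p) ` carrier (free_assoc X))"
    using \<phi>
    by (simp add: algebra_iso_def linear_iso_def algebra_of_def Perm_def quotient_ops(3)[OF two_sided_ideal_perm_ideal])
  then have inj: "inj \<phi>" and range: "range \<phi> = (\<lambda>p. perm_ideal X +>\<^bsub>free_assoc X\<^esub> p) ` carrier (free_assoc X)"
    unfolding bij_betw_def by blast+
  show ?thesis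
  proof (rule that[OF inj])
    show "\<exists>p \<in> carrier (free_assoc X). \<phi> a = perm_ideal X +>\<^bsub>free_assoc X\<^esub> p" for a
      using range by blast
    show "\<exists>a. \<phi> a = perm_ideal X +>\<^bsub>free_assoc X\<^esub> p" if "p \<in> carrier (free_assoc X)" for p
    proof -
      have "perm_ideal X +>\<^bsub>free_assoc X\<^esub> p \<in> range \<phi>" using range that by blast
      then show ?thesis by auto
    qed
  qed (use \<phi> in \<open>simp_all add: algebra_iso_def linear_iso_def linear_map_def algebra_of_def\<close>)
qed

lemma free_perm_algebra_perm:
  assumes "free_perm_algebra X sA mA"
  shows "mA a (mA b c) = mA (mA a b) c" "mA (mA a b) c = mA (mA a c) b"
proof -
  obtain \<phi> where \<phi>: "inj \<phi>"
    "\<And>a b. \<phi> (a + b) = \<phi> a \<oplus>\<^bsub>Perm X\<^esub> \<phi> b" "\<And>c a. \<phi> (sA c a) = c \<odot>\<^bsub>Perm X\<^esub> \<phi> a"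
    "\<And>a b. \<phi> (mA a b) = \<phi> a \<otimes>\<^bsub>Perm X\<^esub> \<phi> b"
    "\<And>a. \<exists>p \<in> carrier (free_assoc X). \<phi> a = perm_ideal X +>\<^bsub>free_assoc X\<^esub> p"
    "\<And>p. p \<in> carrier (free_assoc X) \<Longrightarrow> \<exists>a. \<phi> a = perm_ideal X +>\<^bsub>free_assoc X\<^esub> p"
    by (rule free_perm_algebra_presentation[OF assms]) blast
  obtain p where p: "p \<in> carrier (free_assoc X)" "\<phi> a = perm_ideal X +>\<^bsub>free_assoc X\<^esub> p" using \<phi>(5) by blast
  obtain q where q: "q \<in> carrier (free_assoc X)" "\<phi> b = perm_ideal X +>\<^bsub>free_assoc X\<^esub> q" using \<phi>(5) by blast
  obtain r where r: "r \<in> carrier (free_assoc X)" "\<phi> c = perm_ideal X +>\<^bsub>free_assoc X\<^esub> r" using \<phi>(5) by blast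
  note mult = quotient_mult[OF two_sided_ideal_perm_ideal, folded Perm_def]
  note closed = fa_mult_closed[OF p(1) q(1)] fa_mult_closed[OF p(1) r(1)] fa_mult_closed[OF q(1) r(1)]
    fa_mult_closed[OF r(1) q(1)]
  show assoc: "mA a (mA b c) = mA (mA a b) c"
    by (rule injD[OF \<phi>(1)]) (simp only: \<phi>(4) p q r mult closed fa_mult_assoc)
  have "fa_mult p (fa_mult q r) - fa_mult p (fa_mult r q) \<in> perm_ideal X"
    using perm_relators_subset p(1) q(1) r(1) unfolding perm_relators_def by blast
  then have "perm_ideal X +>\<^bsub>free_assoc X\<^esub> fa_mult p (fa_mult q r) = perm_ideal X +>\<^bsub>free_assoc X\<^esub> fa_mult p (fa_mult r q)"
    by (simp add: quotient_eq_iff[OF two_sided_ideal_perm_ideal] fa_mult_closed p(1) closed)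
  then show "mA (mA a b) c = mA (mA a c) b"
    by (intro injD[OF \<phi>(1)]) (simp only: \<phi>(4) p q r mult closed fa_mult_assoc)
qed

text \<open>Sending the generator \<open>x\<close> to \<open>x\<close> and all the others to \<open>y\<close> maps the free Perm algebra to the
  two-dimensional one with \<open>a x = 0\<close> and \<open>a y = a\<close>; these are the coordinates of that map.\<close>

lemma free_perm_algebra_functionals:
  fixes sA :: "'k::field \<Rightarrow> 'a::ab_group_add \<Rightarrow> 'a" and X :: "'x set"
  assumes A: "free_perm_algebra X sA mA" and x: "x \<in> X" and y: "y \<in> X" and xy: "x \<noteq> y"
  obtains \<epsilon> \<mu> :: "'a \<Rightarrow> 'k" and ax ay where "Vector_Spaces.linear sA (*) \<epsilon>"
    "\<And>a b. \<epsilon> (mA a b) = \<epsilon> a * \<mu> b" "\<epsilon> ax = 1" "\<epsilon> ay = 0" "\<mu> ay = 1"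
proof -
  let ?F = "free_assoc X :: ('k, 'x list \<Rightarrow>\<^sub>0 'k) module"
  let ?I = "perm_ideal X :: ('x list \<Rightarrow>\<^sub>0 'k) set"
  have K: "vector_space ((*) :: 'k \<Rightarrow> 'k \<Rightarrow> 'k)" by unfold_locales (simp_all add: algebra_simps)
  \<comment> \<open>On nonempty words \<open>lw\<close> is the coordinate of \<open>x\<close> in the
    two-dimensional algebra, nonzero exactly if the first letter is the only \<open>x\<close>.
    \<open>mw\<close> is the coordinate of \<open>y\<close>, the scalar by which right
    multiplication acts.\<close>
  define lw :: "'x list \<Rightarrow> 'k" where "lw w = (if hd w = x \<and> x \<notin> set (tl w) then 1 else 0)" for w
  define mw :: "'x list \<Rightarrow> 'k" where "mw w = (if x \<notin> set w then 1 else 0)" for w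
  define l where "l = linear_ext ((*) :: 'k \<Rightarrow> 'k \<Rightarrow> 'k) lw"
  define m where "m = linear_ext ((*) :: 'k \<Rightarrow> 'k \<Rightarrow> 'k) mw"
  have lin: "Vector_Spaces.linear free_scale (*) l" "Vector_Spaces.linear free_scale (*) m"
    unfolding l_def m_def by (rule linear_linear_ext[OF K])+
  have l_sum: "l (sum g W) = (\<Sum>w\<in>W. l (g w))" for g :: "'x list \<Rightarrow> _" and W
    by (induction W rule: infinite_finite_induct) (simp_all add: linear_simps[OF lin(1)])
  have m_sum: "m (sum g W) = (\<Sum>w\<in>W. m (g w))" for g :: "'x list \<Rightarrow> _" and W
    by (induction W rule: infinite_finite_induct) (simp_all add: linear_simps[OF lin(2)])
  have single: "l (Poly_Mapping.single w c) = c * lw w" "m (Poly_Mapping.single w c) = c * mw w" for w c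
    by (simp_all add: l_def m_def linear_ext_single[OF K])
  \<comment> \<open>The words of \<open>p\<close> have to be nonempty, since otherwise the first
    letter of \<open>u @ v\<close> would come from \<open>v\<close>.\<close>
  have lm: "l (fa_mult p q) = l p * m q" if p: "p \<in> carrier ?F" for p q
  proof -
    have "lw (u @ v) = lw u * mw v" if "u \<in> Poly_Mapping.keys p" for u v
      using that p by (cases u) (auto simp: lw_def mw_def carrier_free_assoc)
    then have "l (fa_mult p q) = (\<Sum>u\<in>Poly_Mapping.keys p. \<Sum>v\<in>Poly_Mapping.keys q.
        (Poly_Mapping.lookup p u * lw u) * (Poly_Mapping.lookup q v * mw v))"
      unfolding fa_mult_def l_sum single by (intro sum.cong refl) simp
    then show ?thesis by (simp add: l_def m_def linear_ext_def sum_product)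
  qed
  have mm: "m (fa_mult p q) = m p * m q" for p q
  proof -
    have "mw (u @ v) = mw u * mw v" for u v by (simp add: mw_def)
    then have "m (fa_mult p q) = (\<Sum>u\<in>Poly_Mapping.keys p. \<Sum>v\<in>Poly_Mapping.keys q.
        (Poly_Mapping.lookup p u * mw u) * (Poly_Mapping.lookup q v * mw v))"
      unfolding fa_mult_def m_sum single by (intro sum.cong refl) simp
    then show ?thesis by (simp add: m_def linear_ext_def sum_product)
  qed
  \<comment> \<open>The kernel of the map to the two-dimensional algebra. It is an ideal that
    contains the relators, hence contains \<open>?I\<close>, and so \<open>l\<close> and
    \<open>m\<close> descend to cosets.\<close>
  define J where "J = {p \<in> carrier ?F. l p = 0 \<and> m p = 0}"
  interpret F: module field_ring ?F by (rule module_free_assoc)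
  have minus: "\<ominus>\<^bsub>?F\<^esub> p = - p" if "p \<in> carrier ?F" for p
    using F.M.minus_equality[of "- p" p] that by simp
  have J_carrier: "p \<in> carrier ?F" if "p \<in> J" for p using that by (simp add: J_def)
  have "submodule J field_ring ?F"
  proof (rule F.submoduleI)
    fix a b :: "'x list \<Rightarrow>\<^sub>0 'k" and c :: 'k assume a: "a \<in> J"
    have ac: "a \<in> carrier ?F" using a by (rule J_carrier)
    show "\<ominus>\<^bsub>?F\<^esub> a \<in> J" using a minus[OF ac] by (simp add: J_def linear_simps[OF lin(1)] linear_simps[OF lin(2)])
    have "c \<odot>\<^bsub>?F\<^esub> a \<in> carrier ?F" using F.smult_closed[of c a] ac by simp
    then show "c \<odot>\<^bsub>?F\<^esub> a \<in> J" using a by (simp add: J_def linear_simps[OF lin(1)] linear_simps[OF lin(2)])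
    assume b: "b \<in> J"
    have "a \<oplus>\<^bsub>?F\<^esub> b \<in> carrier ?F" using F.M.a_closed[OF ac J_carrier[OF b]] .
    then show "a \<oplus>\<^bsub>?F\<^esub> b \<in> J" using a b by (simp add: J_def linear_simps[OF lin(1)] linear_simps[OF lin(2)])
  qed (auto simp: J_def linear_simps[OF lin(1)] linear_simps[OF lin(2)])
  moreover have "fa_mult p q \<in> J \<and> fa_mult q p \<in> J" if "p \<in> carrier ?F" "q \<in> J" for p q
    unfolding J_def using that fa_mult_closed[of p X q] fa_mult_closed[of q X p] J_carrier[OF that(2)]
    by (simp add: lm mm) (simp add: J_def)
  ultimately have "two_sided_ideal ?F J" unfolding two_sided_ideal_def free_assoc_simps(4) by blast
  moreover have "perm_relators X \<subseteq> J"
  proof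
    fix r :: "'x list \<Rightarrow>\<^sub>0 'k" assume "r \<in> perm_relators X"
    then obtain p q s where pqs: "r = fa_mult p (fa_mult q s) - fa_mult p (fa_mult s q)"
      "p \<in> carrier ?F" "q \<in> carrier ?F" "s \<in> carrier ?F" by (auto simp: perm_relators_def)
    have "fa_mult p (fa_mult q s) \<in> carrier ?F" "fa_mult p (fa_mult s q) \<in> carrier ?F"
      using pqs fa_mult_closed by blast+
    then have "r \<in> carrier ?F"
      using pqs(1) diff_free_assoc by blast
    then show "r \<in> J" using pqs by (simp add: J_def lm mm linear_simps[OF lin(1)] linear_simps[OF lin(2)])
  qed
  ultimately have IJ: "?I \<subseteq> J" unfolding perm_ideal_eq by blast

  obtain \<phi> where \<phi>: "inj \<phi>"
    "\<And>a b. \<phi> (a + b) = \<phi> a \<oplus>\<^bsub>Perm X\<^esub> \<phi> b" "\<And>c a. \<phi> (sA c a) = c \<odot>\<^bsub>Perm X\<^esub> \<phi> a"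
    "\<And>a b. \<phi> (mA a b) = \<phi> a \<otimes>\<^bsub>Perm X\<^esub> \<phi> b"
    "\<And>a. \<exists>p \<in> carrier ?F. \<phi> a = ?I +>\<^bsub>?F\<^esub> p" "\<And>p. p \<in> carrier ?F \<Longrightarrow> \<exists>a. \<phi> a = ?I +>\<^bsub>?F\<^esub> p"
    by (rule free_perm_algebra_presentation[OF A]) blast
  \<comment> \<open>An arbitrary representative; by \<open>eq\<close> the values of \<open>l\<close>
    and \<open>m\<close> do not depend on it.\<close>
  define rep where "rep a = (SOME p. p \<in> carrier ?F \<and> \<phi> a = ?I +>\<^bsub>?F\<^esub> p)" for a
  have rep: "rep a \<in> carrier ?F" "\<phi> a = ?I +>\<^bsub>?F\<^esub> rep a" for a
    unfolding rep_def using someI_ex[of "\<lambda>p. p \<in> carrier ?F \<and> \<phi> a = ?I +>\<^bsub>?F\<^esub> p"] \<phi>(5)[of a] by blast+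
  have eq: "l (rep a) = l p" "m (rep a) = m p" if "p \<in> carrier ?F" "\<phi> a = ?I +>\<^bsub>?F\<^esub> p" for a p
  proof -
    have "rep a - p \<in> ?I"
      using quotient_eq_iff[OF two_sided_ideal_perm_ideal rep(1)[of a] that(1)] rep(2)[of a] that(2) by simp
    then have "l (rep a - p) = 0" "m (rep a - p) = 0" using IJ unfolding J_def by blast+
    then show "l (rep a) = l p" "m (rep a) = m p"
      by (simp_all add: linear_simps[OF lin(1)] linear_simps[OF lin(2)])
  qed
  note ops = quotient_ops[OF two_sided_ideal_perm_ideal, folded Perm_def]
    quotient_mult[OF two_sided_ideal_perm_ideal, folded Perm_def]
  have add: "l (rep (a + b)) = l (rep a) + l (rep b)" for a b
  proof -
    have "rep a + rep b \<in> carrier ?F" using F.M.a_closed[OF rep(1) rep(1)] by simp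
    moreover have "\<phi> (a + b) = ?I +>\<^bsub>?F\<^esub> (rep a + rep b)"
      using ops(1)[OF rep(1) rep(1), of a b] rep(2) \<phi>(2) by simp
    ultimately show ?thesis using eq by (simp add: linear_simps[OF lin(1)])
  qed
  have scale: "l (rep (sA c a)) = c * l (rep a)" for c a
  proof -
    have "free_scale c (rep a) \<in> carrier ?F" using F.smult_closed[of c "rep a"] rep(1) by simp
    moreover have "\<phi> (sA c a) = ?I +>\<^bsub>?F\<^esub> (free_scale c (rep a))"
      using ops(2)[OF rep(1), of c a] rep(2) \<phi>(3) by simp
    ultimately show ?thesis using eq by (simp add: linear_simps[OF lin(1)])
  qed
  have mult: "l (rep (mA a b)) = l (rep a) * m (rep b)" for a b
  proof -
    have "\<phi> (mA a b) = ?I +>\<^bsub>?F\<^esub> (fa_mult (rep a) (rep b))"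
      using ops(4)[OF rep(1) rep(1), of a b] rep(2) \<phi>(4) by simp
    then show ?thesis using eq(1)[OF fa_mult_closed[OF rep(1) rep(1)]] lm[OF rep(1)] by simp
  qed
  have xc: "Poly_Mapping.single [x] 1 \<in> carrier ?F" and yc: "Poly_Mapping.single [y] 1 \<in> carrier ?F"
    using x y by (auto simp: carrier_free_assoc)
  obtain ax where ax: "\<phi> ax = ?I +>\<^bsub>?F\<^esub> Poly_Mapping.single [x] 1" using \<phi>(6)[OF xc] by blast
  obtain ay where ay: "\<phi> ay = ?I +>\<^bsub>?F\<^esub> Poly_Mapping.single [y] 1" using \<phi>(6)[OF yc] by blast
  show ?thesis
  proof (rule that[of "\<lambda>a. l (rep a)" "\<lambda>a. m (rep a)" ax ay])
    show "Vector_Spaces.linear sA (*) (\<lambda>a. l (rep a))"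
      using A by (intro linearI K add scale) (simp add: free_perm_algebra_def)
    show "l (rep (mA a b)) = l (rep a) * m (rep b)" for a b by (rule mult)
    show "l (rep ax) = 1" using eq(1)[OF xc ax] by (simp add: single lw_def)
    show "l (rep ay) = 0" "m (rep ay) = 1" using eq[OF yc ay] xy by (simp_all add: single lw_def mw_def)
  qed
qed

section \<open>The embedding and its exact sequences\<close>

context perm_pre_lie begin

abbreviation "CPre \<equiv> pre_cochains sP sN"
abbreviation "dPre \<equiv> pre_coboundary mP sN lN rN"
abbreviation "CLie \<equiv> lie_cochains sT sS"
abbreviation "dLie \<equiv> lie_coboundary sS br act"
abbreviation "\<Psi> \<equiv> Psi mA sT \<tau> sS \<sigma>"

lemma foldl_mA_rev: "foldl mA a (rev xs) = foldl mA a xs"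
  by (induction xs arbitrary: a) (simp_all add: foldl_mA_right)

lemma Psi_value_eq: "length as = length bs \<Longrightarrow> Psi_value mA sS \<sigma> f as bs = Psi_c (curry1 f) as bs"
  unfolding Psi_value_def Psi_c_def
proof (intro sum.cong refl)
  fix i assume "i \<in> {..<length as}"
  \<comment> \<open>The reversed initial segment begins with \<open>as ! i\<close>; behind the first
    factor the reversal has no effect.\<close>
  then have "list_product mA (rev (take (Suc i) as) @ drop (Suc i) as) = foldl mA (as ! i) (del_nth i as)"
    by (simp add: take_Suc_conv_app_nth del_nth_def foldl_mA_rev)
  then show "sS ((- 1) ^ i) (\<sigma> (list_product mA (rev (take (Suc i) as) @ drop (Suc i) as)) (f (bs ! i # del_nth i bs))) =
      sS ((- 1) ^ i) (\<sigma> (foldl mA (as ! i) (del_nth i as)) (curry1 f (del_nth i bs) (bs ! i)))"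
    by (simp add: curry1_def)
qed

text \<open>Evaluates the definite description in \<open>Psi\<close>: the alternating sum is
  multilinear with the prescribed values at pure tensors, and those values determine a multilinear
  map.\<close>

lemma Psi_eq:
  assumes "f \<in> carrier (CPre n)"
  shows "\<Psi> n f = (\<lambda>us. if length us = n then L.altern us (G (curry1 f)) else 0)"
proof -
  let ?g = "\<lambda>us. if length us = n then L.altern us (G (curry1 f)) else 0"
  have pure: "?g (map2 \<tau> as bs) = Psi_value mA sS \<sigma> f as bs" if l: "length as = n" "length bs = n" for as bs
  proof (cases n)
    case 0
    then show ?thesis using l by (simp add: Psi_value_def)
  next
    case (Suc m)
    then have "hom.cochain m (curry1 f)" using assms by (simp add: carrier_pre_cochains_Suc)
    then show ?thesis using altern_G_pure[of m "curry1 f" as bs] l Suc by (simp add: Psi_value_eq)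
  qed
  have ml: "multilinear sT sS n ?g"
  proof (cases n)
    case (Suc m)
    then have "hom.cochain m (curry1 f)" using assms by (simp add: carrier_pre_cochains_Suc)
    from cochain_altern_G[OF this] show ?thesis using Suc by (simp add: L.cochain_def multilinear_def)
  qed simp
  show ?thesis
    unfolding Psi_def
  proof (rule the_equality)
    show "(\<forall>us. length us \<noteq> n \<longrightarrow> ?g us = 0) \<and> multilinear sT sS n ?g \<and>
        (\<forall>as bs. length as = n \<and> length bs = n \<longrightarrow> ?g (map2 \<tau> as bs) = Psi_value mA sS \<sigma> f as bs)"
    proof (intro conjI allI impI)
      show "multilinear sT sS n ?g" by (rule ml)
      show "?g (map2 \<tau> as bs) = Psi_value mA sS \<sigma> f as bs" if "length as = n \<and> length bs = n" for as bs
        using pure that by blast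
    qed simp
    fix h assume h: "(\<forall>us. length us \<noteq> n \<longrightarrow> h us = 0) \<and> multilinear sT sS n h \<and>
        (\<forall>as bs. length as = n \<and> length bs = n \<longrightarrow> h (map2 \<tau> as bs) = Psi_value mA sS \<sigma> f as bs)"
    have "h us = ?g us" for us
    proof (cases "length us = n")
      case True
      show ?thesis
      proof (rule T.multilinear_eq[OF _ ml _ True])
        show "multilinear sT sS n h" using h by blast
        show "h (map2 \<tau> as bs) = ?g (map2 \<tau> as bs)" if "length as = n" "length bs = n" for as bs
          using h pure[OF that] that by simp
      qed
    qed (use h in simp)
    then show "h = ?g" by blast
  qed
qed

lemma Psi_carrier:
  assumes "f \<in> carrier (CPre n)" shows "\<Psi> n f \<in> carrier (CLie n)"
proof (cases n)
  case 0
  then show ?thesis unfolding Psi_eq[OF assms] by (simp add: L.carrier_lie_cochains)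
next
  case (Suc m)
  then have "hom.cochain m (curry1 f)" using assms by (simp add: carrier_pre_cochains_Suc)
  from L.cochain_cong[OF cochain_altern_G[OF this]]
  have "L.cochain n (\<lambda>us. if length us = n then L.altern us (G (curry1 f)) else 0)"
    using Suc by simp
  then show ?thesis unfolding Psi_eq[OF assms] by (simp add: L.carrier_lie_cochains)
qed

lemma Psi_pure:
  assumes "f \<in> carrier (CPre n)" "length as = n" "length bs = n"
  shows "\<Psi> n f (map2 \<tau> as bs) = Psi_c (curry1 f) as bs"
proof (cases n)
  case 0
  then show ?thesis using assms unfolding Psi_eq[OF assms(1)] by (simp add: Psi_c_def)
next
  case (Suc m)
  then have "hom.cochain m (curry1 f)" using assms by (simp add: carrier_pre_cochains_Suc)
  then show ?thesis using altern_G_pure[of m "curry1 f" as bs] assms(2,3) Suc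
    unfolding Psi_eq[OF assms(1)] by simp
qed

lemma lie_cochains_eqI:
  assumes "f \<in> carrier (CLie n)" "g \<in> carrier (CLie n)"
    and "\<And>as bs. length as = n \<Longrightarrow> length bs = n \<Longrightarrow> f (map2 \<tau> as bs) = g (map2 \<tau> as bs)"
  shows "f = g"
proof
  fix us
  have ml: "multilinear sT sS n f" "multilinear sT sS n g"
    and "length us \<noteq> n \<Longrightarrow> f us = 0" "length us \<noteq> n \<Longrightarrow> g us = 0"
    using assms(1,2) by (simp_all add: L.carrier_lie_cochains L.cochain_def)
  then show "f us = g us" using T.multilinear_eq[OF ml assms(3)] by (cases "length us = n") auto
qed

lemma cochain_map_Psi: "cochain_map CPre dPre CLie dLie \<Psi>"
  unfolding cochain_map_def linear_map_def
proof (intro allI conjI ballI funcsetI)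
  fix n f c assume f: "f \<in> carrier (CPre n)"
  interpret Pre: complex CPre dPre by unfold_locales (rule cochain_complex_pre)
  interpret Lie: complex CLie dLie by unfold_locales (simp add: L.cochain_complex_lie)
  have lie_add: "F \<oplus>\<^bsub>CLie n\<^esub> F' = (\<lambda>us. F us + F' us)" and lie_scale: "c \<odot>\<^bsub>CLie n\<^esub> F = (\<lambda>us. sS c (F us))"
    for F F' c by (simp_all add: lie_cochains_def)
  show Pf: "\<Psi> n f \<in> carrier (CLie n)" using f by (rule Psi_carrier)
  show "\<Psi> n (c \<odot>\<^bsub>CPre n\<^esub> f) = c \<odot>\<^bsub>CLie n\<^esub> \<Psi> n f"
  proof (rule lie_cochains_eqI)
    have cf: "c \<odot>\<^bsub>CPre n\<^esub> f \<in> carrier (CPre n)" using Pre.D.M.smult_closed[of c f n] f by simp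
    show "\<Psi> n (c \<odot>\<^bsub>CPre n\<^esub> f) \<in> carrier (CLie n)" using cf by (rule Psi_carrier)
    show "c \<odot>\<^bsub>CLie n\<^esub> \<Psi> n f \<in> carrier (CLie n)" using Lie.D.M.smult_closed[of c "\<Psi> n f" n] Pf by simp
    fix as bs assume l: "length (as :: 'a list) = n" "length (bs :: 'p list) = n"
    show "\<Psi> n (c \<odot>\<^bsub>CPre n\<^esub> f) (map2 \<tau> as bs) = (c \<odot>\<^bsub>CLie n\<^esub> \<Psi> n f) (map2 \<tau> as bs)"
      unfolding Psi_pure[OF cf l] lie_scale Psi_pure[OF f l]
      by (simp add: Psi_c_def curry1_def S.tau_simps S.T.scale_sum_right mult.commute)
  qed
  show "\<Psi> (Suc n) (dPre n f) = dLie n (\<Psi> n f)"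
  proof (rule lie_cochains_eqI)
    have df: "dPre n f \<in> carrier (CPre (Suc n))" using f by simp
    show "\<Psi> (Suc n) (dPre n f) \<in> carrier (CLie (Suc n))" using df by (rule Psi_carrier)
    show "dLie n (\<Psi> n f) \<in> carrier (CLie (Suc n))" using Pf by simp
    fix as bs assume l: "length (as :: 'a list) = Suc n" "length (bs :: 'p list) = Suc n"
    have coch: "n = 0 \<or> hom.cochain (n - 1) (curry1 f)"
      using f by (cases n) (simp_all add: carrier_pre_cochains_Suc)
    have lPf: "L.cochain n (\<Psi> n f)" using Pf by (simp add: L.carrier_lie_cochains)
    have "dLie n (\<Psi> n f) (map2 \<tau> as bs) = L.ce_d (map2 \<tau> as bs) (\<Psi> n f)"
      using L.lie_coboundary_eq_ce_d[OF lPf] l by simp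
    also have "\<dots> = L.ce_d (map2 \<tau> as bs) (\<lambda>us. L.altern us (G (curry1 f)))"
      using l by (intro L.ce_d_cong) (simp add: Psi_eq[OF f])
    also have "\<dots> = Psi_c (\<lambda>bs. hom.ce_d bs (curry1 f)) as bs"
      by (rule ce_d_altern_G[OF coch l])
    also have "\<dots> = Psi_c (curry1 (dPre n f)) as bs"
    proof -
      have "hom.ce_d ps (curry1 f) = curry1 (dPre n f) ps" if "length ps = n" for ps
      proof (cases n)
        case 0
        then show ?thesis using that by (simp add: pre_coboundary_0 curry1_def fun_eq_iff)
      next
        case (Suc m)
        then show ?thesis using pre_coboundary_eq_ce_d[of m f ps] coch that by simp
      qed
      then show ?thesis unfolding Psi_c_def using l by (intro sum.cong) auto
    qed
    also have "\<dots> = \<Psi> (Suc n) (dPre n f) (map2 \<tau> as bs)" using Psi_pure[OF df l] by simp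
    finally show "\<Psi> (Suc n) (dPre n f) (map2 \<tau> as bs) = dLie n (\<Psi> n f) (map2 \<tau> as bs)" by simp
  qed
  fix g assume g: "g \<in> carrier (CPre n)"
  show "\<Psi> n (f \<oplus>\<^bsub>CPre n\<^esub> g) = \<Psi> n f \<oplus>\<^bsub>CLie n\<^esub> \<Psi> n g"
  proof (rule lie_cochains_eqI)
    have fg: "f \<oplus>\<^bsub>CPre n\<^esub> g \<in> carrier (CPre n)" using Pre.D.M.a_closed[OF f g] .
    show "\<Psi> n (f \<oplus>\<^bsub>CPre n\<^esub> g) \<in> carrier (CLie n)" using fg by (rule Psi_carrier)
    show "\<Psi> n f \<oplus>\<^bsub>CLie n\<^esub> \<Psi> n g \<in> carrier (CLie n)" using Lie.D.M.a_closed[OF Pf Psi_carrier[OF g]] .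
    fix as bs assume l: "length (as :: 'a list) = n" "length (bs :: 'p list) = n"
    show "\<Psi> n (f \<oplus>\<^bsub>CPre n\<^esub> g) (map2 \<tau> as bs) = (\<Psi> n f \<oplus>\<^bsub>CLie n\<^esub> \<Psi> n g) (map2 \<tau> as bs)"
      unfolding Psi_pure[OF fg l] lie_add Psi_pure[OF f l] Psi_pure[OF g l]
      by (simp add: Psi_c_def curry1_def S.tau_simps S.T.scale_right_distrib sum.distrib)
  qed
qed

lemma inj_on_Psi:
  assumes \<epsilon>: "Vector_Spaces.linear sA (*) \<epsilon>" "\<And>a b. \<epsilon> (mA a b) = \<epsilon> a * \<mu> b"
    and xy: "\<epsilon> x = 1" "\<epsilon> y = 0" "\<mu> y = 1"
  shows "inj_on (\<Psi> n) (carrier (CPre n))"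
proof (rule inj_onI)
  fix f g assume f: "f \<in> carrier (CPre n)" and g: "g \<in> carrier (CPre n)" and eq: "\<Psi> n f = \<Psi> n g"
  have bil: "bilinear_map sA sN sN (\<lambda>a m. sN (\<epsilon> a) m)"
    unfolding bilinear_map_def
    by (auto intro!: linearI N.vector_space_axioms T.A.vector_space_axioms
        simp: linear_simps[OF \<epsilon>(1)] N.scale_left_distrib N.scale_right_distrib mult.commute)
  \<comment> \<open>Applies \<open>\<epsilon>\<close> to the factor in \<open>A\<close>, and so
    reads off an element of \<open>N\<close>.\<close>
  define \<Lambda> where "\<Lambda> = tensor_lift sS \<sigma> sN (\<lambda>a m. sN (\<epsilon> a) m)"
  have \<Lambda>: "Vector_Spaces.linear sS sN \<Lambda>" and \<Lambda>_pure: "\<Lambda> (\<sigma> a m) = sN (\<epsilon> a) m" for a m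
    unfolding \<Lambda>_def using S.tensor_lift[OF bil] by simp_all
  have \<Lambda>_sum: "\<Lambda> (sum h I) = (\<Sum>i\<in>I. \<Lambda> (h i))" for h and I :: "nat set"
    by (induction I rule: infinite_finite_induct) (simp_all add: linear_simps[OF \<Lambda>])
  have zero: "\<epsilon> (foldl mA a as) = 0" if "\<epsilon> a = 0" for a as
    using that by (induction as arbitrary: a) (simp_all add: \<epsilon>(2))
  have one: "\<epsilon> (foldl mA a (replicate m y)) = \<epsilon> a" for a m
    by (induction m arbitrary: a) (simp_all add: \<epsilon>(2) xy)
  \<comment> \<open>Summand 0 has first factor \<open>x\<close> and contributes
    \<open>\<epsilon> x\<close> times a power of \<open>\<mu> y\<close>, which is 1. Every other
    summand has first factor \<open>y\<close>, and \<open>\<epsilon> y = 0\<close> kills its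
    product.\<close>
  have Psi_at: "\<Lambda> (Psi_c c (x # replicate m y) (b # bs)) = c bs b" for c b bs m
  proof -
    have "\<Lambda> (Psi_c c (x # replicate m y) (b # bs)) = c bs b + (\<Sum>i<m. 0)"
      unfolding Psi_c_def length_Cons length_replicate sum.lessThan_Suc_shift \<Lambda>_sum linear_simps[OF \<Lambda>] \<Lambda>_pure
      by (intro arg_cong2[where f = "(+)"] sum.cong refl) (simp_all add: one xy zero \<epsilon>(2))
    then show ?thesis by simp
  qed
  show "f = g"
  proof (cases n)
    case 0
    then show ?thesis using f g by simp
  next
    case (Suc m)
    show ?thesis
    proof
      fix bs
      show "f bs = g bs"
      proof (cases "length bs = n")
        case True
        then obtain b bs' where bs: "bs = b # bs'" "length bs' = m" using Suc by (auto simp: length_Suc_conv)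
        let ?as = "x # replicate m y"
        have "Psi_c (curry1 f) ?as bs = Psi_c (curry1 g) ?as bs"
          using Psi_pure[OF f, of ?as bs] Psi_pure[OF g, of ?as bs] eq bs Suc by simp
        then show ?thesis
          using Psi_at[of "curry1 f" m b bs'] Psi_at[of "curry1 g" m b bs'] bs(1)
          by (simp add: curry1_def)
      next
        case False
        then show ?thesis using f g Suc by (simp add: carrier_pre_cochains_Suc)
      qed
    qed
  qed
qed

end

theorem corollary5p7:
  fixes X :: "'x set"
    and sA :: "'k::field \<Rightarrow> 'a::ab_group_add \<Rightarrow> 'a" and mA :: "'a \<Rightarrow> 'a \<Rightarrow> 'a"
    and sP :: "'k \<Rightarrow> 'p::ab_group_add \<Rightarrow> 'p" and mP :: "'p \<Rightarrow> 'p \<Rightarrow> 'p"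
    and sN :: "'k \<Rightarrow> 'n::ab_group_add \<Rightarrow> 'n"
    and lN :: "'p \<Rightarrow> 'n \<Rightarrow> 'n" and rN :: "'n \<Rightarrow> 'p \<Rightarrow> 'n"
    and sAP :: "'k \<Rightarrow> 't::ab_group_add \<Rightarrow> 't" and tAP :: "'a \<Rightarrow> 'p \<Rightarrow> 't"
    and sAN :: "'k \<Rightarrow> 's::ab_group_add \<Rightarrow> 's" and tAN :: "'a \<Rightarrow> 'n \<Rightarrow> 's"
  assumes "free_perm_algebra X sA mA"
    and "pre_lie_algebra sP mP"
    and "pre_lie_bimodule sP mP sN lN rN"
    and "tensor_product sA sP sAP tAP"
    and "tensor_product sA sN sAN tAN"
  defines "CPre \<equiv> pre_cochains sP sN"
    and "dPre \<equiv> pre_coboundary mP sN lN rN"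
    and "CLie \<equiv> lie_cochains sAP sAN"
    and "dLie \<equiv> lie_coboundary sAN (tensor_bracket mA mP sAP tAP)
                  (tensor_action mA lN rN sAP tAP sAN tAN)"
    and "\<Psi> \<equiv> Psi mA sAP tAP sAN tAN"
  defines "Q \<equiv> quotient_complex CPre CLie \<Psi>"
    and "dQ \<equiv> quotient_differential CPre CLie dLie \<Psi>"
    and "\<pi> \<equiv> quotient_projection CPre CLie \<Psi>"
  shows "cochain_complex CPre dPre \<and> cochain_complex CLie dLie \<and>
    cochain_map CPre dPre CLie dLie \<Psi> \<and>
    (\<forall>n. \<forall>f\<in>carrier (CPre n). \<forall>as bs. length as = n \<and> length bs = n \<longrightarrow>
       \<Psi> n f (map2 tAP as bs) = Psi_value mA sAN tAN f as bs) \<and>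
    ((\<exists>x\<in>X. \<exists>y\<in>X. x \<noteq> y) \<longrightarrow> (\<forall>n. inj_on (\<Psi> n) (carrier (CPre n)))) \<and>
    ((\<forall>n. inj_on (\<Psi> n) (carrier (CPre n))) \<longrightarrow>
       short_exact CPre dPre CLie dLie Q dQ \<Psi> \<pi> \<and>
       long_exact_sequence CPre dPre CLie dLie Q dQ \<Psi> \<pi>)"
proof -
  have "vector_space sA" "bilinear_map sA sA sA mA" using assms(1) by (simp_all add: free_perm_algebra_def)
  moreover have "vector_space sP" "vector_space sN" using assms(2,3)
    by (simp_all add: pre_lie_algebra_def pre_lie_bimodule_def)
  moreover have "vector_space sAP" "vector_space sAN" using assms(4,5) by (simp_all add: tensor_product_def)
  ultimately interpret perm_pre_lie sP mP sN lN rN sA sAP tAP sAN tAN mA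
    using assms(2-5) free_perm_algebra_perm[OF assms(1)]
    by (intro perm_pre_lie.intro pre_lie_module.intro tensor.intro tensor_axioms.intro perm_pre_lie_axioms.intro)
  have dLie: "dLie = lie_coboundary sAN br act" by (simp add: dLie_def br_def act_def)
  have Pre: "cochain_complex CPre dPre" unfolding CPre_def dPre_def by (rule cochain_complex_pre)
  have Lie: "cochain_complex CLie dLie" unfolding CLie_def dLie by (rule L.cochain_complex_lie[OF refl])
  have map: "cochain_map CPre dPre CLie dLie \<Psi>"
    unfolding CPre_def dPre_def CLie_def dLie \<Psi>_def by (rule cochain_map_Psi)
  have Psi_at: "\<Psi> n f (map2 tAP as bs) = Psi_value mA sAN tAN f as bs"
    if "f \<in> carrier (CPre n)" "length as = n" "length bs = n" for n f as bs
    using that Psi_pure[of f n as bs] by (simp add: CPre_def \<Psi>_def Psi_value_eq)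
  have inj: "inj_on (\<Psi> n) (carrier (CPre n))" if "x \<in> X" "y \<in> X" "x \<noteq> y" for x y n
  proof (rule free_perm_algebra_functionals[OF assms(1) that])
    fix \<epsilon> \<mu> ax ay
    assume "Vector_Spaces.linear sA (*) \<epsilon>" "\<And>a b. \<epsilon> (mA a b) = \<epsilon> a * \<mu> b" "\<epsilon> ax = 1" "\<epsilon> ay = 0" "\<mu> ay = 1"
    then show ?thesis unfolding CPre_def \<Psi>_def by (rule inj_on_Psi)
  qed
  \<comment> \<open>From here the argument is pure homological algebra: \<open>\<Psi>\<close> enters
    as an injective cochain map between two complexes.\<close>
  have exact: "short_exact CPre dPre CLie dLie Q dQ \<Psi> \<pi> \<and> long_exact_sequence CPre dPre CLie dLie Q dQ \<Psi> \<pi>"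
    if "\<forall>n. inj_on (\<Psi> n) (carrier (CPre n))"
  proof -
    have "short_exact CPre dPre CLie dLie Q dQ \<Psi> \<pi>"
      unfolding Q_def dQ_def \<pi>_def using that by (intro short_exact_quotient_complex Pre Lie map) blast
    then show ?thesis
      using short_exact_sequence.long_exact[OF short_exact_sequence.intro] by blast
  qed
  show ?thesis using Pre Lie map Psi_at inj exact by blast
qed

end
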